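(* Let $A$ be an $n\times n$ real constant matrix with $\mathrm{Re}(\sigma(A))<0$. Consider the time-changed stochastic system $$\mathrm{d}X(t)=AX(t)\,\mathrm{d}E_t+f(E_t,X(t))\,\mathrm{d}B_{E_t},\qquad X(0)=x_0\in\mathbb{R}^n,$$ where $B_t$ is a standard (one-dimensional) Brownian motion. Suppose $f:\mathbb{R}^+\times\mathbb{R}^n\to\mathbb{R}^n$ is a nonlinear function which satisfies $$\|f(E_t,X(t))\|\le\|g(E_t)\|\,\|X(t)\|$$ with a function $g:\mathbb{R}^+\to\mathbb{R}$ satisfying $$\int_0^\infty\|g(s)\|^2\,\mathrm{d}s<\infty.$$ Then the trivial solution of the system is square-mean asymptotically stable.
   Context: $U(t)$ is a $\beta$-stable subordinator, $\beta\in(0,1)$: a strictly increasing $\beta$-stable L\'evy process with $\mathbb{E}[\exp(-sU(t))]=\exp(-ts^\beta)$. Its inverse is $E_t=\inf\{s>0:U(s)>t\}$, a continuous nondecreasing process. Let $$\mathcal{F}_t=\bigcap_{u>t}\big\{\sigma(B_s:0\le s\le u)\vee\sigma(E_s:s\ge0)\big\},$$ where $\sigma_1\vee\sigma_2$ is the $\sigma$-field generated by $\sigma_1\cup\sigma_2$. Throughout, as in the paper, the time-changed Brownian motion $B_{E_t}$ is a square integrable martingale with respect to $\{\mathcal{F}_{E_t}\}_{t\ge0}$ with quadratic variation $\langle B_{E_t},B_{E_t}\rangle=E_t$. The equation is understood in integral form, in the filtration $\{\mathcal{F}_{E_t}\}$, with pathwise Lebesgue--Stieltjes integrals with respect to $E_t$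 and stochastic integrals with respect to $B_{E_t}$. $\sigma(A)$ is the spectrum of $A$, and $\mathrm{Re}(\sigma(A))<0$ means that every eigenvalue of $A$ has negative real part. $X(t)=X_t(x_0)$ denotes the solution with (deterministic) initial value $x_0$; it is assumed that the coefficients vanish at $x=0$ (so $f(E_t,0)=0$ for all $t\ge0$), whence $X\equiv0$ is the solution for $x_0=0$, called the trivial solution. Definition. The trivial solution is square-mean asymptotically stable (that is, $p$th moment asymptotically stable with $p=2$) if there are a function $\nu:[0,\infty)\to[0,\infty)$ decaying to $0$ as $t\to\infty$ and a positive constant $K$ such that $\mathbb{E}\|X_t(x_0)\|^2\le K\|x_0\|^2\nu(t)$ for all $t\ge0$ and $x_0\in\mathbb{R}^n$. *)

theory Defs
  imports "HOL-Probability.Probability"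
begin

text \<open>
  Processes are functions \<open>real \<Rightarrow> 'w \<Rightarrow> 'b\<close>; only the times \<open>t \<ge> 0\<close> matter. Path properties are
  required almost surely, so that no particular version of a process is singled out.
\<close>

section \<open>Brownian motion, stable subordinators and their inverses\<close>

text \<open>Stochastic continuity follows from stationarity and right continuity at \<open>0\<close>.\<close>

definition levy_process :: "'w measure \<Rightarrow> (real \<Rightarrow> 'w \<Rightarrow> real) \<Rightarrow> bool" where
  "levy_process M X \<longleftrightarrow>
     (\<forall>t\<ge>0. X t \<in> borel_measurable M) \<and>
     (AE \<omega> in M. X 0 \<omega> = 0) \<and>
     (\<forall>\<tau>::nat \<Rightarrow> real. 0 \<le> \<tau> 0 \<and> incseq \<tau> \<longrightarrow>
        prob_space.indep_vars M (\<lambda>_. borel) (\<lambda>i \<omega>. X (\<tau> (Suc i)) \<omega> - X (\<tau> i) \<omega>) UNIV) \<and>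
     (\<forall>s\<ge>0. \<forall>h\<ge>0. distr M borel (\<lambda>\<omega>. X (s + h) \<omega> - X s \<omega>) = distr M borel (X h)) \<and>
     (AE \<omega> in M. (\<forall>t\<ge>0. continuous (at_right t) (\<lambda>s. X s \<omega>)) \<and>
                 (\<forall>t>0. \<exists>l. ((\<lambda>s. X s \<omega>) \<longlongrightarrow> l) (at_left t)))"

definition standard_brownian_motion :: "'w measure \<Rightarrow> (real \<Rightarrow> 'w \<Rightarrow> real) \<Rightarrow> bool" where
  "standard_brownian_motion M B \<longleftrightarrow>
     levy_process M B \<and>
     (\<forall>t>0. distributed M lborel (B t) (normal_density 0 (sqrt t))) \<and>
     (AE \<omega> in M. continuous_on {0..} (\<lambda>t. B t \<omega>))"

definition stable_subordinator :: "'w measure \<Rightarrow> real \<Rightarrow> (real \<Rightarrow> 'w \<Rightarrow> real) \<Rightarrow> bool" where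
  "stable_subordinator M \<beta> U \<longleftrightarrow>
     levy_process M U \<and>
     (AE \<omega> in M. strict_mono_on {0..} (\<lambda>t. U t \<omega>)) \<and>
     (\<forall>t\<ge>0. \<forall>s\<ge>0. prob_space.expectation M (\<lambda>\<omega>. exp (- s * U t \<omega>)) = exp (- t * s powr \<beta>))"

definition inverse_subordinator :: "(real \<Rightarrow> 'w \<Rightarrow> real) \<Rightarrow> real \<Rightarrow> 'w \<Rightarrow> real" where
  "inverse_subordinator U t \<omega> = Inf {s. 0 < s \<and> t < U s \<omega>}"


section \<open>The time-changed filtration\<close>

text \<open>
  The intersection below is already a \<open>\<sigma>\<close>-algebra; the outer \<^const>\<open>sigma\<close> only turns it into a
  measure, as the library represents \<open>\<sigma>\<close>-algebras.
\<close>

definition joint_filtration ::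
    "'w measure \<Rightarrow> (real \<Rightarrow> 'w \<Rightarrow> real) \<Rightarrow> (real \<Rightarrow> 'w \<Rightarrow> real) \<Rightarrow> real \<Rightarrow> 'w measure" where
  "joint_filtration M B E t = sigma (space M)
     (\<Inter>u\<in>{t<..}. sigma_sets (space M)
        ({B s -` S \<inter> space M | s S. 0 \<le> s \<and> s \<le> u \<and> S \<in> sets borel} \<union>
         {E s -` S \<inter> space M | s S. 0 \<le> s \<and> S \<in> sets borel}))"

definition time_changed_filtration ::
    "'w measure \<Rightarrow> (real \<Rightarrow> 'w \<Rightarrow> real) \<Rightarrow> (real \<Rightarrow> 'w \<Rightarrow> real) \<Rightarrow> real \<Rightarrow> 'w measure" where
  "time_changed_filtration M B E t =
     filtration.pre_sigma (space M) (joint_filtration M B E) (E t)"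


section \<open>Martingales and quadratic variation\<close>

definition martingale ::
    "'w measure \<Rightarrow> (real \<Rightarrow> 'w measure) \<Rightarrow> (real \<Rightarrow> 'w \<Rightarrow> real) \<Rightarrow> bool" where
  "martingale M G N \<longleftrightarrow>
     (\<forall>t\<ge>0. subalgebra M (G t)) \<and>
     (\<forall>s\<ge>0. \<forall>t\<ge>s. subalgebra (G t) (G s)) \<and>
     (\<forall>t\<ge>0. N t \<in> borel_measurable (G t) \<and> integrable M (N t)) \<and>
     (\<forall>s\<ge>0. \<forall>t\<ge>s. AE \<omega> in M. real_cond_exp M (G s) (N t) \<omega> = N s \<omega>)"

definition square_integrable_martingale ::
    "'w measure \<Rightarrow> (real \<Rightarrow> 'w measure) \<Rightarrow> (real \<Rightarrow> 'w \<Rightarrow> real) \<Rightarrow> bool" where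
  "square_integrable_martingale M G N \<longleftrightarrow>
     martingale M G N \<and> (\<forall>t\<ge>0. integrable M (\<lambda>\<omega>. (N t \<omega>)\<^sup>2))"

text \<open>
  For a continuous square integrable martingale \<open>N\<close> there is, up to indistinguishability, exactly
  one such process \<open>Q\<close>, the quadratic variation of \<open>N\<close>.
\<close>

definition quadratic_variation ::
    "'w measure \<Rightarrow> (real \<Rightarrow> 'w measure) \<Rightarrow> (real \<Rightarrow> 'w \<Rightarrow> real) \<Rightarrow> (real \<Rightarrow> 'w \<Rightarrow> real) \<Rightarrow> bool" where
  "quadratic_variation M G N Q \<longleftrightarrow>
     (\<forall>t\<ge>0. Q t \<in> borel_measurable (G t)) \<and>
     (AE \<omega> in M. Q 0 \<omega> = 0 \<and> mono_on {0..} (\<lambda>t. Q t \<omega>) \<and> continuous_on {0..} (\<lambda>t. Q t \<omega>)) \<and>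
     martingale M G (\<lambda>t \<omega>. (N t \<omega>)\<^sup>2 - Q t \<omega>)"


section \<open>Stieltjes measures and stochastic integrals\<close>

text \<open>
  \<^const>\<open>interval_measure\<close> needs a nondecreasing right-continuous function on the whole real line;
  the path is continued by its initial value, so that negative times get no mass.
\<close>

definition stieltjes_measure :: "(real \<Rightarrow> 'w \<Rightarrow> real) \<Rightarrow> 'w \<Rightarrow> real measure" where
  "stieltjes_measure Q \<omega> = interval_measure (\<lambda>s. Q (max 0 s) \<omega>)"

text \<open>
  A list of triples \<open>(a, b, \<xi>)\<close> stands for the simple predictable process
  \<open>\<Sum> \<xi> \<cdot> 1\<^bsub>(a,b]\<^esub>\<close> with bounded \<open>\<xi>\<close> known at time \<open>a\<close>.
\<close>

type_synonym ('w, 'v) simple_process = "(real \<times> real \<times> ('w \<Rightarrow> 'v)) list"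

definition simple_predictable ::
    "(real \<Rightarrow> 'w measure) \<Rightarrow> ('w, 'v::euclidean_space) simple_process \<Rightarrow> bool" where
  "simple_predictable G S \<longleftrightarrow>
     (\<forall>(a, b, \<xi>)\<in>set S. 0 \<le> a \<and> a \<le> b \<and> \<xi> \<in> borel_measurable (G a) \<and> bounded (\<xi> ` space (G a)))"

definition simple_value ::
    "('w, 'v::euclidean_space) simple_process \<Rightarrow> real \<Rightarrow> 'w \<Rightarrow> 'v" where
  "simple_value S t \<omega> = (\<Sum>(a, b, \<xi>)\<leftarrow>S. indicator {a<..b} t *\<^sub>R \<xi> \<omega>)"

definition simple_integral ::
    "(real \<Rightarrow> 'w \<Rightarrow> real) \<Rightarrow> ('w, 'v::euclidean_space) simple_process \<Rightarrow> real \<Rightarrow> 'w \<Rightarrow> 'v" where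
  "simple_integral N S t \<omega> = (\<Sum>(a, b, \<xi>)\<leftarrow>S. (N (min t b) \<omega> - N (min t a) \<omega>) *\<^sub>R \<xi> \<omega>)"

text \<open>
  \<open>J\<close> is the Ito integral process \<open>J\<^sub>t = \<integral>\<^sub>0\<^sup>t H\<^sub>s dN\<^sub>s\<close> for a continuous square integrable
  martingale \<open>N\<close> with quadratic variation \<open>Q\<close>: the simple integrals of some sequence of simple
  predictable processes approximating \<open>H\<close> in \<open>L\<^sup>2(dQ)\<close> on compact time intervals converge to \<open>J\<close>
  uniformly on compact time intervals. Both limits are usually taken in probability; as the
  sequence is existentially quantified and may be thinned out, almost sure limits define the same
  integral. It is unique up to indistinguishability, and it exists for every progressively
  measurable \<open>H\<close> with \<open>\<integral>\<^sub>0\<^sup>T \<parallel>H\<^sub>s\<parallel>\<^sup>2 dQ\<^sub>s < \<infinity>\<close> almost surely for all \<open>T\<close>; such \<open>H\<close> need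
  not be square integrable with respect to the product measure.
\<close>

definition has_stochastic_integral ::
    "'w measure \<Rightarrow> (real \<Rightarrow> 'w measure) \<Rightarrow> (real \<Rightarrow> 'w \<Rightarrow> real) \<Rightarrow> (real \<Rightarrow> 'w \<Rightarrow> real) \<Rightarrow>
     (real \<Rightarrow> 'w \<Rightarrow> 'v::euclidean_space) \<Rightarrow> (real \<Rightarrow> 'w \<Rightarrow> 'v) \<Rightarrow> bool" where
  "has_stochastic_integral M G N Q H J \<longleftrightarrow>
     (AE \<omega> in M. set_borel_measurable borel {0..} (\<lambda>s. H s \<omega>)) \<and>
     (\<exists>S. (\<forall>k::nat. simple_predictable G (S k)) \<and>
        (AE \<omega> in M. \<forall>T\<ge>0.
           (\<lambda>k. \<integral>\<^sup>+s\<in>{0..T}. ennreal ((norm (simple_value (S k) s \<omega> - H s \<omega>))\<^sup>2)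
                  \<partial>stieltjes_measure Q \<omega>) \<longlonglongrightarrow> 0 \<and>
           uniform_limit {0..T} (\<lambda>k t. simple_integral N (S k) t \<omega>) (\<lambda>t. J t \<omega>) sequentially))"


section \<open>The time-changed equation\<close>

definition eigenvalues :: "real^'n^'n \<Rightarrow> complex set" where
  "eigenvalues A =
     {z. \<exists>v::complex^'n. v \<noteq> 0 \<and> map_matrix complex_of_real A *v v = z *s v}"

text \<open>
  \<open>dX = A X dE + f(E, X) dB\<^sub>E\<close>, \<open>X(0) = x0\<close>, in integral form. The Stieltjes integral exists because
  paths of \<open>X\<close> are continuous; the initial condition is the equation at \<open>t = 0\<close>.
\<close>

definition time_changed_sde_solution ::
    "'w measure \<Rightarrow> (real \<Rightarrow> 'w \<Rightarrow> real) \<Rightarrow> (real \<Rightarrow> 'w \<Rightarrow> real) \<Rightarrow> real^'n^'n \<Rightarrow>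
     (real \<Rightarrow> real^'n \<Rightarrow> real^'n) \<Rightarrow> real^'n \<Rightarrow> (real \<Rightarrow> 'w \<Rightarrow> real^'n) \<Rightarrow> bool" where
  "time_changed_sde_solution M B E A f x0 X \<longleftrightarrow>
     (\<forall>t\<ge>0. X t \<in> borel_measurable (time_changed_filtration M B E t)) \<and>
     (AE \<omega> in M. continuous_on {0..} (\<lambda>t. X t \<omega>)) \<and>
     (\<exists>J. has_stochastic_integral M (time_changed_filtration M B E) (\<lambda>t \<omega>. B (E t \<omega>) \<omega>) E
            (\<lambda>s \<omega>. f (E s \<omega>) (X s \<omega>)) J \<and>
          (AE \<omega> in M. \<forall>t\<ge>0.
             X t \<omega> = x0 + (LINT s:{0..t}|stieltjes_measure E \<omega>. A *v X s \<omega>) + J t \<omega>))"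

text \<open>
  \<open>X x0\<close> is the solution started in \<open>x0\<close>. The expectation is a nonnegative integral, so that the
  bound includes its finiteness.
\<close>

definition square_mean_asymptotically_stable ::
    "'w measure \<Rightarrow> ('v::euclidean_space \<Rightarrow> real \<Rightarrow> 'w \<Rightarrow> 'v) \<Rightarrow> bool" where
  "square_mean_asymptotically_stable M X \<longleftrightarrow>
     (\<exists>\<nu> K. (\<forall>t\<ge>0. 0 \<le> \<nu> t) \<and> (\<nu> \<longlongrightarrow> 0) at_top \<and> 0 < (K::real) \<and>
        (\<forall>x0. \<forall>t\<ge>0. (\<integral>\<^sup>+\<omega>. ennreal ((norm (X x0 t \<omega>))\<^sup>2) \<partial>M)
                        \<le> ennreal (K * (norm x0)\<^sup>2 * \<nu> t)))"

end

theory Submission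
  imports Defs "Jordan_Normal_Form.Schur_Decomposition"
begin

text \<open>
  \<^bold>\<open>Idea of the proof.\<close> Time enters the equation only through the clock \<open>E\<close>, and the whole path of
  \<open>E\<close> is known at time \<open>0\<close> of the filtration. In the time scale of the clock the equation is an
  exponentially stable linear system, perturbed by a noise of intensity at most \<open>g\<^sup>2 |X|\<^sup>2\<close>, where \<open>g\<^sup>2\<close>
  has finite total mass. As in the classical theory this yields the bound \<open>const |x\<^sub>0|\<^sup>2 exp (- 2 \<mu> E\<^sub>T)\<close> for the conditional
  expectation of \<open>|X\<^sub>T|\<^sup>2\<close> given the clock. Since \<open>E\<^sub>T \<rightarrow> \<infinity>\<close> almost surely, the mean of
  this bound tends to \<open>0\<close>, and \<open>\<nu> T\<close> can be taken as the mean of \<open>exp (- 2 \<mu> E\<^sub>T)\<close>.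

  \<^bold>\<open>Lyapunov function.\<close> A Schur triangularisation of \<open>A\<close>, followed by a diagonal scaling that makes
  the off-diagonal part small, gives an injective linear \<open>L\<close> with
  \<open>\<langle>L x, L A x\<rangle> \<le> - \<mu> |L x|\<^sup>2\<close> (\<open>lyapunov_transform\<close>). With \<open>\<Gamma> u = \<integral>\<^sub>0\<^sup>u g\<^sup>2\<close> and a large constant \<open>C\<close>
  the process \<open>exp (2 \<mu> E\<^sub>t - C \<Gamma> (E\<^sub>t)) |L X\<^sub>t|\<^sup>2\<close> is formally a supermartingale: the dissipativity pays
  for \<open>2 \<mu>\<close>, and the growth bound \<open>|f (E, X)| \<le> |g (E)| |X|\<close> is paid for by \<open>C \<Gamma>\<close>. The factor
  \<open>exp (- C \<Gamma>)\<close> stays away from \<open>0\<close>, as \<open>g\<close> is square integrable.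

  \<^bold>\<open>Avoiding Ito's formula.\<close> The stochastic integral is a pathwise limit of simple integrals, so
  the supermartingale property is established for Euler schemes driven by these simple integrals.
  On a grid that refines the simple process, one step of the scheme increases the weighted energy
  by a martingale increment plus a drift that is known at the beginning of the step
  (\<open>energy_step\<close>). The scheme is stopped predictably before it, the clock, or the accumulated
  positive part of the drift gets too large; up to that moment all coefficients of the martingale
  increments are bounded, whence the expected weighted energy exceeds its initial value by at most
  the tolerance \<open>\<epsilon>\<close> (\<open>stopped_energy_estimate\<close>). Along almost every path the schemes converge
  uniformly to \<open>X\<close> and the accumulated positive part of the drift converges to \<open>0\<close> (\<open>euler_scheme_converges\<close>), so that
  eventually nothing is stopped. Fatou's lemma transfers the estimate to \<open>X\<close>
  (\<open>weighted_energy_bound\<close>). Multiplying the energy by the \<open>\<sigma>(E)\<close>-measurable factor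
  \<open>Z = exp (- 2 \<mu> E\<^sub>T)\<close> replaces the conditioning on the clock.
\<close>

section \<open>Dissipative coordinates for a stable matrix\<close>

text \<open>The symbol \<open>$\<close> is kept for the components of vectors indexed by a finite type.\<close>

no_notation vec_index (infixl "$" 100)
notation vec_index (infixl "$v" 100)

text \<open>
  The coordinates \<open>x \<mapsto> \<Sum>\<^sub>j Q i j x\<^sub>j\<close> triangularise \<open>A\<close>: the Schur decomposition \<open>M = P S R\<close> of the
  complexified matrix gives \<open>R M = S R\<close>, so \<open>Q\<close> is \<open>R\<close> and \<open>T\<close> is \<open>S\<close>. The index type is enumerated
  by \<open>b\<close>, since triangularity needs a linear order. Eigenvectors of the carrier-based matrix \<open>M\<close> are
  those of \<open>A\<close>, which is why the diagonal of \<open>T\<close> lies in the left half plane.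
\<close>

lemma schur_form_complex:
  fixes A :: "real^'n^'n"
  defines "n \<equiv> CARD('n)"
  assumes ev: "\<forall>z\<in>eigenvalues A. Re z < 0"
  obtains b :: "nat \<Rightarrow> 'n" and T :: "nat \<Rightarrow> nat \<Rightarrow> complex" and Q :: "nat \<Rightarrow> 'n \<Rightarrow> complex"
  where "bij_betw b {..<n} UNIV"
    and "\<And>x i. i < n \<Longrightarrow> (\<Sum>j\<in>UNIV. Q i j * of_real ((A *v x) $ j)) =
            (\<Sum>k\<in>{i..<n}. T i k * (\<Sum>j\<in>UNIV. Q k j * of_real (x $ j)))"
    and "\<And>i. i < n \<Longrightarrow> Re (T i i) < 0"
    and "\<And>x::real^'n. (\<And>i. i < n \<Longrightarrow> (\<Sum>j\<in>UNIV. Q i j * of_real (x $ j)) = 0) \<Longrightarrow> x = 0"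
proof -
  obtain b0 where b0: "bij_betw b0 {0..<n} (UNIV :: 'n set)"
    unfolding n_def using ex_bij_betw_nat_finite[of "UNIV :: 'n set"] by auto
  then have b: "bij_betw b0 {..<n} (UNIV :: 'n set)" by (simp add: atLeast0LessThan)
  define M where "M = mat n n (\<lambda>(i,j). complex_of_real (A $ b0 i $ b0 j))"
  have M: "M \<in> carrier_mat n n" by (simp add: M_def)
  have sumb: "(\<Sum>j\<in>UNIV. h j) = (\<Sum>j<n. h (b0 j))" for h :: "'n \<Rightarrow> complex"
    using sum.reindex_bij_betw[OF b, of h] by simp
  obtain es where es: "char_poly M = (\<Prod>a\<leftarrow>es. [:- a, 1:])" "length es = n"
    using char_poly_factorized[OF M] by auto
  obtain S P R where "schur_decomposition M es = (S, P, R)"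
    by (metis surj_pair)
  from schur_decomposition[OF M es(1) this]
  have wit: "similar_mat_wit M S P R" and ut: "upper_triangular S" and dg: "diag_mat S = es"
    by auto
  from similar_mat_witD2[OF M wit]
  have PR: "P * R = 1\<^sub>m n" "R * P = 1\<^sub>m n" "M = P * S * R"
    and cS: "S \<in> carrier_mat n n" and cP: "P \<in> carrier_mat n n" and cR: "R \<in> carrier_mat n n"
    by auto
  have RM: "R * M = S * R"
  proof -
    have "R * M = R * (P * (S * R))" using PR(3) cS cP cR by simp
    also have "\<dots> = (R * P) * (S * R)" using cS cP cR by (simp add: assoc_mult_mat[of R n n P n "S * R" n])
    also have "\<dots> = S * R" using PR(2) cS cR by simp
    finally show ?thesis .
  qed
  define xv where "xv = (\<lambda>x::complex^'n. Matrix.vec n (\<lambda>i. x $ b0 i))"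
  define cx where "cx = (\<lambda>x::real^'n. (\<chi> i. complex_of_real (x $ i)))"
  have xvc: "xv x \<in> carrier_vec n" for x by (simp add: xv_def)
  have Mx: "M *\<^sub>v xv z = xv (map_matrix complex_of_real A *v z)" for z
    by (rule eq_vecI)
       (auto simp: M_def xv_def scalar_prod_def matrix_vector_mult_def sumb map_matrix_def
             atLeast0LessThan)
  have cxA: "map_matrix complex_of_real A *v cx x = cx (A *v x)" for x
    by (simp add: cx_def matrix_vector_mult_def Finite_Cartesian_Product.vec_eq_iff map_matrix_def)
  define b where "b = b0"
  define T where "T = (\<lambda>i k. S $$ (i,k))"
  define Q where "Q = (\<lambda>i j. R $$ (i, the_inv_into {..<n} b0 j))"
  have Qx: "(\<Sum>j\<in>UNIV. Q i j * of_real (x $ j)) = (R *\<^sub>v xv (cx x)) $v i" if "i < n" for i x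
  proof -
    have "the_inv_into {..<n} b0 (b0 j) = j" if "j < n" for j
      using that b by (simp add: bij_betw_def the_inv_into_f_f)
    then show ?thesis
      using that cR unfolding sumb
      by (auto simp: Q_def xv_def cx_def scalar_prod_def atLeast0LessThan intro!: sum.cong)
  qed
  have diag: "Re (S $$ (i,i)) < 0" if "i < n" for i
  proof -
    have "S $$ (i,i) \<in> set es"
      using dg that cS by (auto simp: diag_mat_def)
    then have "poly (char_poly M) (S $$ (i,i)) = 0"
      unfolding es by (auto simp: poly_prod_list prod_list_zero_iff image_iff)
    then obtain v where v: "eigenvector M v (S $$ (i,i))"
      using eigenvalue_root_char_poly[OF M] by (auto simp: eigenvalue_def)
    define z :: "complex^'n" where "z = (\<chi> j. v $v the_inv_into {..<n} b0 j)"
    have inv: "the_inv_into {..<n} b0 (b0 j) = j" if "j < n" for j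
      using that b by (simp add: bij_betw_def the_inv_into_f_f)
    have vc: "v \<in> carrier_vec n" "v \<noteq> 0\<^sub>v n" "M *\<^sub>v v = S $$ (i,i) \<cdot>\<^sub>v v"
      using v M by (auto simp: eigenvector_def)
    have vz: "v = xv z"
      by (rule eq_vecI) (use vc in \<open>auto simp: xv_def z_def inv\<close>)
    have surj: "\<exists>k<n. j = b0 k" for j using b by (auto simp: bij_betw_def image_iff set_eq_iff)
    have "z \<noteq> 0"
    proof
      assume "z = 0"
      then have "v = 0\<^sub>v n" unfolding vz by (intro eq_vecI) (auto simp: xv_def)
      with vc show False by simp
    qed
    moreover have "map_matrix complex_of_real A *v z = S $$ (i,i) *s z"
    proof -
      have eq: "xv (map_matrix complex_of_real A *v z) = S $$ (i,i) \<cdot>\<^sub>v xv z"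
        using vc(3) vz Mx by simp
      have eqk: "(map_matrix complex_of_real A *v z) $ b0 k = (S $$ (i,i) *s z) $ b0 k" if "k < n" for k
        using that arg_cong[OF eq, of "\<lambda>v. v $v k"] by (simp add: xv_def)
      have "(map_matrix complex_of_real A *v z) $ j = (S $$ (i,i) *s z) $ j" for j
      proof -
        obtain k where "k < n" "j = b0 k" using surj by blast
        then show ?thesis using eqk by simp
      qed
      then show ?thesis unfolding Finite_Cartesian_Product.vec_eq_iff by blast
    qed
    ultimately show ?thesis using ev unfolding eigenvalues_def by auto
  qed
  show thesis
  proof (rule that[of b Q T])
    show "bij_betw b {..<n} UNIV" using b by (simp add: b_def)
    show "(\<Sum>j\<in>UNIV. Q i j * of_real ((A *v x) $ j)) =
            (\<Sum>k\<in>{i..<n}. T i k * (\<Sum>j\<in>UNIV. Q k j * of_real (x $ j)))" if "i < n" for i x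
    proof -
      have "(\<Sum>j\<in>UNIV. Q i j * of_real ((A *v x) $ j)) = (R *\<^sub>v (M *\<^sub>v xv (cx x))) $v i"
        using that by (simp only: Qx cxA Mx)
      also have "R *\<^sub>v (M *\<^sub>v xv (cx x)) = S *\<^sub>v (R *\<^sub>v xv (cx x))"
        using cR M cS xvc RM by (metis assoc_mult_mat_vec)
      also have "\<dots> $v i = (\<Sum>k\<in>{0..<n}. T i k * (R *\<^sub>v xv (cx x)) $v k)"
        using that cS cR by (auto simp: scalar_prod_def T_def)
      also have "\<dots> = (\<Sum>k\<in>{i..<n}. T i k * (R *\<^sub>v xv (cx x)) $v k)"
        using ut cS that by (intro sum.mono_neutral_right) (auto simp: T_def upper_triangular_def)
      finally show ?thesis by (simp add: Qx)
    qed
    show "Re (T i i) < 0" if "i < n" for i using diag that by (simp add: T_def)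
    show "x = 0" if "\<And>i. i < n \<Longrightarrow> (\<Sum>j\<in>UNIV. Q i j * of_real (x $ j)) = 0" for x :: "real^'n"
    proof -
      have "R *\<^sub>v xv (cx x) = 0\<^sub>v n"
        by (rule eq_vecI) (use that cR in \<open>auto simp: Qx[symmetric] simp del: index_mult_mat_vec\<close>)
      moreover have "P *\<^sub>v 0\<^sub>v n = 0\<^sub>v n"
        by (rule eq_vecI) (use cP in \<open>auto simp: scalar_prod_def\<close>)
      ultimately have "(P * R) *\<^sub>v xv (cx x) = 0\<^sub>v n"
        using cP cR xvc by (simp add: assoc_mult_mat_vec[of P n n R n] ) 
      then have z: "xv (cx x) = 0\<^sub>v n" using PR(1) xvc by simp
      have "cx x $ b0 k = 0" if "k < n" for k
        using arg_cong[OF z, of "\<lambda>v. v $v k"] that by (simp add: xv_def)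
      moreover have "\<exists>k<n. j = b0 k" for j using b by (auto simp: bij_betw_def image_iff set_eq_iff)
      ultimately show ?thesis by (auto simp: cx_def Finite_Cartesian_Product.vec_eq_iff)  (metis of_real_eq_0_iff)
    qed
  qed
qed

text \<open>
  Scaling the \<open>i\<close>-th coordinate by \<open>r ^ i\<close> multiplies the entry \<open>T i k\<close> above the diagonal by
  \<open>r ^ i / r ^ k \<le> 1 / r\<close>. For large \<open>r\<close> the off-diagonal part is thus dominated by the diagonal,
  whose real parts are at most \<open>- 2 \<mu>\<close>.
\<close>

lemma scaled_triangular_dissipative:
  fixes T :: "nat \<Rightarrow> nat \<Rightarrow> complex"
  assumes neg: "\<And>i. i < n \<Longrightarrow> Re (T i i) < 0"
  obtains r \<mu> :: real where "r > 0" "\<mu> > 0"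
    "\<And>u :: nat \<Rightarrow> complex.
       (\<Sum>i<n. Re (cnj (r^i * u i) * (r^i * (\<Sum>k\<in>{i..<n}. T i k * u k)))) \<le>
         - \<mu> * (\<Sum>i<n. (cmod (r^i * u i))\<^sup>2)"
proof -
  define d where "d = Min (insert 1 ((\<lambda>i. - Re (T i i)) ` {..<n}))"
  define \<mu> where "\<mu> = d / 2"
  have mu: "\<mu> > 0" "\<And>i. i < n \<Longrightarrow> Re (T i i) \<le> - 2 * \<mu>"
  proof -
    have "d > 0"
      using neg unfolding d_def by (subst Min_gr_iff) auto
    then show "\<mu> > 0" by (simp add: \<mu>_def)
    fix i assume "i < n"
    then have "d \<le> - Re (T i i)"
      unfolding d_def by (intro Min_le) auto
    then show "Re (T i i) \<le> - 2 * \<mu>" by (simp add: \<mu>_def)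
  qed
  define K where "K = (\<Sum>i<n. \<Sum>k<n. cmod (T i k))"
  have K: "cmod (T i k) \<le> K" if "i < n" "k < n" for i k
  proof -
    have "cmod (T i k) \<le> (\<Sum>k<n. cmod (T i k))" using that by (intro member_le_sum) auto
    also have "\<dots> \<le> K" unfolding K_def using that
      by (intro member_le_sum[where f = "\<lambda>i. \<Sum>k<n. cmod (T i k)"]) (auto intro: sum_nonneg)
    finally show ?thesis .
  qed
  have K0: "K \<ge> 0" by (simp add: K_def sum_nonneg)
  \<comment> \<open>Large enough for the off-diagonal part to use up only half of the decay \<open>2 \<mu>\<close>.\<close>
  define r where "r = 1 + K * n / \<mu>"
  have r: "r \<ge> 1" "K * n \<le> \<mu> * r" using mu(1) K0 by (auto simp: r_def field_simps)
  show thesis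
  proof (rule that[of r \<mu>])
    show "r > 0" "\<mu> > 0" using r mu by auto
    fix u :: "nat \<Rightarrow> complex"
    define v where "v i = r^i * u i" for i
    define a where "a i = cmod (v i)" for i
    have off: "Re (cnj (v i) * (r^i * (T i k * u k))) \<le> K / r * (a i * a k)" if "i < k" "k < n" for i k
    proof -
      have rk: "r^k = r^i * r^(k-i)" using that by (simp flip: power_add)
      have "r^1 \<le> r^(k-i)" using r that by (intro power_increasing) auto
      then have le: "r * r^i \<le> r^k" unfolding rk using r by (simp add: mult.commute)
      have rp: "r^i > 0" "r^k > 0" using r by auto
      have "Re (cnj (v i) * (r^i * (T i k * u k))) \<le> cmod (cnj (v i) * (r^i * (T i k * u k)))"
        by (rule complex_Re_le_cmod)
      also have "\<dots> = cmod (T i k) * a i * (r^i * cmod (u k))"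
        using r by (simp add: norm_mult norm_power a_def)
      also have "\<dots> \<le> K * a i * (r^k / r * cmod (u k))"
        using that r le by (intro mult_mono K) (auto simp: a_def field_simps K0)
      also have "\<dots> = K / r * (a i * a k)"
        using r by (simp add: a_def v_def norm_mult norm_power)
      finally show ?thesis .
    qed
    have row: "Re (cnj (v i) * (r^i * (\<Sum>k\<in>{i..<n}. T i k * u k))) \<le>
        - 2 * \<mu> * (a i)\<^sup>2 + (\<Sum>k<n. K / r * (a i * a k))" if i: "i < n" for i
    proof -
      have "{i..<n} = insert i {i<..<n}" using i by auto
      then have "Re (cnj (v i) * (r^i * (\<Sum>k\<in>{i..<n}. T i k * u k))) =
          Re (cnj (v i) * (r^i * (T i i * u i))) + (\<Sum>k\<in>{i<..<n}. Re (cnj (v i) * (r^i * (T i k * u k))))"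
        by (simp add: sum_distrib_left distrib_left del: times_complex.simps)
      also have "Re (cnj (v i) * (r^i * (T i i * u i))) = Re (T i i) * (a i)\<^sup>2"
      proof -
        have "cnj (v i) * (r^i * (T i i * u i)) = of_real ((a i)\<^sup>2) * T i i"
          unfolding a_def complex_norm_square by (simp add: v_def)
        then show ?thesis by (simp only:) (simp flip: of_real_power)
      qed
      also have "\<dots> \<le> - 2 * \<mu> * (a i)\<^sup>2" using mu(2)[OF i] by (intro mult_right_mono) auto
      also have "(\<Sum>k\<in>{i<..<n}. Re (cnj (v i) * (r^i * (T i k * u k)))) \<le> (\<Sum>k\<in>{i<..<n}. K / r * (a i * a k))"
        by (intro sum_mono off) auto
      also have "\<dots> \<le> (\<Sum>k<n. K / r * (a i * a k))"
        using K0 r by (intro sum_mono2) (auto simp: a_def)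
      finally show ?thesis by simp
    qed
    have cs: "(\<Sum>i<n. \<Sum>k<n. a i * a k) \<le> n * (\<Sum>i<n. (a i)\<^sup>2)"
    proof -
      have "(\<Sum>i<n. \<Sum>k<n. a i * a k) \<le> (\<Sum>i<n. \<Sum>k<n. (a i)\<^sup>2/2 + (a k)\<^sup>2/2)"
        using [[simp_trace=false]] sum_squares_bound by (intro sum_mono) (simp add: field_simps)
      also have "\<dots> = n * (\<Sum>i<n. (a i)\<^sup>2)"
        by (simp add: sum.distrib flip: sum_distrib_left sum_divide_distrib)
      finally show ?thesis .
    qed
    have "(\<Sum>i<n. Re (cnj (v i) * (r^i * (\<Sum>k\<in>{i..<n}. T i k * u k)))) \<le>
        (\<Sum>i<n. - 2 * \<mu> * (a i)\<^sup>2 + (\<Sum>k<n. K / r * (a i * a k)))"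
      by (intro sum_mono row) auto
    also have "\<dots> = - 2 * \<mu> * (\<Sum>i<n. (a i)\<^sup>2) + K / r * (\<Sum>i<n. \<Sum>k<n. a i * a k)"
      by (simp only: sum.distrib sum_distrib_left)
    also have "\<dots> \<le> - 2 * \<mu> * (\<Sum>i<n. (a i)\<^sup>2) + K / r * (n * (\<Sum>i<n. (a i)\<^sup>2))"
      using cs K0 r by (intro add_left_mono mult_left_mono) auto
    also have "K / r * (n * (\<Sum>i<n. (a i)\<^sup>2)) = (K * n / r) * (\<Sum>i<n. (a i)\<^sup>2)" by simp
    also have "- 2 * \<mu> * (\<Sum>i<n. (a i)\<^sup>2) + \<dots> \<le> - 2 * \<mu> * (\<Sum>i<n. (a i)\<^sup>2) + \<mu> * (\<Sum>i<n. (a i)\<^sup>2)"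
      using r by (intro add_left_mono mult_right_mono) (auto simp: field_simps sum_nonneg)
    finally show "(\<Sum>i<n. Re (cnj (r^i * u i) * (r^i * (\<Sum>k\<in>{i..<n}. T i k * u k)))) \<le>
         - \<mu> * (\<Sum>i<n. (cmod (r^i * u i))\<^sup>2)"
      by (simp add: v_def a_def)
  qed
qed

text \<open>
  The quadratic form \<open>x \<mapsto> |L x|\<^sup>2\<close> is a strict Lyapunov function of the linear system, with an
  explicit decay rate. Keeping \<open>L\<close> rather than the form turns all later computations into
  computations with an inner product.
\<close>

lemma lyapunov_transform:
  fixes A :: "real^'n^'n"
  assumes ev: "\<forall>z\<in>eigenvalues A. Re z < 0"
  obtains L :: "real^'n \<Rightarrow> complex^'n" and \<mu> :: real
  where "linear L" "inj L" "\<mu> > 0" "\<And>x. inner (L x) (L (A *v x)) \<le> - \<mu> * (norm (L x))\<^sup>2"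
proof -
  define n where "n = CARD('n)"
  obtain b :: "nat \<Rightarrow> 'n" and T :: "nat \<Rightarrow> nat \<Rightarrow> complex" and Q :: "nat \<Rightarrow> 'n \<Rightarrow> complex"
  where b: "bij_betw b {..<n} UNIV"
    and QA: "\<And>x i. i < n \<Longrightarrow> (\<Sum>j\<in>UNIV. Q i j * of_real ((A *v x) $ j)) =
            (\<Sum>k\<in>{i..<n}. T i k * (\<Sum>j\<in>UNIV. Q k j * of_real (x $ j)))"
    and neg: "\<And>i. i < n \<Longrightarrow> Re (T i i) < 0"
    and inj: "\<And>x::real^'n. (\<And>i. i < n \<Longrightarrow> (\<Sum>j\<in>UNIV. Q i j * of_real (x $ j)) = 0) \<Longrightarrow> x = 0"
  proof (rule schur_form_complex[OF ev, folded n_def], goal_cases)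
    case (1 b T Q)
    show ?case by (rule 1(1)[of b Q T]) (rule 1; assumption)+
  qed
  obtain r \<mu> :: real where r: "r > 0" and mu: "\<mu> > 0" and dis:
    "\<And>u :: nat \<Rightarrow> complex.
       (\<Sum>i<n. Re (cnj (r^i * u i) * (r^i * (\<Sum>k\<in>{i..<n}. T i k * u k)))) \<le>
         - \<mu> * (\<Sum>i<n. (cmod (r^i * u i))\<^sup>2)"
  proof (rule scaled_triangular_dissipative[where n = n and T = T, OF neg], goal_cases)
    case (2 r \<mu>)
    show ?case by (rule 2(1)[of r \<mu>]) (rule 2)+
  qed
  define u where "u x i = (\<Sum>j\<in>UNIV. Q i j * of_real (x $ j))" for x :: "real^'n" and i
  define c where "c = the_inv_into {..<n} b"
  have cb: "c (b i) = i" if "i < n" for i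
    using b that by (simp add: c_def bij_betw_def the_inv_into_f_f)
  define L where "L x = (\<chi> k. complex_of_real r ^ c k * u x (c k))" for x :: "real^'n"
  have u_add: "u (x + y) i = u x i + u y i" for x y i
    by (simp add: u_def distrib_left sum.distrib)
  have u_scale: "u (a *\<^sub>R x) i = of_real a * u x i" for a x i
    by (simp add: u_def sum_distrib_left mult.left_commute)
  have lin: "linear L"
  proof (rule linearI)
    show "L (x + y) = L x + L y" for x y
      by (simp add: L_def u_add Finite_Cartesian_Product.vec_eq_iff distrib_left)
    show "L (a *\<^sub>R x) = a *\<^sub>R L x" for a x
      unfolding Finite_Cartesian_Product.vec_eq_iff vector_scaleR_component L_def vec_lambda_beta u_scale
      by (simp add: scaleR_conv_of_real)
  qed
  have inner_L: "inner (L x) (L y) = (\<Sum>i<n. Re (cnj (r^i * u x i) * (r^i * u y i)))" for x y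
  proof -
    have "inner (L x) (L y) = (\<Sum>k\<in>UNIV. inner (L x $ k) (L y $ k))" by (simp add: inner_vec_def)
    also have "\<dots> = (\<Sum>i<n. inner (L x $ b i) (L y $ b i))"
      using sum.reindex_bij_betw[OF b, of "\<lambda>k. inner (L x $ k) (L y $ k)"] by simp
    also have "\<dots> = (\<Sum>i<n. Re (cnj (r^i * u x i) * (r^i * u y i)))"
      by (intro sum.cong refl) (simp add: L_def cb inner_complex_def)
    finally show ?thesis .
  qed
  have Re_cnj: "Re (cnj z * z) = (cmod z)\<^sup>2" for z
    unfolding cmod_power2 by (simp add: power2_eq_square)
  have norm_L: "(norm (L x))\<^sup>2 = (\<Sum>i<n. (cmod (r^i * u x i))\<^sup>2)" for x
    unfolding power2_norm_eq_inner[of "L x"] inner_L by (intro sum.cong refl Re_cnj)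
  show thesis
  proof (rule that[OF lin _ mu])
    show "inj L"
    proof (subst linear_injective_0[OF lin], intro allI impI)
      fix x assume "L x = 0"
      then have "(\<Sum>i<n. (cmod (r^i * u x i))\<^sup>2) = 0" using norm_L[of x] by simp
      then have "\<forall>i<n. u x i = 0" using r by (subst (asm) sum_nonneg_eq_0_iff) auto
      then show "x = 0" using inj[of x] by (simp add: u_def)
    qed
    show "inner (L x) (L (A *v x)) \<le> - \<mu> * (norm (L x))\<^sup>2" for x
    proof -
      have "u (A *v x) i = (\<Sum>k\<in>{i..<n}. T i k * u x k)" if "i < n" for i
        using QA[OF that] by (simp add: u_def)
      then have "inner (L x) (L (A *v x)) =
          (\<Sum>i<n. Re (cnj (r^i * u x i) * (r^i * (\<Sum>k\<in>{i..<n}. T i k * u x k))))"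
        unfolding inner_L by (intro sum.cong refl) simp
      then show ?thesis using dis[of "u x"] norm_L by simp
    qed
  qed
qed

section \<open>Change of variables for continuous distribution functions\<close>

text \<open>
  A continuous distribution function transports its own Stieltjes measure to Lebesgue measure.
  Both sides are finite Borel measures, so it suffices to compare their cumulative distribution
  functions.
\<close>

lemma distr_interval_measure_continuous:
  fixes F :: "real \<Rightarrow> real"
  assumes mono: "mono F" and cont: "continuous_on UNIV F" and "a \<le> b"
  shows "distr (density (interval_measure F) (indicator {a<..b})) lborel F =
         density lborel (indicator {F a<..F b})" (is "?D = ?R")
proof -
  have meas: "F \<in> borel_measurable borel" by (rule borel_measurable_mono[OF mono])
  have Ioc: "emeasure (interval_measure F) {x<..y} = ennreal (F y - F x)" if "x \<le> y" for x y
    using that mono cont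
    by (intro emeasure_interval_measure_Ioc)
       (auto simp: mono_def continuous_on_eq_continuous_within continuous_at_imp_continuous_at_within)
  have emD: "emeasure ?D {..x} = emeasure (interval_measure F) ({a<..b} \<inter> F -` {..x})" for x
  proof -
    have "emeasure ?D {..x} = emeasure (density (interval_measure F) (indicator {a<..b})) (F -` {..x})"
      using meas by (subst emeasure_distr) (auto simp: measurable_def)
    also have "\<dots> = (\<integral>\<^sup>+s. indicator {a<..b} s * indicator (F -` {..x}) s \<partial>interval_measure F)"
      using measurable_sets[OF meas, of "{..x}"] by (subst emeasure_density) auto
    also have "\<dots> = (\<integral>\<^sup>+s. indicator ({a<..b} \<inter> F -` {..x}) s \<partial>interval_measure F)"
      by (simp add: indicator_inter_arith)
    finally show ?thesis using measurable_sets[OF meas, of "{..x}"] by simp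
  qed
  have emR: "emeasure ?R {..x} = emeasure lborel ({F a<..F b} \<inter> {..x})" for x
    by (subst emeasure_density) (auto simp flip: indicator_inter_arith)
  have eq: "emeasure ?D {..x} = emeasure ?R {..x}" for x
  proof -
    consider "x < F a" | "F a \<le> x" "x < F b" | "F b \<le> x" by linarith
    then show ?thesis
    proof cases
      case 1
      have "F a \<le> F s" if "a < s" for s using that by (intro monoD[OF mono]) simp
      then have "{a<..b} \<inter> F -` {..x} = {}" using 1 by fastforce
      moreover have "{F a<..F b} \<inter> {..x} = {}" using 1 by auto
      ultimately show ?thesis unfolding emD emR by simp
    next
      case 3
      have "{a<..b} \<inter> F -` {..x} = {a<..b}" using 3 by (auto intro: order_trans[OF monoD[OF mono]])
      moreover have "{F a<..F b} \<inter> {..x} = {F a<..F b}" using 3 by auto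
      ultimately show ?thesis unfolding emD emR using Ioc[OF \<open>a \<le> b\<close>] monoD[OF mono \<open>a \<le> b\<close>] by simp
    next
      case 2
      \<comment> \<open>The last time at which the level \<open>x\<close> is attained turns the preimage into an interval.\<close>
      define K where "K = {s\<in>{a..b}. F s = x}"
      have "compact K"
      proof -
        have "closed (F -` {x})" using cont by (simp add: continuous_on_closed_vimage)
        moreover have "K = {a..b} \<inter> F -` {x}" by (auto simp: K_def)
        ultimately show ?thesis by (simp add: compact_Int_closed)
      qed
      moreover have "K \<noteq> {}"
        using IVT'[of F a x b] 2 \<open>a \<le> b\<close> continuous_on_subset[OF cont] by (auto simp: K_def)
      ultimately obtain c where c: "c \<in> K" "\<forall>s\<in>K. s \<le> c"
        using compact_attains_sup by metis
      have "{a<..b} \<inter> F -` {..x} = {a<..c}"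
      proof (intro equalityI subsetI)
        fix s assume s: "s \<in> {a<..b} \<inter> F -` {..x}"
        have "s \<le> c"
        proof (rule ccontr)
          assume "\<not> s \<le> c"
          then have "F s = x" using s c monoD[OF mono, of c s] by (auto simp: K_def)
          then show False using c(2) s \<open>\<not> s \<le> c\<close> by (auto simp: K_def)
        qed
        then show "s \<in> {a<..c}" using s by simp
      next
        fix s assume "s \<in> {a<..c}"
        then show "s \<in> {a<..b} \<inter> F -` {..x}" using c monoD[OF mono, of s c] by (auto simp: K_def)
      qed
      moreover have "{F a<..F b} \<inter> {..x} = {F a<..x}" using 2 by auto
      ultimately show ?thesis unfolding emD emR using Ioc[of a c] c 2 by (simp add: K_def)
    qed
  qed
  have fin: "emeasure ?D UNIV < \<infinity>" "emeasure ?R UNIV < \<infinity>"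
  proof -
    have "emeasure ?D UNIV = emeasure (density (interval_measure F) (indicator {a<..b})) UNIV"
      using meas by (subst emeasure_distr) (auto simp: measurable_def)
    also have "\<dots> = emeasure (interval_measure F) {a<..b}"
      by (subst emeasure_density) auto
    finally show "emeasure ?D UNIV < \<infinity>" using Ioc[OF \<open>a \<le> b\<close>] by simp
    have "emeasure ?R UNIV = emeasure lborel {F a<..F b}"
      by (subst emeasure_density) auto
    then show "emeasure ?R UNIV < \<infinity>" using monoD[OF mono \<open>a \<le> b\<close>] by simp
  qed
  have "finite_borel_measure ?D" "finite_borel_measure ?R"
    using fin by (auto simp: finite_borel_measure_def finite_borel_measure_axioms_def less_top
                       intro!: finite_measureI)
  then show ?thesis
    by (rule cdf_unique') (auto simp: cdf_def measure_def eq)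
qed

text \<open>
  Change of variables \<open>u = F s\<close> in the form needed for the growth bound on the noise coefficient.
  The function \<open>g\<close> is only Lebesgue measurable; its Borel modification agrees with it
  at \<open>F s\<close> for almost every \<open>s\<close>, because \<open>F\<close> transports null sets correctly.
\<close>

lemma nn_integral_interval_measure_le:
  fixes F g :: "real \<Rightarrow> real" and h :: "real \<Rightarrow> ennreal"
  assumes mono: "mono F" and cont: "continuous_on UNIV F" and "a \<le> b" "F a \<ge> 0"
    and h: "\<And>s. s \<in> {a<..b} \<Longrightarrow> h s \<le> ennreal (g (F s))"
    and g: "set_integrable lebesgue {0..} g" and g0: "\<And>u. g u \<ge> 0"
  shows "(\<integral>\<^sup>+s\<in>{a<..b}. h s \<partial>interval_measure F) \<le> ennreal (LINT u:{F a<..F b}|lebesgue. g u)"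
proof -
  have meas: "F \<in> borel_measurable borel" by (rule borel_measurable_mono[OF mono])
  let ?D = "density (interval_measure F) (indicator {a<..b})"
  have int: "set_integrable lebesgue {F a<..F b} g"
    by (rule set_integrable_subset[OF g]) (use \<open>F a \<ge> 0\<close> in auto)
  then have "(\<lambda>u. indicator {F a<..F b} u * g u) \<in> borel_measurable (completion lborel)"
    by (simp add: set_integrable_def)
  from completion_ex_borel_measurable_real[OF this] obtain g' where
    g': "g' \<in> borel_measurable lborel" "AE u in lborel. indicator {F a<..F b} u * g u = g' u"
    by auto
  have distr: "distr ?D lborel F = density lborel (indicator {F a<..F b})"
    by (rule distr_interval_measure_continuous[OF mono cont \<open>a \<le> b\<close>])
  have mF: "F \<in> measurable ?D lborel" using meas by (simp add: measurable_def)
  have "AE u in distr ?D lborel F. g u = g' u"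
    unfolding distr by (subst AE_density) (use g'(2) in \<open>auto split: split_indicator_asm\<close>)
  then have ae: "AE s in ?D. g (F s) = g' (F s)" by (rule AE_distrD[OF mF])
  then have ae': "AE s in interval_measure F. s \<in> {a<..b} \<longrightarrow> g (F s) = g' (F s)"
    by (subst (asm) AE_density) (auto split: split_indicator_asm)
  have "(\<integral>\<^sup>+s\<in>{a<..b}. h s \<partial>interval_measure F) \<le>
      (\<integral>\<^sup>+s\<in>{a<..b}. ennreal (g' (F s)) \<partial>interval_measure F)"
    by (intro nn_integral_mono_AE, use ae' in eventually_elim) (use h in \<open>force split: split_indicator\<close>)
  also have "\<dots> = (\<integral>\<^sup>+s. ennreal (g' (F s)) \<partial>?D)"
    using g'(1) meas by (subst nn_integral_density) (auto simp: mult.commute)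
  also have "\<dots> = (\<integral>\<^sup>+u. ennreal (g' u) \<partial>distr ?D lborel F)"
    using mF g'(1) by (subst nn_integral_distr) auto
  also have "\<dots> = (\<integral>\<^sup>+u. indicator {F a<..F b} u * ennreal (g' u) \<partial>lborel)"
    unfolding distr using g'(1) by (subst nn_integral_density) auto
  also have "\<dots> = (\<integral>\<^sup>+u. indicator {F a<..F b} u * ennreal (g u) \<partial>lebesgue)"
    unfolding nn_integral_completion[symmetric, of lborel]
    by (intro nn_integral_cong_AE AE_completion, use g'(2) in eventually_elim)
       (auto split: split_indicator)
  also have "\<dots> = (\<integral>\<^sup>+u. ennreal (indicator {F a<..F b} u *\<^sub>R g u) \<partial>lebesgue)"
    by (intro nn_integral_cong) (auto split: split_indicator)
  also have "\<dots> = ennreal (LINT u:{F a<..F b}|lebesgue. g u)"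
    unfolding set_lebesgue_integral_def using int g0
    by (intro nn_integral_eq_integral) (auto simp: set_integrable_def)
  finally show ?thesis .
qed

section \<open>The Euler scheme and its energy\<close>

primrec euler_scheme :: "('v \<Rightarrow> 'v) \<Rightarrow> 'v \<Rightarrow> (nat \<Rightarrow> real) \<Rightarrow> (nat \<Rightarrow> 'v) \<Rightarrow> nat \<Rightarrow> 'v::real_vector" where
  "euler_scheme a x e d 0 = x"
| "euler_scheme a x e d (Suc i) =
     euler_scheme a x e d i + (e (Suc i) - e i) *\<^sub>R a (euler_scheme a x e d i) + d i"

text \<open>
  Discrete Gronwall argument. The quantity \<open>\<parallel>d i\<parallel> + \<eta> + \<delta>\<close>, with \<open>d\<close> the error after removing the
  difference \<open>j - J\<close> of the driving terms, grows in one step at most by the factor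
  \<open>1 + K (e (i + 1) - e i)\<close>. The differences \<open>j - J\<close> are removed first because only their size, and
  not their variation, is small.
\<close>

lemma euler_scheme_error_discrete:
  fixes a :: "'v::real_normed_vector \<Rightarrow> 'v"
  assumes a: "linear a" "\<And>v. norm (a v) \<le> K * norm v" "K \<ge> 0"
    and e: "incseq e"
    and eq: "\<And>i. i \<le> m \<Longrightarrow> x i = x0 + I i + J i" and "I 0 = 0" and "j 0 = 0"
    and osc: "\<And>i. i < m \<Longrightarrow> norm (I (Suc i) - I i - (e (Suc i) - e i) *\<^sub>R a (x i)) \<le> K * \<delta> * (e (Suc i) - e i)"
    and J: "\<And>i. i \<le> m \<Longrightarrow> norm (j i - J i) \<le> \<eta>" and "\<delta> \<ge> 0"
    and "i \<le> m"
  shows "norm (euler_scheme a x0 e (\<lambda>i. j (Suc i) - j i) i - x i) \<le> (\<eta> + \<delta>) * exp (K * (e i - e 0))"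
proof -
  define y where "y = euler_scheme a x0 e (\<lambda>i. j (Suc i) - j i)"
  define d where "d i = y i - x i - (j i - J i)" for i
  have ys: "y (Suc i) = y i + (e (Suc i) - e i) *\<^sub>R a (y i) + (j (Suc i) - j i)" for i
    by (simp add: y_def)
  have yx: "norm (y i - x i) \<le> norm (d i) + \<eta>" if "i \<le> m" for i
  proof -
    have "y i - x i = d i + (j i - J i)" by (simp add: d_def)
    then show ?thesis using J[OF that] norm_triangle_ineq[of "d i" "j i - J i"] by simp
  qed
  have "norm (d i) + \<eta> + \<delta> \<le> (\<eta> + \<delta>) * exp (K * (e i - e 0))" if "i \<le> m" for i
    using that
  proof (induction i)
    case 0
    have "d 0 = 0" using eq[of 0] \<open>I 0 = 0\<close> \<open>j 0 = 0\<close> by (simp add: d_def y_def)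
    then show ?case by simp
  next
    case (Suc i)
    define \<Delta> where "\<Delta> = e (Suc i) - e i"
    have \<Delta>: "\<Delta> \<ge> 0" using e by (simp add: \<Delta>_def incseq_SucD)
    define r where "r = I (Suc i) - I i - \<Delta> *\<^sub>R a (x i)"
    have r: "norm r \<le> K * \<delta> * \<Delta>" using osc[of i] Suc.prems by (simp add: r_def \<Delta>_def)
    have "d (Suc i) = d i + \<Delta> *\<^sub>R a (y i - x i) - r"
      using eq[of i] eq[of "Suc i"] Suc.prems
      by (simp add: d_def ys r_def \<Delta>_def linear_diff[OF a(1)] scaleR_diff_right)
    then have "norm (d (Suc i)) \<le> norm (d i) + norm (\<Delta> *\<^sub>R a (y i - x i)) + norm r"
      using norm_triangle_ineq4[of "d i + \<Delta> *\<^sub>R a (y i - x i)" r]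
        norm_triangle_ineq[of "d i" "\<Delta> *\<^sub>R a (y i - x i)"] by simp
    also have "norm (\<Delta> *\<^sub>R a (y i - x i)) \<le> \<Delta> * (K * (norm (d i) + \<eta>))"
    proof -
      have "norm (a (y i - x i)) \<le> K * norm (y i - x i)" by (rule a)
      also have "\<dots> \<le> K * (norm (d i) + \<eta>)" using yx[of i] Suc.prems a(3) by (intro mult_left_mono) auto
      finally show ?thesis using \<Delta> by (simp add: mult_left_mono)
    qed
    finally have "norm (d (Suc i)) + \<eta> + \<delta> \<le> (norm (d i) + \<eta> + \<delta>) * (1 + K * \<Delta>)"
      using r by (simp add: algebra_simps)
    also have "\<dots> \<le> (norm (d i) + \<eta> + \<delta>) * exp (K * \<Delta>)"
    proof (intro mult_left_mono exp_ge_add_one_self)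
      have "\<eta> \<ge> 0" using J[of i] Suc.prems norm_ge_zero[of "j i - J i"] by linarith
      then show "0 \<le> norm (d i) + \<eta> + \<delta>" using \<open>\<delta> \<ge> 0\<close> by simp
    qed
    also have "\<dots> \<le> ((\<eta> + \<delta>) * exp (K * (e i - e 0))) * exp (K * \<Delta>)"
      using Suc by (intro mult_right_mono) auto
    also have "\<dots> = (\<eta> + \<delta>) * exp (K * (e (Suc i) - e 0))"
      by (simp add: \<Delta>_def mult.assoc algebra_simps flip: exp_add)
    finally show ?case .
  qed
  from this[OF \<open>i \<le> m\<close>] yx[OF \<open>i \<le> m\<close>] \<open>\<delta> \<ge> 0\<close> show ?thesis unfolding y_def by linarith
qed

text \<open>
  Discrete replacement of Ito's formula for the weighted square \<open>w |L y|\<^sup>2\<close>. Apart from the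
  martingale increments \<open>dn\<close> and \<open>dn\<^sup>2 - \<Delta>\<close> only the first term on the right is left: the
  dissipativity cancels the growth \<open>2 \<mu> \<Delta>\<close> of the weight. Differentiating the weight is avoided by
  \<open>1 - x \<le> exp (- x)\<close>.
\<close>

lemma energy_step:
  fixes L :: "'v::real_vector \<Rightarrow> 'b::real_inner"
  assumes "linear L" and dis: "inner (L y) (L (a y)) \<le> - \<mu> * (norm (L y))\<^sup>2"
    and "\<Delta> \<ge> 0" "w' \<ge> 0"
    and w: "w = w' * exp (- (2 * \<mu> * \<Delta> - C * \<gamma>))"
  shows "w' * (norm (L (y + \<Delta> *\<^sub>R a y + dn *\<^sub>R \<xi>)))\<^sup>2 - w * (norm (L y))\<^sup>2 \<le>
     w' * (\<Delta>\<^sup>2 * (norm (L (a y)))\<^sup>2 + \<Delta> * (norm (L \<xi>))\<^sup>2 - C * \<gamma> * (norm (L y))\<^sup>2) +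
     w' * (2 * inner (L (y + \<Delta> *\<^sub>R a y)) (L \<xi>)) * dn + w' * (norm (L \<xi>))\<^sup>2 * (dn\<^sup>2 - \<Delta>)"
proof -
  have L: "L (y + \<Delta> *\<^sub>R a y + dn *\<^sub>R \<xi>) = L (y + \<Delta> *\<^sub>R a y) + dn *\<^sub>R L \<xi>"
    "L (y + \<Delta> *\<^sub>R a y) = L y + \<Delta> *\<^sub>R L (a y)"
    by (simp_all add: linear_add[OF assms(1)] linear_scale[OF assms(1)])
  have sq: "(norm (p + r *\<^sub>R q))\<^sup>2 = (norm p)\<^sup>2 + 2 * r * inner p q + r\<^sup>2 * (norm q)\<^sup>2" for p q :: 'b and r
  proof -
    have "(norm (p + r *\<^sub>R q))\<^sup>2 = inner p p + 2 * r * inner p q + r * r * inner q q"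
      unfolding power2_norm_eq_inner
      by (simp add: inner_add_left inner_add_right inner_commute[of q p] algebra_simps)
    then show ?thesis by (simp add: power2_norm_eq_inner[symmetric] power2_eq_square[of r])
  qed
  have "1 - (2 * \<mu> * \<Delta> - C * \<gamma>) \<le> exp (- (2 * \<mu> * \<Delta> - C * \<gamma>))"
    using exp_ge_add_one_self[of "- (2 * \<mu> * \<Delta> - C * \<gamma>)"] by linarith
  then have "w' * (1 - (2 * \<mu> * \<Delta> - C * \<gamma>)) * (norm (L y))\<^sup>2 \<le> w * (norm (L y))\<^sup>2"
    unfolding w using \<open>w' \<ge> 0\<close> by (intro mult_right_mono mult_left_mono) auto
  moreover have "w' * (2 * \<Delta> * inner (L y) (L (a y))) \<le> w' * (2 * \<Delta> * (- \<mu> * (norm (L y))\<^sup>2))"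
    using dis \<open>\<Delta> \<ge> 0\<close> \<open>w' \<ge> 0\<close> by (intro mult_left_mono) auto
  ultimately have *: "w' * (1 - (2 * \<mu> * \<Delta> - C * \<gamma>)) * (norm (L y))\<^sup>2 +
      w' * (2 * \<Delta> * inner (L y) (L (a y))) - w' * (2 * \<Delta> * (- \<mu> * (norm (L y))\<^sup>2)) \<le> w * (norm (L y))\<^sup>2"
    by linarith
  have **: "(norm (L (y + \<Delta> *\<^sub>R a y + dn *\<^sub>R \<xi>)))\<^sup>2 =
      (norm (L y))\<^sup>2 + 2 * \<Delta> * inner (L y) (L (a y)) + \<Delta>\<^sup>2 * (norm (L (a y)))\<^sup>2 +
      2 * dn * inner (L (y + \<Delta> *\<^sub>R a y)) (L \<xi>) + dn\<^sup>2 * (norm (L \<xi>))\<^sup>2"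
    unfolding L(1) sq[of "L (y + \<Delta> *\<^sub>R a y)"] unfolding L(2) sq[of "L y"] by simp
  show ?thesis unfolding ** using * by (simp add: algebra_simps)
qed

text \<open>
  For an antitone indicator \<open>\<kappa>\<close> of "not yet stopped" the right-hand side is the value of \<open>\<Phi>\<close> at the
  minimum of \<open>m\<close> and the stopping time, which dominates \<open>\<Phi> m\<close> on the event of no stop.
\<close>

lemma stopped_telescope:
  fixes \<kappa> \<Phi> :: "nat \<Rightarrow> real"
  assumes "\<And>i. \<Phi> i \<ge> 0" "\<And>i. \<kappa> (Suc i) \<le> \<kappa> i" "\<kappa> 0 \<le> 1"
  shows "\<kappa> m * \<Phi> m \<le> \<Phi> 0 + (\<Sum>i<m. \<kappa> i * (\<Phi> (Suc i) - \<Phi> i))"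
proof (induction m)
  case 0
  then show ?case using assms mult_right_mono[of "\<kappa> 0" 1 "\<Phi> 0"] by simp
next
  case (Suc m)
  have "\<kappa> (Suc m) * \<Phi> (Suc m) \<le> \<kappa> m * \<Phi> (Suc m)" using assms by (intro mult_right_mono) auto
  then show ?case using Suc by (simp add: algebra_simps)
qed

lemma stopped_sum_le:
  fixes p :: "nat \<Rightarrow> real"
  assumes "\<And>i. p i \<ge> 0" "\<epsilon> \<ge> 0" "\<And>i. \<kappa> i \<noteq> 0 \<Longrightarrow> (\<Sum>j\<le>i. p j) \<le> \<epsilon>" "\<And>i. 0 \<le> \<kappa> i" "\<And>i. \<kappa> i \<le> (1::real)"
  shows "(\<Sum>i<m. \<kappa> i * p i) \<le> \<epsilon>"
proof (induction m)
  case 0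
  then show ?case using assms by simp
next
  case (Suc m)
  show ?case
  proof (cases "\<kappa> m = 0")
    case True
    then show ?thesis using Suc by simp
  next
    case False
    have "(\<Sum>i<Suc m. \<kappa> i * p i) \<le> (\<Sum>i<Suc m. p i)"
      using assms by (intro sum_mono mult_left_le_one_le) auto
    also have "\<dots> \<le> \<epsilon>" using assms(3)[OF False] by (simp add: lessThan_Suc_atMost)
    finally show ?thesis .
  qed
qed

text \<open>
  On one cell the energy of the noise is controlled by the mass of \<open>q\<close> on the image of the cell
  under the clock, up to the approximation error \<open>p\<close>. The factor \<open>2\<close> comes from
  \<open>|\<xi>|\<^sup>2 \<le> 2 |\<xi> - H|\<^sup>2 + 2 |H|\<^sup>2\<close>; it is harmless, as it is absorbed by the constant in the weight.
\<close>

lemma excess_cell_bound: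
  fixes L :: "'v::euclidean_space \<Rightarrow> 'b::real_normed_vector" and F g :: "real \<Rightarrow> real"
  assumes F: "mono F" "continuous_on UNIV F" "a \<le> b" "F a \<ge> 0"
    and g: "set_integrable lebesgue {0..} q" "\<And>u. q u \<ge> 0"
    and L: "\<And>v. norm (L v) \<le> K * norm v" "K \<ge> 0" "\<And>v. c * norm v \<le> norm (L v)" "c > 0"
    and H: "set_borel_measurable borel {a<..b} H"
       "\<And>s. s \<in> {a<..b} \<Longrightarrow> (norm (H s))\<^sup>2 \<le> q (F s) * (norm (X s))\<^sup>2"
    and y: "\<And>s. s \<in> {a<..b} \<Longrightarrow> (norm (L (X s)))\<^sup>2 \<le> (norm (L y))\<^sup>2 + \<eta>" "\<eta> \<ge> 0"
    and p: "(\<integral>\<^sup>+s\<in>{a<..b}. ennreal ((norm (\<xi> - H s))\<^sup>2) \<partial>interval_measure F) = ennreal p" "p \<ge> 0"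
  shows "(F b - F a) * (norm (L \<xi>))\<^sup>2 \<le>
    2 * K\<^sup>2 / c\<^sup>2 * (LINT u:{F a<..F b}|lebesgue. q u) * ((norm (L y))\<^sup>2 + \<eta>) + 2 * K\<^sup>2 * p"
proof -
  define B where "B = ((norm (L y))\<^sup>2 + \<eta>) / c\<^sup>2"
  have B0: "B \<ge> 0" using y(2) by (simp add: B_def)
  have Xs: "(norm (X s))\<^sup>2 \<le> B" if "s \<in> {a<..b}" for s
  proof -
    have "(c * norm (X s))\<^sup>2 \<le> (norm (L (X s)))\<^sup>2" using L by (intro power_mono) auto
    also have "\<dots> \<le> (norm (L y))\<^sup>2 + \<eta>" using y that by simp
    finally show ?thesis using \<open>c > 0\<close> by (simp add: B_def power_mult_distrib field_simps)
  qed
  have Ioc: "emeasure (interval_measure F) {a<..b} = ennreal (F b - F a)"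
    using F by (intro emeasure_interval_measure_Ioc)
       (auto simp: mono_def continuous_on_eq_continuous_within continuous_at_imp_continuous_at_within)
  have Hm: "(\<lambda>s. indicator {a<..b} s *\<^sub>R H s) \<in> borel_measurable borel"
    using H(1) by (simp add: set_borel_measurable_def)
  have Hm2: "(\<lambda>s. ennreal ((norm (H s))\<^sup>2) * indicator {a<..b} s) \<in> borel_measurable borel"
  proof -
    have "(\<lambda>s. ennreal ((norm (indicator {a<..b} s *\<^sub>R H s))\<^sup>2)) \<in> borel_measurable borel"
      using Hm by measurable
    also have "(\<lambda>s. ennreal ((norm (indicator {a<..b} s *\<^sub>R H s))\<^sup>2)) =
        (\<lambda>s. ennreal ((norm (H s))\<^sup>2) * indicator {a<..b} s)"
      by (auto split: split_indicator)
    finally show ?thesis .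
  qed
  have Dm2: "(\<lambda>s. ennreal ((norm (\<xi> - H s))\<^sup>2) * indicator {a<..b} s) \<in> borel_measurable borel"
  proof -
    have "(\<lambda>s. ennreal ((norm (indicator {a<..b} s *\<^sub>R \<xi> - indicator {a<..b} s *\<^sub>R H s))\<^sup>2)) \<in> borel_measurable borel"
      using Hm by measurable
    also have "(\<lambda>s. ennreal ((norm (indicator {a<..b} s *\<^sub>R \<xi> - indicator {a<..b} s *\<^sub>R H s))\<^sup>2)) =
        (\<lambda>s. ennreal ((norm (\<xi> - H s))\<^sup>2) * indicator {a<..b} s)"
      by (auto split: split_indicator)
    finally show ?thesis .
  qed
  have Hint: "(\<integral>\<^sup>+s\<in>{a<..b}. ennreal ((norm (H s))\<^sup>2) \<partial>interval_measure F) \<le>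
      ennreal (LINT u:{F a<..F b}|lebesgue. B * q u)"
  proof (rule nn_integral_interval_measure_le[OF F])
    show "set_integrable lebesgue {0..} (\<lambda>u. B * q u)" using g(1) by (simp add: set_integrable_mult_right)
    show "0 \<le> B * q u" for u using B0 g by simp
    fix s assume s: "s \<in> {a<..b}"
    have "(norm (H s))\<^sup>2 \<le> q (F s) * (norm (X s))\<^sup>2" using H s by simp
    also have "\<dots> \<le> q (F s) * B" using Xs[OF s] g by (intro mult_left_mono) auto
    finally show "ennreal ((norm (H s))\<^sup>2) \<le> ennreal (B * q (F s))" by (simp add: mult.commute ennreal_leI)
  qed
  define G where "G = (LINT u:{F a<..F b}|lebesgue. q u)"
  have G0: "G \<ge> 0" unfolding G_def set_lebesgue_integral_def using g by (intro integral_nonneg_AE) auto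
  have "ennreal ((F b - F a) * (norm (L \<xi>))\<^sup>2) =
      (\<integral>\<^sup>+s\<in>{a<..b}. ennreal ((norm (L \<xi>))\<^sup>2) \<partial>interval_measure F)"
    using monoD[OF F(1,3)] by (subst nn_integral_cmult_indicator) (auto simp: Ioc ennreal_mult'' mult.commute)
  also have "\<dots> \<le> (\<integral>\<^sup>+s. ennreal (2 * K\<^sup>2) * (ennreal ((norm (\<xi> - H s))\<^sup>2) * indicator {a<..b} s) +
       ennreal (2 * K\<^sup>2) * (ennreal ((norm (H s))\<^sup>2) * indicator {a<..b} s) \<partial>interval_measure F)"
  proof (intro nn_integral_mono)
    fix s
    have "(norm (L \<xi>))\<^sup>2 \<le> (K * norm \<xi>)\<^sup>2" using L by (intro power_mono) auto
    also have "\<dots> \<le> (K * (norm (\<xi> - H s) + norm (H s)))\<^sup>2"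
      using L norm_triangle_ineq[of "\<xi> - H s" "H s"] by (intro power_mono mult_left_mono) auto
    also have "\<dots> = K\<^sup>2 * (norm (\<xi> - H s) + norm (H s))\<^sup>2" by (simp add: power_mult_distrib)
    also have "\<dots> \<le> K\<^sup>2 * (2 * (norm (\<xi> - H s))\<^sup>2 + 2 * (norm (H s))\<^sup>2)"
      using sum_squares_bound[of "norm (\<xi> - H s)" "norm (H s)"]
      by (intro mult_left_mono) (auto simp: power2_sum)
    finally have "(norm (L \<xi>))\<^sup>2 \<le> 2 * K\<^sup>2 * (norm (\<xi> - H s))\<^sup>2 + 2 * K\<^sup>2 * (norm (H s))\<^sup>2"
      by (simp add: algebra_simps)
    then have "ennreal ((norm (L \<xi>))\<^sup>2) \<le>
        ennreal (2 * K\<^sup>2) * ennreal ((norm (\<xi> - H s))\<^sup>2) + ennreal (2 * K\<^sup>2) * ennreal ((norm (H s))\<^sup>2)"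
      by (simp add: ennreal_leI flip: ennreal_mult ennreal_plus)
    then show "ennreal ((norm (L \<xi>))\<^sup>2) * indicator {a<..b} s \<le>
        ennreal (2 * K\<^sup>2) * (ennreal ((norm (\<xi> - H s))\<^sup>2) * indicator {a<..b} s) +
        ennreal (2 * K\<^sup>2) * (ennreal ((norm (H s))\<^sup>2) * indicator {a<..b} s)"
      by (auto split: split_indicator)
  qed
  also have "\<dots> = ennreal (2 * K\<^sup>2) * ennreal p +
      ennreal (2 * K\<^sup>2) * (\<integral>\<^sup>+s\<in>{a<..b}. ennreal ((norm (H s))\<^sup>2) \<partial>interval_measure F)"
    using Hm2 Dm2 p by (subst nn_integral_add) (simp_all add: nn_integral_cmult)
  also have "\<dots> \<le> ennreal (2 * K\<^sup>2) * ennreal p + ennreal (2 * K\<^sup>2) * ennreal (B * G)"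
    using Hint by (intro add_left_mono mult_left_mono) (auto simp: G_def)
  also have "\<dots> = ennreal (2 * K\<^sup>2 * p + 2 * K\<^sup>2 * (B * G))"
    using p B0 G0 by (simp flip: ennreal_mult ennreal_plus)
  finally have "(F b - F a) * (norm (L \<xi>))\<^sup>2 \<le> 2 * K\<^sup>2 * p + 2 * K\<^sup>2 * (B * G)"
    using p B0 G0 by (subst (asm) ennreal_le_iff) auto
  then show ?thesis by (simp add: G_def B_def field_simps)
qed

section \<open>Pathwise convergence of the schemes\<close>

text \<open>
  Sequences that are eventually constant encode finite grids of variable length. The finite set
  \<open>P\<close> is going to be the set of endpoints of a simple process, which is then constant on cells.
\<close>

lemma refining_grid:
  fixes P :: "real set"
  assumes "finite P" "T \<ge> 0" "\<delta> > 0"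
  obtains \<tau> :: "nat \<Rightarrow> real" and m where "incseq \<tau>" "\<tau> 0 = 0" "\<And>i. i \<ge> m \<Longrightarrow> \<tau> i = T"
    "\<And>i. \<tau> (Suc i) - \<tau> i \<le> \<delta>" "\<And>i p. p \<in> P \<Longrightarrow> \<not> (\<tau> i < p \<and> p < \<tau> (Suc i))"
proof -
  obtain N :: nat where N: "T / \<delta> < N" using reals_Archimedean2 by blast
  define S where "S = {0, T} \<union> P \<inter> {0..T} \<union> (\<lambda>j. real j * \<delta>) ` {..N} \<inter> {0..T}"
  have S: "finite S" "S \<subseteq> {0..T}" "0 \<in> S" "T \<in> S" using assms by (auto simp: S_def)
  define xs where "xs = sorted_list_of_set S"
  have set_xs: "set xs = S" and sorted: "sorted xs" using S by (auto simp: xs_def)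
  have ne: "length xs > 0" using S set_xs by (auto simp: length_greater_0_conv)
  define \<tau> where "\<tau> i = (if i < length xs then xs ! i else T)" for i
  have tS: "\<tau> i \<in> S" for i using S set_xs by (auto simp: \<tau>_def)
  have inc: "incseq \<tau>"
    by (rule incseq_SucI) (use S set_xs sorted in \<open>auto simp: \<tau>_def sorted_nth_mono dest: nth_mem\<close>)
  have idx: "\<exists>i. i < length xs \<and> \<tau> i = p" if "p \<in> S" for p
    using that by (auto simp: \<tau>_def set_xs[symmetric] in_set_conv_nth)
  \<comment> \<open>A point of \<open>S\<close> is a value of \<open>\<tau>\<close> and cannot lie strictly between consecutive values.\<close>
  have gap: "\<not> (\<tau> i < p \<and> p < \<tau> (Suc i))" if "p \<in> S" for i p
  proof
    assume *: "\<tau> i < p \<and> p < \<tau> (Suc i)"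
    obtain j where "\<tau> j = p" using idx[OF \<open>p \<in> S\<close>] by auto
    then have "\<not> j \<le> i" "\<not> Suc i \<le> j" using * incseqD[OF inc, of j i] incseqD[OF inc, of "Suc i" j] by auto
    then show False by simp
  qed
  show thesis
  proof (rule that[of \<tau> "length xs - 1"])
    show "incseq \<tau>" by (rule inc)
    obtain i where "\<tau> i = 0" using idx S by auto
    then show "\<tau> 0 = 0" using incseqD[OF inc, of 0 i] tS[of 0] S by force
    obtain j where "j < length xs" "\<tau> j = T" using idx S by auto
    then show "\<tau> i = T" if "i \<ge> length xs - 1" for i
      using incseqD[OF inc, of j i] tS[of i] S that by force
    show "\<not> (\<tau> i < p \<and> p < \<tau> (Suc i))" if "p \<in> P" for i p
    proof
      assume *: "\<tau> i < p \<and> p < \<tau> (Suc i)"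
      then have "p \<in> S" using tS[of i] tS[of "Suc i"] S that by (force simp: S_def)
      then show False using gap * by blast
    qed
    show "\<tau> (Suc i) - \<tau> i \<le> \<delta>" for i
    proof (rule ccontr)
      assume *: "\<not> \<tau> (Suc i) - \<tau> i \<le> \<delta>"
      define j where "j = nat \<lfloor>\<tau> i / \<delta>\<rfloor> + 1"
      have t0: "0 \<le> \<tau> i" "\<tau> (Suc i) \<le> T" using subsetD[OF S(2) tS] by auto
      have "real (nat \<lfloor>\<tau> i / \<delta>\<rfloor>) \<le> \<tau> i / \<delta>" "\<tau> i / \<delta> < real (nat \<lfloor>\<tau> i / \<delta>\<rfloor>) + 1"
        using t0 \<open>\<delta> > 0\<close> by auto
      then have j: "\<tau> i < j * \<delta>" "j * \<delta> \<le> \<tau> i + \<delta>"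
        using \<open>\<delta> > 0\<close> by (auto simp: j_def field_simps)
      then have lt: "j * \<delta> < \<tau> (Suc i)" using * by linarith
      moreover have "T < N * \<delta>" using N \<open>\<delta> > 0\<close> by (simp add: pos_divide_less_eq)
      ultimately have "j * \<delta> < N * \<delta>" using t0 by linarith
      then have "j \<le> N" using \<open>\<delta> > 0\<close> by simp
      then have "j * \<delta> \<in> S" using t0 j lt by (auto simp: S_def)
      then show False using gap j lt by blast
    qed
  qed
qed

lemma set_integrable_interval_measure_continuous:
  fixes h :: "real \<Rightarrow> 'v::euclidean_space"
  assumes F: "mono F" "continuous_on UNIV F" and h: "continuous_on {0..T} h"
  shows "set_integrable (interval_measure F) {0..T} h"
proof -
  have "bounded (h ` {0..T})" using h by (intro compact_imp_bounded compact_continuous_image) auto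
  then obtain B where B: "\<And>s. s \<in> {0..T} \<Longrightarrow> norm (h s) \<le> B" unfolding bounded_iff by blast
  have fin: "emeasure (interval_measure F) {0..T} < \<infinity>"
  proof (cases "0 \<le> T")
    case True
    then show ?thesis using F by (subst emeasure_interval_measure_Icc) (auto dest: monoD)
  qed simp
  have "(\<lambda>s. indicator {0..T} s *\<^sub>R h s) \<in> borel_measurable borel"
    using h by (intro borel_measurable_continuous_on_indicator) auto
  then have "integrable (interval_measure F) (\<lambda>s. indicator {0..T} s *\<^sub>R (indicator {0..T} s *\<^sub>R h s))"
    using fin B by (intro integrableI_bounded_set_indicator[where B = B]) auto
  moreover have "(\<lambda>s. indicator {0..T} s *\<^sub>R (indicator {0..T} s *\<^sub>R h s)) = (\<lambda>s. indicator {0..T} s *\<^sub>R h s)"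
    by (auto split: split_indicator)
  ultimately show ?thesis by (simp add: set_integrable_def)
qed

text \<open>
  The local error of an Euler step for the drift integral.
\<close>

lemma stieltjes_integral_oscillation:
  fixes h :: "real \<Rightarrow> 'v::euclidean_space"
  assumes F: "mono F" "continuous_on UNIV F" and h: "continuous_on {0..T} h"
    and st: "0 \<le> s" "s \<le> t" "t \<le> T"
    and osc: "\<And>r. s \<le> r \<Longrightarrow> r \<le> t \<Longrightarrow> norm (h r - h s) \<le> \<kappa>"
  shows "norm ((LINT r:{0..t}|interval_measure F. h r) - (LINT r:{0..s}|interval_measure F. h r) -
           (F t - F s) *\<^sub>R h s) \<le> \<kappa> * (F t - F s)"
proof -
  let ?M = "interval_measure F"
  have em: "emeasure ?M {s<..t} = ennreal (F t - F s)"
    using F st by (intro emeasure_interval_measure_Ioc)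
       (auto simp: mono_def continuous_on_eq_continuous_within continuous_at_imp_continuous_at_within)
  then have ms: "measure ?M {s<..t} = F t - F s" using monoD[OF F(1) st(2)] by (simp add: measure_def)
  have int: "set_integrable ?M {0..s} h" "set_integrable ?M {s<..t} h"
    using set_integrable_interval_measure_continuous[OF F h] st by (auto elim!: set_integrable_subset)
  have intc: "integrable ?M (\<lambda>r. indicator {s<..t} r *\<^sub>R c)" for c :: "'c::{banach,second_countable_topology}"
    using em by (intro integrable_scaleR_left integrable_real_indicator) auto
  have inti: "integrable ?M (indicat_real {s<..t})" using em by (intro integrable_real_indicator) auto
  have "(LINT r:{0..t}|?M. h r) = (LINT r:{0..s} \<union> {s<..t}|?M. h r)"
    using st by (intro arg_cong2[where f = "\<lambda>A f. set_lebesgue_integral ?M A f"]) auto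
  also have "\<dots> = (LINT r:{0..s}|?M. h r) + (LINT r:{s<..t}|?M. h r)"
    using int by (intro set_integral_Un) auto
  finally have "(LINT r:{0..t}|?M. h r) - (LINT r:{0..s}|?M. h r) - (F t - F s) *\<^sub>R h s =
      (\<integral>r. indicator {s<..t} r *\<^sub>R h r \<partial>?M) - (\<integral>r. indicator {s<..t} r *\<^sub>R h s \<partial>?M)"
    using em by (simp add: set_lebesgue_integral_def ms less_top)
  also have "\<dots> = (\<integral>r. indicator {s<..t} r *\<^sub>R h r - indicator {s<..t} r *\<^sub>R h s \<partial>?M)"
    using int(2) intc by (intro Bochner_Integration.integral_diff[symmetric]) (auto simp: set_integrable_def)
  also have "norm \<dots> \<le> (\<integral>r. indicator {s<..t} r *\<^sub>R \<kappa> \<partial>?M)"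
    using int(2) intc inti osc
    by (intro Bochner_Integration.integral_norm_bound_integral Bochner_Integration.integrable_diff)
       (auto simp: set_integrable_def split: split_indicator)
  also have "\<dots> = \<kappa> * (F t - F s)" using em by (simp add: ms less_top)
  finally show ?thesis .
qed

text \<open>
  The scheme follows the solution up to the oscillation of \<open>X\<close> on the cells and the distance of the
  driving path \<open>j\<close> to \<open>J\<close>, uniformly over the grid.
\<close>

lemma euler_scheme_error:
  fixes X J :: "real \<Rightarrow> 'v::euclidean_space"
  assumes F: "mono F" "continuous_on UNIV F"
    and a: "linear a" "\<And>v. norm (a v) \<le> K * norm v" "K \<ge> 0"
    and X: "continuous_on {0..T} X"
      "\<And>t. t \<in> {0..T} \<Longrightarrow> X t = x0 + (LINT s:{0..t}|interval_measure F. a (X s)) + J t"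
    and \<tau>: "incseq \<tau>" "\<tau> 0 = 0" "\<And>i. \<tau> i \<le> T"
    and osc: "\<And>i s. \<tau> i \<le> s \<Longrightarrow> s \<le> \<tau> (Suc i) \<Longrightarrow> norm (X s - X (\<tau> i)) \<le> \<rho>"
    and j: "\<And>t. t \<in> {0..T} \<Longrightarrow> norm (j t - J t) \<le> \<rho>" "j 0 = 0"
  shows "norm (euler_scheme a x0 (\<lambda>i. F (\<tau> i)) (\<lambda>i. j (\<tau> (Suc i)) - j (\<tau> i)) i - X (\<tau> i)) \<le>
    2 * \<rho> * exp (K * (F T - F 0))"
proof -
  define I where "I t = (LINT s:{0..t}|interval_measure F. a (X s))" for t
  have t0: "0 \<le> \<tau> i" for i using incseqD[OF \<tau>(1), of 0 i] \<tau>(2) by simp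
  have \<rho>: "\<rho> \<ge> 0" using osc[of 0 "\<tau> 0"] incseq_SucD[OF \<tau>(1), of 0] by simp
  have ca: "continuous_on {0..T} (\<lambda>s. a (X s))"
    by (rule linear_continuous_on_compose[OF X(1) a(1)])
  have "norm (euler_scheme a x0 (\<lambda>i. F (\<tau> i)) (\<lambda>i. j (\<tau> (Suc i)) - j (\<tau> i)) i - X (\<tau> i)) \<le>
      (\<rho> + \<rho>) * exp (K * (F (\<tau> i) - F (\<tau> 0)))"
  proof (rule euler_scheme_error_discrete[where I = "\<lambda>i. I (\<tau> i)" and J = "\<lambda>i. J (\<tau> i)" and m = i and j = "\<lambda>i. j (\<tau> i)"])
    show "incseq (\<lambda>i. F (\<tau> i))" using F(1) \<tau>(1) by (auto simp: incseq_def mono_def)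
    show "X (\<tau> i) = x0 + I (\<tau> i) + J (\<tau> i)" for i using X(2)[of "\<tau> i"] t0[of i] \<tau>(3)[of i] unfolding I_def by simp
    have "emeasure (interval_measure F) {0..0} = 0"
      using F by (subst emeasure_interval_measure_Icc) (auto dest: monoD)
    then show "I (\<tau> 0) = 0"
      unfolding I_def set_lebesgue_integral_def \<tau>(2)
      by (intro integral_eq_zero_AE AE_I[where N = "{0..0}"]) (auto split: split_indicator)
    show "norm (I (\<tau> (Suc i)) - I (\<tau> i) - (F (\<tau> (Suc i)) - F (\<tau> i)) *\<^sub>R a (X (\<tau> i))) \<le>
        K * \<rho> * (F (\<tau> (Suc i)) - F (\<tau> i))" for i
      unfolding I_def
    proof (rule stieltjes_integral_oscillation[OF F ca t0 _ \<tau>(3)])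
      show "\<tau> i \<le> \<tau> (Suc i)" using \<tau>(1) by (simp add: incseq_SucD)
      fix r assume r: "\<tau> i \<le> r" "r \<le> \<tau> (Suc i)"
      have "norm (a (X r) - a (X (\<tau> i))) \<le> K * norm (X r - X (\<tau> i))"
        using a(2)[of "X r - X (\<tau> i)"] by (simp add: linear_diff[OF a(1)])
      also have "\<dots> \<le> K * \<rho>" using osc[OF r] a(3) by (intro mult_left_mono) auto
      finally show "norm (a (X r) - a (X (\<tau> i))) \<le> K * \<rho>" .
    qed
  next
    show "norm (j (\<tau> i) - J (\<tau> i)) \<le> \<rho>" for i using j(1) t0 \<tau>(3) by simp
  qed (simp_all add: a j(2) \<tau>(2) \<rho>)
  also have "\<dots> \<le> (\<rho> + \<rho>) * exp (K * (F T - F 0))"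
  proof (rule mult_left_mono)
    show "exp (K * (F (\<tau> i) - F (\<tau> 0))) \<le> exp (K * (F T - F 0))"
      unfolding exp_le_cancel_iff using a(3) monoD[OF F(1) \<tau>(3)[of i]] \<tau>(2) by (intro mult_left_mono) auto
  qed (use \<rho> in simp)
  finally show ?thesis by simp
qed

text \<open>
  The accumulated positive part of the drift of the weighted energy is of the order of the
  discretisation error \<open>\<rho>\<close>. In each cell the noise term is compensated by the weight up to an
  error proportional to the increment of \<open>\<Gamma>\<close>, of the clock, or of the \<open>L\<^sup>2\<close> distance of \<open>S\<close> and \<open>H\<close>,
  and all three have finite sums.
\<close>

lemma sum_excess_bound:
  fixes L :: "'v::euclidean_space \<Rightarrow> 'b::real_normed_vector" and F q :: "real \<Rightarrow> real"
    and X H S :: "real \<Rightarrow> 'v" and y \<xi> :: "nat \<Rightarrow> 'v"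
  defines "\<Gamma> \<equiv> \<lambda>u. LINT v:{0..u}|lebesgue. q v"
  assumes F: "mono F" "continuous_on UNIV F" "F 0 = 0"
    and q: "set_integrable lebesgue {0..} q" "\<And>u. q u \<ge> 0"
    and L: "linear L" "\<And>v. norm (L v) \<le> K * norm v" "K \<ge> 0" "\<And>v. c * norm v \<le> norm (L v)" "c > 0"
    and a: "\<And>v. norm (a v) \<le> Ka * norm v" "Ka \<ge> 0"
    and H: "set_borel_measurable borel {0..} H"
       "\<And>s. s \<in> {0..T} \<Longrightarrow> (norm (H s))\<^sup>2 \<le> q (F s) * (norm (X s))\<^sup>2"
    and S: "S \<in> borel_measurable borel" "\<And>i s. s \<in> {\<tau> i<..\<tau> (Suc i)} \<Longrightarrow> S s = \<xi> i"
    and \<tau>: "incseq \<tau>" "\<tau> 0 = 0" "\<And>i. \<tau> i \<le> T"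
    and R: "\<And>s. s \<in> {0..T} \<Longrightarrow> norm (X s) \<le> R" "\<And>i. norm (y i) \<le> R"
    and osc: "\<And>i s. \<tau> i \<le> s \<Longrightarrow> s \<le> \<tau> (Suc i) \<Longrightarrow> norm (X s - y i) \<le> \<rho>"
       "\<And>i. F (\<tau> (Suc i)) - F (\<tau> i) \<le> \<rho>"
    and SH: "(\<integral>\<^sup>+s\<in>{0..T}. ennreal ((norm (S s - H s))\<^sup>2) \<partial>interval_measure F) \<le> ennreal \<rho>"
    and \<rho>: "\<rho> \<ge> 0"
  shows "(\<Sum>i<m. max 0
      ((F (\<tau> (Suc i)) - F (\<tau> i))\<^sup>2 * (norm (L (a (y i))))\<^sup>2 + (F (\<tau> (Suc i)) - F (\<tau> i)) * (norm (L (\<xi> i)))\<^sup>2 -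
       2 * K\<^sup>2 / c\<^sup>2 * (\<Gamma> (F (\<tau> (Suc i))) - \<Gamma> (F (\<tau> i))) * (norm (L (y i)))\<^sup>2))
    \<le> \<rho> * (4 * K ^ 4 * R / c\<^sup>2 * \<Gamma> (F T) + (K * Ka * R)\<^sup>2 * F T + 2 * K\<^sup>2)"
proof -
  define \<Delta> where "\<Delta> i = F (\<tau> (Suc i)) - F (\<tau> i)" for i
  define \<gamma> where "\<gamma> i = \<Gamma> (F (\<tau> (Suc i))) - \<Gamma> (F (\<tau> i))" for i
  have tS: "\<tau> i \<le> \<tau> (Suc i)" for i using \<tau>(1) by (simp add: incseq_SucD)
  have t0: "0 \<le> \<tau> i" for i using incseqD[OF \<tau>(1), of 0 i] \<tau>(2) by simp
  have \<Delta>: "\<Delta> i \<ge> 0" for i using monoD[OF F(1) tS] by (simp add: \<Delta>_def)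
  have F0: "F (\<tau> i) \<ge> 0" for i using monoD[OF F(1) t0[of i]] F(3) by simp
  have R0: "R \<ge> 0" using R(2)[of 0] norm_ge_zero[of "y 0"] by linarith
  have \<gamma>: "\<gamma> i = (LINT u:{F (\<tau> i)<..F (\<tau> (Suc i))}|lebesgue. q u)" for i
  proof -
    have *: "{0..F (\<tau> (Suc i))} = {0..F (\<tau> i)} \<union> {F (\<tau> i)<..F (\<tau> (Suc i))}"
      using F0[of i] monoD[OF F(1) tS[of i]] by auto
    have "\<Gamma> (F (\<tau> (Suc i))) = \<Gamma> (F (\<tau> i)) + (LINT u:{F (\<tau> i)<..F (\<tau> (Suc i))}|lebesgue. q u)"
      unfolding \<Gamma>_def *
      by (rule set_integral_Un) (use F0[of i] in \<open>auto intro!: set_integrable_subset[OF q(1)]\<close>)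
    then show ?thesis by (simp add: \<gamma>_def)
  qed
  have \<gamma>0: "\<gamma> i \<ge> 0" for i
    unfolding \<gamma> set_lebesgue_integral_def using q by (intro integral_nonneg_AE) auto
  define f where "f s = ennreal ((norm (S s - H s))\<^sup>2)" for s
  define C where "C i = {\<tau> i<..\<tau> (Suc i)}" for i
  have fm: "(\<lambda>s. f s * indicator {0..} s) \<in> borel_measurable borel"
  proof -
    have "(\<lambda>s. ennreal ((norm (indicator {0..} s *\<^sub>R S s - indicator {0..} s *\<^sub>R H s))\<^sup>2)) \<in> borel_measurable borel"
      using H(1) S(1) unfolding set_borel_measurable_def by measurable
    also have "(\<lambda>s. ennreal ((norm (indicator {0..} s *\<^sub>R S s - indicator {0..} s *\<^sub>R H s))\<^sup>2)) =
        (\<lambda>s. f s * indicator {0..} s)"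
      by (auto simp: f_def split: split_indicator)
    finally show ?thesis .
  qed
  have fC: "(\<lambda>s. f s * indicator (C i) s) \<in> borel_measurable borel" for i
  proof -
    have "(\<lambda>s. f s * indicator {0..} s * indicator (C i) s) \<in> borel_measurable borel"
      by (rule borel_measurable_times_ennreal[OF fm]) (simp add: C_def)
    also have "(\<lambda>s. f s * indicator {0..} s * indicator (C i) s) = (\<lambda>s. f s * indicator (C i) s)"
      using t0[of i] by (auto simp: C_def split: split_indicator)
    finally show ?thesis .
  qed
  have disj: "(\<Sum>i<m. indicator (C i) s) \<le> (indicator {0..T} s :: ennreal)" for s m
  proof -
    have "disjoint_family_on C {..<m}"
    proof (unfold disjoint_family_on_def, intro ballI impI)
      fix i j :: nat assume "i \<noteq> j"
      then have "Suc i \<le> j \<or> Suc j \<le> i" by linarith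
      then show "C i \<inter> C j = {}"
        using incseqD[OF \<tau>(1), of "Suc i" j] incseqD[OF \<tau>(1), of "Suc j" i] by (auto simp: C_def)
    qed
    then have "(\<Sum>i<m. indicator (C i) s) = (indicator (\<Union>i<m. C i) s :: ennreal)"
      by (simp add: indicator_UN_disjoint)
    also have "\<dots> \<le> indicator {0..T} s"
      using t0 \<tau>(3) by (fastforce simp: C_def split: split_indicator intro: order_trans less_imp_le)
    finally show ?thesis .
  qed
  define P where "P i = (\<integral>\<^sup>+s. f s * indicator (C i) s \<partial>interval_measure F)" for i
  have sumP: "(\<Sum>i<m. P i) \<le> ennreal \<rho>" for m
  proof -
    have "(\<Sum>i<m. P i) = (\<integral>\<^sup>+s. (\<Sum>i<m. f s * indicator (C i) s) \<partial>interval_measure F)"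
      unfolding P_def using fC by (intro nn_integral_sum[symmetric]) auto
    also have "\<dots> \<le> (\<integral>\<^sup>+s. f s * indicator {0..T} s \<partial>interval_measure F)"
      using disj by (intro nn_integral_mono) (auto simp: sum_distrib_left[symmetric] intro!: mult_left_mono)
    finally show ?thesis using SH by (simp add: f_def)
  qed
  define p where "p i = enn2real (P i)" for i
  have Pfin: "P i < \<infinity>" for i
  proof -
    have "P i \<le> (\<Sum>i<Suc i. P i)" by (simp add: add_increasing)
    also have "\<dots> \<le> ennreal \<rho>" by (rule sumP)
    also have "\<dots> < \<infinity>" by simp
    finally show ?thesis .
  qed
  have Pp: "P i = ennreal (p i)" and p0: "p i \<ge> 0" for i using Pfin[of i] by (auto simp: p_def)
  have sump: "(\<Sum>i<m. p i) \<le> \<rho>" for m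
    using sumP[of m] p0 \<rho> unfolding Pp by (simp add: sum_nonneg sum_ennreal)
  \<comment> \<open>From \<open>p\<^sup>2 - q\<^sup>2 = (p - q) (p + q)\<close> with \<open>p - q \<le> K \<rho>\<close> and \<open>p + q \<le> 2 K R\<close>.\<close>
  define \<eta> where "\<eta> = 2 * K\<^sup>2 * R * \<rho>"
  have \<eta>0: "\<eta> \<ge> 0" using R0 \<rho> by (simp add: \<eta>_def)
  have LX: "(norm (L (X s)))\<^sup>2 \<le> (norm (L (y i)))\<^sup>2 + \<eta>" if "s \<in> C i" for s i
  proof -
    have s: "\<tau> i \<le> s" "s \<le> \<tau> (Suc i)" "s \<in> {0..T}"
      using that t0[of i] \<tau>(3)[of "Suc i"] by (auto simp: C_def)
    have "norm (L (X s)) - norm (L (y i)) \<le> norm (L (X s) - L (y i))" by (rule norm_triangle_ineq2)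
    also have "\<dots> \<le> K * norm (X s - y i)" using L(2)[of "X s - y i"] by (simp add: linear_diff[OF L(1)])
    also have "\<dots> \<le> K * \<rho>" using osc(1)[OF s(1,2)] L(3) by (intro mult_left_mono) auto
    finally have d: "norm (L (X s)) - norm (L (y i)) \<le> K * \<rho>" .
    have "norm (L (X s)) \<le> K * R" "norm (L (y i)) \<le> K * R"
      using order_trans[OF L(2) mult_left_mono[OF R(1)[OF s(3)] L(3)]]
        order_trans[OF L(2) mult_left_mono[OF R(2) L(3)]] by auto
    then have "(norm (L (X s)) - norm (L (y i))) * (norm (L (X s)) + norm (L (y i))) \<le> K * \<rho> * (2 * K * R)"
      using d L(3) \<rho> by (intro order_trans[OF mult_right_mono[OF d] mult_left_mono]) auto
    then show ?thesis by (simp add: \<eta>_def power2_eq_square algebra_simps)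
  qed
  have cell: "max 0 ((\<Delta> i)\<^sup>2 * (norm (L (a (y i))))\<^sup>2 + \<Delta> i * (norm (L (\<xi> i)))\<^sup>2 -
       2 * K\<^sup>2 / c\<^sup>2 * \<gamma> i * (norm (L (y i)))\<^sup>2) \<le>
      2 * K\<^sup>2 / c\<^sup>2 * \<eta> * \<gamma> i + \<rho> * (K * Ka * R)\<^sup>2 * \<Delta> i + 2 * K\<^sup>2 * p i" for i
  proof -
    have "\<Delta> i * (norm (L (\<xi> i)))\<^sup>2 \<le>
      2 * K\<^sup>2 / c\<^sup>2 * (LINT u:{F (\<tau> i)<..F (\<tau> (Suc i))}|lebesgue. q u) * ((norm (L (y i)))\<^sup>2 + \<eta>) + 2 * K\<^sup>2 * p i"
      unfolding \<Delta>_def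
    proof (rule excess_cell_bound[OF F(1,2) tS F0 q L(2,3,4,5)])
      show "set_borel_measurable borel {\<tau> i<..\<tau> (Suc i)} H"
        by (rule set_borel_measurable_subset[OF H(1)]) (use t0[of i] in auto)
      show "(norm (H s))\<^sup>2 \<le> q (F s) * (norm (X s))\<^sup>2" if "s \<in> {\<tau> i<..\<tau> (Suc i)}" for s
        using that t0[of i] \<tau>(3)[of "Suc i"] by (intro H(2)) auto
      show "(norm (L (X s)))\<^sup>2 \<le> (norm (L (y i)))\<^sup>2 + \<eta>" if "s \<in> {\<tau> i<..\<tau> (Suc i)}" for s
        using LX that by (simp add: C_def)
      have "P i = (\<integral>\<^sup>+s\<in>{\<tau> i<..\<tau> (Suc i)}. ennreal ((norm (\<xi> i - H s))\<^sup>2) \<partial>interval_measure F)"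
        unfolding P_def f_def C_def by (intro nn_integral_cong) (auto simp: S(2) split: split_indicator)
      then show "(\<integral>\<^sup>+s\<in>{\<tau> i<..\<tau> (Suc i)}. ennreal ((norm (\<xi> i - H s))\<^sup>2) \<partial>interval_measure F) = ennreal (p i)"
        using Pp by simp
    qed (use \<eta>0 p0 in auto)
    moreover have "(\<Delta> i)\<^sup>2 * (norm (L (a (y i))))\<^sup>2 \<le> \<rho> * (K * Ka * R)\<^sup>2 * \<Delta> i"
    proof -
      have "norm (L (a (y i))) \<le> K * (Ka * R)"
        using order_trans[OF L(2) mult_left_mono[OF order_trans[OF a(1) mult_left_mono[OF R(2) a(2)]] L(3)]] .
      then have "(norm (L (a (y i))))\<^sup>2 \<le> (K * Ka * R)\<^sup>2" by (intro power_mono) (auto simp: mult.assoc)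
      moreover have "(\<Delta> i)\<^sup>2 \<le> \<rho> * \<Delta> i"
        using osc(2)[of i] \<Delta>[of i] by (simp add: power2_eq_square \<Delta>_def[symmetric] mult_right_mono)
      ultimately have "(\<Delta> i)\<^sup>2 * (norm (L (a (y i))))\<^sup>2 \<le> (\<rho> * \<Delta> i) * (K * Ka * R)\<^sup>2"
        using \<Delta> \<rho> by (intro mult_mono) auto
      then show ?thesis by (simp add: mult.commute mult.left_commute)
    qed
    moreover have "0 \<le> 2 * K\<^sup>2 / c\<^sup>2 * \<eta> * \<gamma> i + \<rho> * (K * Ka * R)\<^sup>2 * \<Delta> i + 2 * K\<^sup>2 * p i"
      using \<eta>0 \<gamma>0 \<rho> \<Delta> p0 by (intro add_nonneg_nonneg mult_nonneg_nonneg divide_nonneg_nonneg) auto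
    ultimately show ?thesis unfolding \<gamma>[symmetric] by (simp add: algebra_simps add_divide_distrib)
  qed
  have "(\<Sum>i<m. max 0 ((\<Delta> i)\<^sup>2 * (norm (L (a (y i))))\<^sup>2 + \<Delta> i * (norm (L (\<xi> i)))\<^sup>2 -
       2 * K\<^sup>2 / c\<^sup>2 * \<gamma> i * (norm (L (y i)))\<^sup>2)) \<le>
      (\<Sum>i<m. 2 * K\<^sup>2 / c\<^sup>2 * \<eta> * \<gamma> i + \<rho> * (K * Ka * R)\<^sup>2 * \<Delta> i + 2 * K\<^sup>2 * p i)"
    by (intro sum_mono cell)
  also have "\<dots> = 2 * K\<^sup>2 / c\<^sup>2 * \<eta> * (\<Sum>i<m. \<gamma> i) + \<rho> * (K * Ka * R)\<^sup>2 * (\<Sum>i<m. \<Delta> i) + 2 * K\<^sup>2 * (\<Sum>i<m. p i)"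
    by (simp only: sum.distrib sum_distrib_left)
  also have "\<dots> \<le> 2 * K\<^sup>2 / c\<^sup>2 * \<eta> * \<Gamma> (F T) + \<rho> * (K * Ka * R)\<^sup>2 * F T + 2 * K\<^sup>2 * \<rho>"
  proof (intro add_mono mult_left_mono)
    have "(\<Sum>i<m. \<Delta> i) = F (\<tau> m)" unfolding \<Delta>_def sum_lessThan_telescope[of "\<lambda>i. F (\<tau> i)"] using F(3) \<tau>(2) by simp
    then show "(\<Sum>i<m. \<Delta> i) \<le> F T" using monoD[OF F(1) \<tau>(3)] by simp
    have "(\<Sum>i<m. \<gamma> i) = \<Gamma> (F (\<tau> m)) - \<Gamma> (F (\<tau> 0))" unfolding \<gamma>_def by (rule sum_lessThan_telescope)
    also have "\<Gamma> (F (\<tau> 0)) \<ge> 0"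
      unfolding \<Gamma>_def set_lebesgue_integral_def using q by (intro integral_nonneg_AE) auto
    then have "\<Gamma> (F (\<tau> m)) - \<Gamma> (F (\<tau> 0)) \<le> \<Gamma> (F (\<tau> m))" by simp
    also have "\<dots> \<le> \<Gamma> (F T)"
      unfolding \<Gamma>_def set_lebesgue_integral_def
    proof (rule integral_mono)
      have "set_integrable lebesgue {0..u} q" for u by (rule set_integrable_subset[OF q(1)]) auto
      then show "integrable lebesgue (\<lambda>x. indicat_real {0..F (\<tau> m)} x *\<^sub>R q x)"
        "integrable lebesgue (\<lambda>x. indicat_real {0..F T} x *\<^sub>R q x)" by (auto simp: set_integrable_def)
    qed (use monoD[OF F(1) \<tau>(3)[of m]] q in \<open>auto split: split_indicator\<close>)
    finally show "(\<Sum>i<m. \<gamma> i) \<le> \<Gamma> (F T)" .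
  qed (use sump \<eta>0 \<rho> in auto)
  also have "\<dots> = \<rho> * (4 * K ^ 4 * R / c\<^sup>2 * \<Gamma> (F T) + (K * Ka * R)\<^sup>2 * F T + 2 * K\<^sup>2)"
    by (simp add: \<eta>_def algebra_simps power2_eq_square power4_eq_xxxx)
  finally show ?thesis by (simp add: \<Delta>_def \<gamma>_def)
qed

text \<open>
  Everything that is used about a single path: eventually the schemes are uniformly close to the
  solution, and the predictable stopping rule for the drift does not become active.
\<close>

lemma euler_scheme_converges:
  fixes L :: "'v::euclidean_space \<Rightarrow> 'b::real_normed_vector" and F q :: "real \<Rightarrow> real"
    and X H J :: "real \<Rightarrow> 'v" and S j :: "nat \<Rightarrow> real \<Rightarrow> 'v" and \<xi> :: "nat \<Rightarrow> nat \<Rightarrow> 'v"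
    and \<tau> :: "nat \<Rightarrow> nat \<Rightarrow> real" and K c \<mu> :: real and a :: "'v \<Rightarrow> 'v" and x0 :: 'v
  defines "\<Gamma> \<equiv> \<lambda>u. LINT v:{0..u}|lebesgue. q v"
    and "y \<equiv> \<lambda>k. euler_scheme a x0 (\<lambda>i. F (\<tau> k i)) (\<lambda>i. j k (\<tau> k (Suc i)) - j k (\<tau> k i))"
    and "C \<equiv> 2 * K\<^sup>2 / c\<^sup>2"
  assumes F: "mono F" "continuous_on UNIV F" "F 0 = 0"
    and q: "set_integrable lebesgue {0..} q" "\<And>u. q u \<ge> 0"
    and L: "linear L" "\<And>v. norm (L v) \<le> K * norm v" "K \<ge> 0" "\<And>v. c * norm v \<le> norm (L v)" "c > 0"
    and a: "linear a"
    and X: "continuous_on {0..T} X"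
      "\<And>t. t \<in> {0..T} \<Longrightarrow> X t = x0 + (LINT s:{0..t}|interval_measure F. a (X s)) + J t"
    and H: "set_borel_measurable borel {0..} H"
       "\<And>s. s \<in> {0..T} \<Longrightarrow> (norm (H s))\<^sup>2 \<le> q (F s) * (norm (X s))\<^sup>2"
    and \<tau>: "\<And>k. incseq (\<tau> k)" "\<And>k. \<tau> k 0 = 0" "\<And>k i. \<tau> k i \<le> T"
       "\<And>k i. \<tau> k (Suc i) - \<tau> k i \<le> \<delta> k" "\<delta> \<longlonglongrightarrow> 0"
    and S: "\<And>k. S k \<in> borel_measurable borel" "\<And>k i s. s \<in> {\<tau> k i<..\<tau> k (Suc i)} \<Longrightarrow> S k s = \<xi> k i"
       "(\<lambda>k. \<integral>\<^sup>+s\<in>{0..T}. ennreal ((norm (S k s - H s))\<^sup>2) \<partial>interval_measure F) \<longlonglongrightarrow> 0"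
    and j: "uniform_limit {0..T} j J sequentially" "\<And>k. j k 0 = 0"
    and \<mu>: "\<mu> \<ge> 0"
  shows "\<And>\<eta>. \<eta> > 0 \<Longrightarrow> \<forall>\<^sub>F k in sequentially. \<forall>i. norm (y k i - X (\<tau> k i)) \<le> \<eta>"
    and "\<And>\<epsilon>. \<epsilon> > 0 \<Longrightarrow> \<forall>\<^sub>F k in sequentially. \<forall>m.
      (\<Sum>i<m. exp (2 * \<mu> * F (\<tau> k (Suc i)) - C * \<Gamma> (F (\<tau> k (Suc i)))) * max 0
      ((F (\<tau> k (Suc i)) - F (\<tau> k i))\<^sup>2 * (norm (L (a (y k i))))\<^sup>2 + (F (\<tau> k (Suc i)) - F (\<tau> k i)) * (norm (L (\<xi> k i)))\<^sup>2 -
       C * (\<Gamma> (F (\<tau> k (Suc i))) - \<Gamma> (F (\<tau> k i))) * (norm (L (y k i)))\<^sup>2)) \<le> \<epsilon>"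
proof -
  have t0: "0 \<le> \<tau> k i" for k i using incseqD[OF \<tau>(1), of 0 i k] \<tau>(2)[of k] by simp
  have tS: "\<tau> k i \<le> \<tau> k (Suc i)" for k i using \<tau>(1) by (simp add: incseq_SucD)
  have T0: "0 \<le> T" using t0[of 0 0] \<tau>(3)[of 0 0] by linarith
  obtain Ka where Ka: "\<And>v. norm (a v) \<le> Ka * norm v" "Ka > 0"
    using linear_conv_bounded_linear[of a] a bounded_linear.pos_bounded by (metis mult.commute)
  have unif: "\<forall>\<^sub>F k in sequentially. \<forall>i s. \<tau> k i \<le> s \<longrightarrow> s \<le> \<tau> k (Suc i) \<longrightarrow> dist (h s) (h (\<tau> k i)) < \<rho>"
    if h: "continuous_on {0..T} h" and \<rho>: "\<rho> > 0" for h :: "real \<Rightarrow> 'c::metric_space" and \<rho>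
  proof -
    have "uniformly_continuous_on {0..T} h" using h by (intro compact_uniformly_continuous) auto
    then obtain d where d: "d > 0" "\<And>s t. s \<in> {0..T} \<Longrightarrow> t \<in> {0..T} \<Longrightarrow> dist t s < d \<Longrightarrow> dist (h t) (h s) < \<rho>"
      using \<rho> unfolding uniformly_continuous_on_def by metis
    have "\<forall>\<^sub>F k in sequentially. \<delta> k < d" using \<tau>(5) d(1) by (rule order_tendstoD)
    then show ?thesis
    proof eventually_elim
      fix k assume k: "\<delta> k < d"
      show "\<forall>i s. \<tau> k i \<le> s \<longrightarrow> s \<le> \<tau> k (Suc i) \<longrightarrow> dist (h s) (h (\<tau> k i)) < \<rho>"
      proof (intro allI impI)
        fix i s assume s: "\<tau> k i \<le> s" "s \<le> \<tau> k (Suc i)"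
        show "dist (h s) (h (\<tau> k i)) < \<rho>"
          using s t0[of k i] \<tau>(3)[of k i] \<tau>(3)[of k "Suc i"] \<tau>(4)[of k i] k
          by (intro d(2)) (auto simp: dist_real_def)
      qed
    qed
  qed
  have err: "\<forall>\<^sub>F k in sequentially. \<forall>i. norm (y k i - X (\<tau> k i)) \<le> \<eta>" if \<eta>: "\<eta> > 0" for \<eta>
  proof -
    define \<rho> where "\<rho> = \<eta> / (2 * exp (Ka * (F T - F 0)))"
    have \<rho>: "\<rho> > 0" using \<eta> by (simp add: \<rho>_def)
    have "\<forall>\<^sub>F k in sequentially. \<forall>t\<in>{0..T}. dist (j k t) (J t) < \<rho>"
      using j(1) \<rho> by (rule uniform_limitD)
    then show ?thesis using unif[OF X(1) \<rho>]
    proof eventually_elim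
      fix k assume k: "\<forall>t\<in>{0..T}. dist (j k t) (J t) < \<rho>"
        "\<forall>i s. \<tau> k i \<le> s \<longrightarrow> s \<le> \<tau> k (Suc i) \<longrightarrow> dist (X s) (X (\<tau> k i)) < \<rho>"
      have "norm (y k i - X (\<tau> k i)) \<le> 2 * \<rho> * exp (Ka * (F T - F 0))" for i
        unfolding y_def
      proof (rule euler_scheme_error[OF F(1,2) a Ka(1) less_imp_le[OF Ka(2)] X \<tau>(1,2,3)])
        show "norm (X s - X (\<tau> k i)) \<le> \<rho>" if "\<tau> k i \<le> s" "s \<le> \<tau> k (Suc i)" for i s
          using k(2) that by (simp add: dist_norm less_imp_le)
        show "norm (j k t - J t) \<le> \<rho>" if "t \<in> {0..T}" for t
          using k(1) that by (simp add: dist_norm less_imp_le)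
      qed (auto simp: j(2))
      then show "\<forall>i. norm (y k i - X (\<tau> k i)) \<le> \<eta>" by (simp add: \<rho>_def)
    qed
  qed
  then show "\<And>\<eta>. \<eta> > 0 \<Longrightarrow> \<forall>\<^sub>F k in sequentially. \<forall>i. norm (y k i - X (\<tau> k i)) \<le> \<eta>" .
  fix \<epsilon> :: real assume \<epsilon>: "\<epsilon> > 0"
  have "bounded (X ` {0..T})" using X(1) by (intro compact_imp_bounded compact_continuous_image) auto
  then obtain R0 where R0: "\<And>s. s \<in> {0..T} \<Longrightarrow> norm (X s) \<le> R0" unfolding bounded_iff by blast
  define R where "R = R0 + 1"
  have Rn: "R \<ge> 0" using R0[of 0] T0 norm_ge_zero[of "X 0"] by (simp add: R_def del: norm_ge_zero)
  have \<Gamma>0: "\<Gamma> u \<ge> 0" for u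
    unfolding \<Gamma>_def set_lebesgue_integral_def using q by (intro integral_nonneg_AE) auto
  have F0: "F s \<ge> 0" if "s \<ge> 0" for s using monoD[OF F(1) that] F(3) by simp
  define B where "B = 4 * K ^ 4 * R / c\<^sup>2 * \<Gamma> (F T) + (K * Ka * R)\<^sup>2 * F T + 2 * K\<^sup>2"
  have B: "B \<ge> 0" using Rn \<Gamma>0 F0[OF T0] L by (simp add: B_def)
  define W where "W = exp (2 * \<mu> * F T)"
  \<comment> \<open>The accumulated drift is at most \<open>\<rho> B\<close>, and the weights are at most \<open>W\<close>.\<close>
  define \<rho> where "\<rho> = min 1 (\<epsilon> / (W * (B + 1)))"
  have \<rho>: "\<rho> > 0" "\<rho> \<le> 1" and W\<rho>: "W * (\<rho> * B) \<le> \<epsilon>"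
  proof -
    have WB: "W * (B + 1) > 0" using B by (simp add: W_def)
    then show "\<rho> > 0" "\<rho> \<le> 1" using \<epsilon> by (auto simp: \<rho>_def)
    have "W * (\<rho> * B) \<le> (W * (B + 1)) * \<rho>" using \<open>\<rho> > 0\<close> by (simp add: W_def algebra_simps)
    also have "\<dots> \<le> (W * (B + 1)) * (\<epsilon> / (W * (B + 1)))"
      using WB by (intro mult_left_mono) (auto simp: \<rho>_def)
    also have "\<dots> = \<epsilon>"
    proof -
      have "P * (\<epsilon> / P) = \<epsilon>" if "P > 0" for P using that by simp
      then show ?thesis using WB by blast
    qed
    finally show "W * (\<rho> * B) \<le> \<epsilon>" .
  qed
  have "\<forall>\<^sub>F k in sequentially. (\<integral>\<^sup>+s\<in>{0..T}. ennreal ((norm (S k s - H s))\<^sup>2) \<partial>interval_measure F) < ennreal \<rho>"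
    using S(3) by (rule order_tendstoD) (use \<rho> in simp)
  moreover have "\<forall>\<^sub>F k in sequentially. \<forall>i. norm (y k i - X (\<tau> k i)) \<le> \<rho> / 2" using \<rho> by (intro err) simp
  moreover have "\<forall>\<^sub>F k in sequentially. \<forall>i s. \<tau> k i \<le> s \<longrightarrow> s \<le> \<tau> k (Suc i) \<longrightarrow> dist (X s) (X (\<tau> k i)) < \<rho> / 2"
    using \<rho> by (intro unif X(1)) simp
  moreover have "\<forall>\<^sub>F k in sequentially. \<forall>i s. \<tau> k i \<le> s \<longrightarrow> s \<le> \<tau> k (Suc i) \<longrightarrow> dist (F s) (F (\<tau> k i)) < \<rho>"
    using \<rho> by (intro unif continuous_on_subset[OF F(2)]) auto
  ultimately show "\<forall>\<^sub>F k in sequentially. \<forall>m.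
      (\<Sum>i<m. exp (2 * \<mu> * F (\<tau> k (Suc i)) - C * \<Gamma> (F (\<tau> k (Suc i)))) * max 0
      ((F (\<tau> k (Suc i)) - F (\<tau> k i))\<^sup>2 * (norm (L (a (y k i))))\<^sup>2 + (F (\<tau> k (Suc i)) - F (\<tau> k i)) * (norm (L (\<xi> k i)))\<^sup>2 -
       C * (\<Gamma> (F (\<tau> k (Suc i))) - \<Gamma> (F (\<tau> k i))) * (norm (L (y k i)))\<^sup>2)) \<le> \<epsilon>"
  proof eventually_elim
    fix k
    assume SH: "(\<integral>\<^sup>+s\<in>{0..T}. ennreal ((norm (S k s - H s))\<^sup>2) \<partial>interval_measure F) < ennreal \<rho>"
      and yX: "\<forall>i. norm (y k i - X (\<tau> k i)) \<le> \<rho> / 2"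
      and Xo: "\<forall>i s. \<tau> k i \<le> s \<longrightarrow> s \<le> \<tau> k (Suc i) \<longrightarrow> dist (X s) (X (\<tau> k i)) < \<rho> / 2"
      and Fo: "\<forall>i s. \<tau> k i \<le> s \<longrightarrow> s \<le> \<tau> k (Suc i) \<longrightarrow> dist (F s) (F (\<tau> k i)) < \<rho>"
    have sum: "(\<Sum>i<m. max 0
      ((F (\<tau> k (Suc i)) - F (\<tau> k i))\<^sup>2 * (norm (L (a (y k i))))\<^sup>2 + (F (\<tau> k (Suc i)) - F (\<tau> k i)) * (norm (L (\<xi> k i)))\<^sup>2 -
       C * (\<Gamma> (F (\<tau> k (Suc i))) - \<Gamma> (F (\<tau> k i))) * (norm (L (y k i)))\<^sup>2)) \<le> \<rho> * B" for m
      unfolding B_def C_def \<Gamma>_def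
    proof (rule sum_excess_bound[OF F q L Ka(1) less_imp_le[OF Ka(2)] H S(1,2) \<tau>(1,2,3)])
      show "norm (X s) \<le> R" if "s \<in> {0..T}" for s using R0[OF that] by (simp add: R_def)
      show "norm (y k i) \<le> R" for i
      proof -
        have "norm (y k i) \<le> norm (X (\<tau> k i)) + norm (y k i - X (\<tau> k i))" by (rule norm_triangle_sub)
        also have "\<dots> \<le> R0 + 1" using R0[of "\<tau> k i"] t0[of k i] \<tau>(3)[of k i] yX[rule_format, of i] \<rho>
          by (intro add_mono) auto
        finally show ?thesis by (simp add: R_def)
      qed
      show "norm (X s - y k i) \<le> \<rho>" if "\<tau> k i \<le> s" "s \<le> \<tau> k (Suc i)" for i s
      proof -
        have "dist (X s) (y k i) \<le> dist (X s) (X (\<tau> k i)) + dist (y k i) (X (\<tau> k i))" by (rule dist_triangle2)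
        also have "\<dots> \<le> \<rho> / 2 + \<rho> / 2" using Xo that yX by (intro add_mono) (auto simp: dist_norm less_imp_le)
        finally show ?thesis by (simp add: dist_norm)
      qed
      show "F (\<tau> k (Suc i)) - F (\<tau> k i) \<le> \<rho>" for i
      proof -
        have "dist (F (\<tau> k (Suc i))) (F (\<tau> k i)) < \<rho>" using Fo tS[of k i] by blast
        then show ?thesis by (simp add: dist_real_def)
      qed
    qed (use SH \<rho> in auto)
    show "\<forall>m. (\<Sum>i<m. exp (2 * \<mu> * F (\<tau> k (Suc i)) - C * \<Gamma> (F (\<tau> k (Suc i)))) * max 0
      ((F (\<tau> k (Suc i)) - F (\<tau> k i))\<^sup>2 * (norm (L (a (y k i))))\<^sup>2 + (F (\<tau> k (Suc i)) - F (\<tau> k i)) * (norm (L (\<xi> k i)))\<^sup>2 -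
       C * (\<Gamma> (F (\<tau> k (Suc i))) - \<Gamma> (F (\<tau> k i))) * (norm (L (y k i)))\<^sup>2)) \<le> \<epsilon>"
    proof
      fix m
      let ?D = "\<lambda>i. max 0
        ((F (\<tau> k (Suc i)) - F (\<tau> k i))\<^sup>2 * (norm (L (a (y k i))))\<^sup>2 + (F (\<tau> k (Suc i)) - F (\<tau> k i)) * (norm (L (\<xi> k i)))\<^sup>2 -
        C * (\<Gamma> (F (\<tau> k (Suc i))) - \<Gamma> (F (\<tau> k i))) * (norm (L (y k i)))\<^sup>2)"
      have ex: "exp (2 * \<mu> * F (\<tau> k i) - C * \<Gamma> (F (\<tau> k i))) \<le> W" for i
      proof -
        have "C * \<Gamma> (F (\<tau> k i)) \<ge> 0" using \<Gamma>0 by (simp add: C_def)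
        moreover have "2 * \<mu> * F (\<tau> k i) \<le> 2 * \<mu> * F T"
          using \<mu> monoD[OF F(1) \<tau>(3)] by (intro mult_left_mono) auto
        ultimately show ?thesis by (simp add: W_def)
      qed
      have "(\<Sum>i<m. exp (2 * \<mu> * F (\<tau> k (Suc i)) - C * \<Gamma> (F (\<tau> k (Suc i)))) * ?D i) \<le> (\<Sum>i<m. W * ?D i)"
        by (intro sum_mono mult_right_mono ex) simp
      also have "\<dots> = W * (\<Sum>i<m. ?D i)" by (simp only: sum_distrib_left)
      also have "\<dots> \<le> W * (\<rho> * B)" by (intro mult_left_mono sum) (simp add: W_def)
      also note W\<rho>
      finally show "(\<Sum>i<m. exp (2 * \<mu> * F (\<tau> k (Suc i)) - C * \<Gamma> (F (\<tau> k (Suc i)))) * ?D i) \<le> \<epsilon>" .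
    qed
  qed
qed

section \<open>Martingale increments and the stopped energy\<close>

lemma integrable_bounded_mult:
  fixes c f :: "'w \<Rightarrow> real"
  assumes "integrable M f" "c \<in> borel_measurable M" "\<And>\<omega>. \<omega> \<in> space M \<Longrightarrow> \<bar>c \<omega>\<bar> \<le> B"
  shows "integrable M (\<lambda>\<omega>. c \<omega> * f \<omega>)"
proof (rule Bochner_Integration.integrable_bound)
  show "integrable M (\<lambda>\<omega>. B * f \<omega>)" using assms by simp
  show "(\<lambda>\<omega>. c \<omega> * f \<omega>) \<in> borel_measurable M" using assms by measurable
  show "AE \<omega> in M. norm (c \<omega> * f \<omega>) \<le> norm (B * f \<omega>)"
  proof (rule AE_I2)
    fix \<omega> assume "\<omega> \<in> space M"
    then have "\<bar>c \<omega>\<bar> * \<bar>f \<omega>\<bar> \<le> \<bar>B\<bar> * \<bar>f \<omega>\<bar>"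
      using assms(3)[of \<omega>] by (intro mult_right_mono) auto
    then show "norm (c \<omega> * f \<omega>) \<le> norm (B * f \<omega>)" by (simp add: abs_mult)
  qed
qed

text \<open>
  The product with \<open>c\<close> is only required to be integrable: below, \<open>c\<close> also contains the unbounded
  factor \<open>N s\<close>.
\<close>

lemma martingale_increment_orthogonal:
  assumes "prob_space M" "martingale M G N" "0 \<le> s" "s \<le> t" "c \<in> borel_measurable (G s)"
    and "integrable M (\<lambda>\<omega>. c \<omega> * N t \<omega>)" "integrable M (\<lambda>\<omega>. c \<omega> * N s \<omega>)"
  shows "(\<integral>\<omega>. c \<omega> * (N t \<omega> - N s \<omega>) \<partial>M) = 0"
proof -
  interpret prob_space M by fact
  have sub: "subalgebra M (G s)" and int: "integrable M (N t)"
    and ce: "AE \<omega> in M. real_cond_exp M (G s) (N t) \<omega> = N s \<omega>"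
    using assms(2-4) by (auto simp: martingale_def)
  interpret finite_measure_subalgebra M "G s"
    by unfold_locales (rule sub)
  have cm: "c \<in> borel_measurable M" using measurable_from_subalg[OF sub assms(5)] .
  have "(\<integral>\<omega>. c \<omega> * N t \<omega> \<partial>M) = (\<integral>\<omega>. c \<omega> * real_cond_exp M (G s) (N t) \<omega> \<partial>M)"
    using real_cond_exp_intg(2)[OF assms(6,5)] int by simp
  also have "\<dots> = (\<integral>\<omega>. c \<omega> * N s \<omega> \<partial>M)"
    using ce assms(7) cm by (intro integral_cong_AE) auto
  finally show ?thesis using assms(6,7) by (simp add: right_diff_distrib)
qed

text \<open>
  The quadratic statement follows from
  \<open>(N\<^sub>t - N\<^sub>s)\<^sup>2 - (Q\<^sub>t - Q\<^sub>s) = (N\<^sub>t\<^sup>2 - Q\<^sub>t) - (N\<^sub>s\<^sup>2 - Q\<^sub>s) - 2 N\<^sub>s (N\<^sub>t - N\<^sub>s)\<close>, a sum of martingale increments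
  with coefficients known at time \<open>s\<close>.
\<close>

lemma square_integrable_martingale_increments:
  fixes c :: "'w \<Rightarrow> real"
  assumes "prob_space M" "square_integrable_martingale M G N"
    and mart: "martingale M G (\<lambda>t \<omega>. (N t \<omega>)\<^sup>2 - Q t \<omega>)"
    and st: "0 \<le> s" "s \<le> t" and c: "c \<in> borel_measurable (G s)" "\<And>\<omega>. \<omega> \<in> space M \<Longrightarrow> \<bar>c \<omega>\<bar> \<le> B"
  shows "integrable M (\<lambda>\<omega>. c \<omega> * (N t \<omega> - N s \<omega>))"
    and "(\<integral>\<omega>. c \<omega> * (N t \<omega> - N s \<omega>) \<partial>M) = 0"
    and "integrable M (\<lambda>\<omega>. c \<omega> * ((N t \<omega> - N s \<omega>)\<^sup>2 - (Q t \<omega> - Q s \<omega>)))"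
    and "(\<integral>\<omega>. c \<omega> * ((N t \<omega> - N s \<omega>)\<^sup>2 - (Q t \<omega> - Q s \<omega>)) \<partial>M) = 0"
proof -
  have N: "martingale M G N" and N2: "\<And>t. 0 \<le> t \<Longrightarrow> integrable M (\<lambda>\<omega>. (N t \<omega>)\<^sup>2)"
    using assms(2) by (auto simp: square_integrable_martingale_def)
  have sub: "subalgebra M (G s)" and intN: "integrable M (N t)" "integrable M (N s)"
    and intQ: "integrable M (\<lambda>\<omega>. (N t \<omega>)\<^sup>2 - Q t \<omega>)" "integrable M (\<lambda>\<omega>. (N s \<omega>)\<^sup>2 - Q s \<omega>)"
    and Ns: "N s \<in> borel_measurable (G s)"
    using N mart st by (auto simp: martingale_def)
  have cM: "c \<in> borel_measurable M" using measurable_from_subalg[OF sub c(1)] .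
  have NN: "integrable M (\<lambda>\<omega>. N s \<omega> * N t \<omega>)"
  proof (rule Bochner_Integration.integrable_bound)
    show "integrable M (\<lambda>\<omega>. (N s \<omega>)\<^sup>2 + (N t \<omega>)\<^sup>2)" using N2 st by simp
    show "(\<lambda>\<omega>. N s \<omega> * N t \<omega>) \<in> borel_measurable M" using intN by simp
    have "\<bar>x * y\<bar> \<le> x\<^sup>2 + y\<^sup>2" for x y :: real
    proof -
      have "2 * (\<bar>x\<bar> * \<bar>y\<bar>) \<le> x\<^sup>2 + y\<^sup>2" using sum_squares_bound[of "\<bar>x\<bar>" "\<bar>y\<bar>"] by simp
      moreover have "0 \<le> \<bar>x\<bar> * \<bar>y\<bar>" by simp
      ultimately show ?thesis unfolding abs_mult by linarith
    qed
    then show "AE \<omega> in M. norm (N s \<omega> * N t \<omega>) \<le> norm ((N s \<omega>)\<^sup>2 + (N t \<omega>)\<^sup>2)" by simp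
  qed
  note int = integrable_bounded_mult[OF _ cM c(2)]
  show 1: "integrable M (\<lambda>\<omega>. c \<omega> * (N t \<omega> - N s \<omega>))" using intN by (intro int) simp_all
  show "(\<integral>\<omega>. c \<omega> * (N t \<omega> - N s \<omega>) \<partial>M) = 0"
    by (rule martingale_increment_orthogonal[OF assms(1) N st c(1) int[OF intN(1)] int[OF intN(2)]])
  have sq: "c \<omega> * ((N t \<omega> - N s \<omega>)\<^sup>2 - (Q t \<omega> - Q s \<omega>)) =
      c \<omega> * (((N t \<omega>)\<^sup>2 - Q t \<omega>) - ((N s \<omega>)\<^sup>2 - Q s \<omega>)) - 2 * ((c \<omega> * N s \<omega>) * (N t \<omega> - N s \<omega>))" for \<omega>
    by (simp add: power2_eq_square algebra_simps)
  have i1: "integrable M (\<lambda>\<omega>. c \<omega> * (((N t \<omega>)\<^sup>2 - Q t \<omega>) - ((N s \<omega>)\<^sup>2 - Q s \<omega>)))"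
    by (rule int[OF Bochner_Integration.integrable_diff[OF intQ]])
  have i2: "integrable M (\<lambda>\<omega>. (c \<omega> * N s \<omega>) * N t \<omega>)" "integrable M (\<lambda>\<omega>. (c \<omega> * N s \<omega>) * N s \<omega>)"
    using int[OF NN] int[OF N2[OF st(1)]] by (simp_all add: mult.assoc power2_eq_square)
  then have i3: "integrable M (\<lambda>\<omega>. 2 * ((c \<omega> * N s \<omega>) * (N t \<omega> - N s \<omega>)))"
    by (simp add: right_diff_distrib)
  show "integrable M (\<lambda>\<omega>. c \<omega> * ((N t \<omega> - N s \<omega>)\<^sup>2 - (Q t \<omega> - Q s \<omega>)))"
    unfolding sq using i1 i3 by (rule Bochner_Integration.integrable_diff)
  have "(\<integral>\<omega>. (c \<omega> * N s \<omega>) * (N t \<omega> - N s \<omega>) \<partial>M) = 0"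
    by (rule martingale_increment_orthogonal[OF assms(1) N st]) (use c(1) Ns i2 in auto)
  moreover have "(\<integral>\<omega>. c \<omega> * (((N t \<omega>)\<^sup>2 - Q t \<omega>) - ((N s \<omega>)\<^sup>2 - Q s \<omega>)) \<partial>M) = 0"
    by (rule martingale_increment_orthogonal[OF assms(1) mart st c(1) int[OF intQ(1)] int[OF intQ(2)]])
  ultimately show "(\<integral>\<omega>. c \<omega> * ((N t \<omega> - N s \<omega>)\<^sup>2 - (Q t \<omega> - Q s \<omega>)) \<partial>M) = 0"
    unfolding sq using i1 i3 by simp
qed

text \<open>
  Each condition in the stopping rule \<open>good i\<close> is known at time \<open>\<tau> i\<close>, although it mentions the
  clock at later times: by assumption the clock is measurable at every time. As long as \<open>good\<close>
  holds, scheme, clock and weight are bounded by constants, so that the martingale increments in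
  \<open>energy_step\<close> have bounded coefficients and vanish in expectation; the remaining drift sums to at
  most \<open>\<epsilon>\<close> by the rule itself. The weight \<open>Z\<close> is arbitrary in order to replace conditioning on
  the initial \<open>\<sigma>\<close>-algebra.
\<close>

lemma stopped_energy_estimate:
  fixes L :: "'v::euclidean_space \<Rightarrow> 'b::euclidean_space" and a :: "'v \<Rightarrow> 'v" and x0 :: 'v
    and N E :: "real \<Rightarrow> 'w \<Rightarrow> real" and \<xi> :: "nat \<Rightarrow> 'w \<Rightarrow> 'v" and \<Gamma> :: "real \<Rightarrow> real"
    and \<tau> :: "nat \<Rightarrow> real" and \<mu> C R \<epsilon> :: real
  defines "y \<equiv> \<lambda>\<omega>. euler_scheme a x0 (\<lambda>i. E (\<tau> i) \<omega>) (\<lambda>i. (N (\<tau> (Suc i)) \<omega> - N (\<tau> i) \<omega>) *\<^sub>R \<xi> i \<omega>)"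
    and "w \<equiv> \<lambda>i \<omega>. exp (2 * \<mu> * E (\<tau> i) \<omega> - C * \<Gamma> (E (\<tau> i) \<omega>))"
  defines "D \<equiv> \<lambda>i \<omega>. (E (\<tau> (Suc i)) \<omega> - E (\<tau> i) \<omega>)\<^sup>2 * (norm (L (a (y \<omega> i))))\<^sup>2 +
       (E (\<tau> (Suc i)) \<omega> - E (\<tau> i) \<omega>) * (norm (L (\<xi> i \<omega>)))\<^sup>2 -
       C * (\<Gamma> (E (\<tau> (Suc i)) \<omega>) - \<Gamma> (E (\<tau> i) \<omega>)) * (norm (L (y \<omega> i)))\<^sup>2"
  defines "good \<equiv> \<lambda>i \<omega>. (\<forall>l\<in>{..Suc i}. 0 \<le> E (\<tau> l) \<omega> \<and> E (\<tau> l) \<omega> \<le> R) \<and> (\<forall>l\<in>{..i}. norm (y \<omega> l) \<le> R) \<and>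
       (\<Sum>l\<le>i. w (Suc l) \<omega> * max 0 (D l \<omega>)) \<le> \<epsilon>"
  assumes M: "prob_space M"
    and N: "square_integrable_martingale M G N" "martingale M G (\<lambda>t \<omega>. (N t \<omega>)\<^sup>2 - E t \<omega>)"
    and E: "\<And>s t. 0 \<le> s \<Longrightarrow> 0 \<le> t \<Longrightarrow> E s \<in> borel_measurable (G t)"
      "AE \<omega> in M. E 0 \<omega> = 0 \<and> mono_on {0..} (\<lambda>t. E t \<omega>)"
    and \<tau>: "incseq \<tau>" "\<tau> 0 = 0"
    and \<xi>: "\<And>i. \<xi> i \<in> borel_measurable (G (\<tau> i))" "\<And>i. \<exists>B. \<forall>\<omega>\<in>space M. norm (\<xi> i \<omega>) \<le> B"
    and L: "linear L" and a: "linear a"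
    and dis: "\<And>v. inner (L v) (L (a v)) \<le> - \<mu> * (norm (L v))\<^sup>2" "\<mu> \<ge> 0"
    and \<Gamma>: "mono \<Gamma>" "\<Gamma> 0 = 0" "C \<ge> 0"
    and Z: "Z \<in> borel_measurable (G 0)" "\<And>\<omega>. 0 \<le> Z \<omega>" "\<And>\<omega>. Z \<omega> \<le> 1"
    and \<epsilon>: "\<epsilon> \<ge> 0"
  shows "(\<lambda>\<omega>. ennreal (of_bool (good m \<omega>) * (Z \<omega> * w m \<omega> * (norm (L (y \<omega> m)))\<^sup>2))) \<in> borel_measurable M"
    and "(\<integral>\<^sup>+\<omega>. ennreal (of_bool (good m \<omega>) * (Z \<omega> * w m \<omega> * (norm (L (y \<omega> m)))\<^sup>2)) \<partial>M)
     \<le> ennreal ((\<integral>\<omega>. Z \<omega> \<partial>M) * ((norm (L x0))\<^sup>2 + \<epsilon>))"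
proof -
  interpret prob_space M by fact
  have t0: "0 \<le> \<tau> i" for i using incseqD[OF \<tau>(1), of 0 i] \<tau>(2) by simp
  have sub: "subalgebra M (G t)" if "0 \<le> t" for t
    using N(2) that by (auto simp: martingale_def)
  have mono_G: "f \<in> borel_measurable (G (\<tau> i))" if "f \<in> borel_measurable (G (\<tau> l))" "l \<le> i" for f :: "'w \<Rightarrow> 'c::topological_space" and l i
    using N(2) that t0[of l] incseqD[OF \<tau>(1) that(2)] by (auto simp: martingale_def intro: measurable_from_subalg)
  have Nm: "N (\<tau> i) \<in> borel_measurable (G (\<tau> i))" for i
    using N(1) t0 by (auto simp: square_integrable_martingale_def martingale_def)
  define \<Delta> where "\<Delta> i \<omega> = E (\<tau> (Suc i)) \<omega> - E (\<tau> i) \<omega>" for i \<omega>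
  define dn where "dn i \<omega> = N (\<tau> (Suc i)) \<omega> - N (\<tau> i) \<omega>" for i \<omega>
  have cL[measurable]: "L \<in> borel_measurable borel" and ca[measurable]: "a \<in> borel_measurable borel"
    using L a by (auto intro!: borel_measurable_continuous_onI linear_continuous_on linear_conv_bounded_linear[THEN iffD1])
  have [measurable]: "\<Gamma> \<in> borel_measurable borel" by (rule borel_measurable_mono[OF \<Gamma>(1)])
  have Em: "(\<lambda>\<omega>. E (\<tau> l) \<omega>) \<in> borel_measurable (G (\<tau> i))" for l i
    using E(1)[OF t0 t0] by simp
  have ys: "y \<omega> (Suc i) = y \<omega> i + \<Delta> i \<omega> *\<^sub>R a (y \<omega> i) + dn i \<omega> *\<^sub>R \<xi> i \<omega>" for i \<omega>
    by (simp add: y_def \<Delta>_def dn_def)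
  have ym0: "(\<lambda>\<omega>. y \<omega> i) \<in> borel_measurable (G (\<tau> i))" for i
  proof (induction i)
    case 0
    then show ?case by (simp add: y_def)
  next
    case (Suc i)
    have [measurable]: "(\<lambda>\<omega>. y \<omega> i) \<in> borel_measurable (G (\<tau> (Suc i)))" "N (\<tau> i) \<in> borel_measurable (G (\<tau> (Suc i)))"
      "\<xi> i \<in> borel_measurable (G (\<tau> (Suc i)))"
      using Suc Nm[of i] \<xi>(1)[of i] by (auto intro: mono_G[of _ i])
    note [measurable] = Em Nm[of "Suc i"]
    show ?case unfolding ys \<Delta>_def dn_def by measurable
  qed
  have ym: "(\<lambda>\<omega>. y \<omega> l) \<in> borel_measurable (G (\<tau> i))" if "l \<le> i" for l i
    using mono_G[OF ym0 that] .
  have wm: "(\<lambda>\<omega>. w l \<omega>) \<in> borel_measurable (G (\<tau> i))" for l i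
    unfolding w_def using Em[of l i] by measurable
  have Dm: "(\<lambda>\<omega>. D l \<omega>) \<in> borel_measurable (G (\<tau> i))" if "l \<le> i" for l i
  proof -
    note [measurable] = Em ym[OF that] mono_G[OF \<xi>(1) that]
    show ?thesis unfolding D_def by measurable
  qed
  have goodm: "Measurable.pred (G (\<tau> i)) (good i)" for i
  proof -
    have 1: "Measurable.pred (G (\<tau> i)) (\<lambda>\<omega>. \<forall>l\<in>{..Suc i}. 0 \<le> E (\<tau> l) \<omega> \<and> E (\<tau> l) \<omega> \<le> R)"
    proof (intro pred_intros_finite)
      fix l
      have [measurable]: "E (\<tau> l) \<in> borel_measurable (G (\<tau> i))" using Em .
      show "Measurable.pred (G (\<tau> i)) (\<lambda>\<omega>. 0 \<le> E (\<tau> l) \<omega> \<and> E (\<tau> l) \<omega> \<le> R)" by measurable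
    qed simp
    have 2: "Measurable.pred (G (\<tau> i)) (\<lambda>\<omega>. \<forall>l\<in>{..i}. norm (y \<omega> l) \<le> R)"
    proof (intro pred_intros_finite)
      fix l assume "l \<in> {..i}"
      then have [measurable]: "(\<lambda>\<omega>. y \<omega> l) \<in> borel_measurable (G (\<tau> i))" using ym by simp
      show "Measurable.pred (G (\<tau> i)) (\<lambda>\<omega>. norm (y \<omega> l) \<le> R)" by measurable
    qed simp
    have "(\<lambda>\<omega>. \<Sum>l\<le>i. w (Suc l) \<omega> * max 0 (D l \<omega>)) \<in> borel_measurable (G (\<tau> i))"
      using Dm wm by (intro borel_measurable_sum borel_measurable_times borel_measurable_max) auto
    then have 3: "Measurable.pred (G (\<tau> i)) (\<lambda>\<omega>. (\<Sum>l\<le>i. w (Suc l) \<omega> * max 0 (D l \<omega>)) \<le> \<epsilon>)"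
      by measurable
    show ?thesis unfolding good_def using 1 2 3 by (intro pred_intros_logic)
  qed
  define \<kappa> where "\<kappa> i \<omega> = (of_bool (good i \<omega>) :: real)" for i \<omega>
  have \<kappa>m: "\<kappa> i \<in> borel_measurable (G (\<tau> i))" for i
    unfolding \<kappa>_def of_bool_def using goodm[of i] by measurable
  have \<kappa>01: "0 \<le> \<kappa> i \<omega>" "\<kappa> i \<omega> \<le> 1" for i \<omega> by (auto simp: \<kappa>_def)
  have w0: "w i \<omega> > 0" for i \<omega> by (simp add: w_def)
  have anti: "\<kappa> (Suc i) \<omega> \<le> \<kappa> i \<omega>" for i \<omega>
  proof -
    have "good i \<omega>" if g: "good (Suc i) \<omega>"
    proof -
      have "(\<Sum>l\<le>i. w (Suc l) \<omega> * max 0 (D l \<omega>)) \<le> (\<Sum>l\<le>Suc i. w (Suc l) \<omega> * max 0 (D l \<omega>))"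
        using w0[of "Suc (Suc i)" \<omega>] by simp
      then show ?thesis using g by (auto simp: good_def)
    qed
    then show ?thesis by (auto simp: \<kappa>_def)
  qed
  have Zm: "Z \<in> borel_measurable (G (\<tau> i))" for i using mono_G[of Z 0 i] Z(1) \<tau>(2) by simp
  obtain KL where KL: "\<And>v. norm (L v) \<le> norm v * KL" "KL > 0"
    using linear_conv_bounded_linear[of L] L bounded_linear.pos_bounded by metis
  obtain Ka where Ka: "\<And>v. norm (a v) \<le> norm v * Ka" "Ka > 0"
    using linear_conv_bounded_linear[of a] a bounded_linear.pos_bounded by metis
  \<comment> \<open>The coefficients of the quadratic and of the linear martingale increment in one step.\<close>
  define b where "b i \<omega> = \<kappa> i \<omega> * Z \<omega> * w (Suc i) \<omega> * (norm (L (\<xi> i \<omega>)))\<^sup>2" for i \<omega>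
  define c where "c i \<omega> = \<kappa> i \<omega> * Z \<omega> * w (Suc i) \<omega> * (2 * inner (L (y \<omega> i + \<Delta> i \<omega> *\<^sub>R a (y \<omega> i))) (L (\<xi> i \<omega>)))" for i \<omega>
  have bm: "b i \<in> borel_measurable (G (\<tau> i))" for i
  proof -
    note [measurable] = \<kappa>m Zm wm \<xi>(1)
    show ?thesis unfolding b_def by measurable
  qed
  have cm: "c i \<in> borel_measurable (G (\<tau> i))" for i
  proof -
    note [measurable] = \<kappa>m Zm wm \<xi>(1) ym0 Em
    show ?thesis unfolding c_def \<Delta>_def by measurable
  qed
  \<comment> \<open>Before stopping all coefficients are bounded by constants depending on \<open>R\<close>.\<close>
  have wbd: "\<kappa> i \<omega> * Z \<omega> * w (Suc i) \<omega> \<le> exp (2 * \<mu> * R)" and R0: "\<kappa> i \<omega> \<noteq> 0 \<Longrightarrow> R \<ge> 0"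
    and ybd: "\<kappa> i \<omega> \<noteq> 0 \<Longrightarrow> norm (y \<omega> i) \<le> R" "\<kappa> i \<omega> \<noteq> 0 \<Longrightarrow> \<bar>\<Delta> i \<omega>\<bar> \<le> R" for i \<omega>
  proof -
    show "\<kappa> i \<omega> \<noteq> 0 \<Longrightarrow> R \<ge> 0" by (auto simp: \<kappa>_def good_def intro: order_trans)
    show "\<kappa> i \<omega> \<noteq> 0 \<Longrightarrow> norm (y \<omega> i) \<le> R" by (auto simp: \<kappa>_def good_def)
    show "\<bar>\<Delta> i \<omega>\<bar> \<le> R" if "\<kappa> i \<omega> \<noteq> 0"
    proof -
      have "\<forall>l\<in>{..Suc i}. 0 \<le> E (\<tau> l) \<omega> \<and> E (\<tau> l) \<omega> \<le> R"
        using that by (auto simp: \<kappa>_def good_def)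
      then have "0 \<le> E (\<tau> i) \<omega>" "E (\<tau> i) \<omega> \<le> R" "0 \<le> E (\<tau> (Suc i)) \<omega>" "E (\<tau> (Suc i)) \<omega> \<le> R"
        by auto
      then show ?thesis by (simp add: \<Delta>_def abs_le_iff)
    qed
    show "\<kappa> i \<omega> * Z \<omega> * w (Suc i) \<omega> \<le> exp (2 * \<mu> * R)"
    proof (cases "\<kappa> i \<omega> = 0")
      case False
      then have E: "0 \<le> E (\<tau> (Suc i)) \<omega>" "E (\<tau> (Suc i)) \<omega> \<le> R" by (auto simp: \<kappa>_def good_def)
      have "\<Gamma> (E (\<tau> (Suc i)) \<omega>) \<ge> 0" using monoD[OF \<Gamma>(1) E(1)] \<Gamma>(2) by simp
      then have "2 * \<mu> * E (\<tau> (Suc i)) \<omega> - C * \<Gamma> (E (\<tau> (Suc i)) \<omega>) \<le> 2 * \<mu> * R"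
        using E(2) dis(2) \<Gamma>(3) by (intro order_trans[OF _ mult_left_mono[OF E(2)]]) auto
      then have "w (Suc i) \<omega> \<le> exp (2 * \<mu> * R)" by (simp add: w_def)
      moreover have "\<kappa> i \<omega> * Z \<omega> * w (Suc i) \<omega> \<le> w (Suc i) \<omega>"
        using \<kappa>01 Z w0[of "Suc i" \<omega>] by (intro mult_left_le_one_le mult_nonneg_nonneg mult_le_one) auto
      ultimately show ?thesis by simp
    qed simp
  qed
  have nn: "0 \<le> \<kappa> i \<omega> * Z \<omega> * w (Suc i) \<omega>" for i \<omega>
    using \<kappa>01 Z w0[of "Suc i" \<omega>] by simp
  have bounds: "\<exists>B. \<forall>\<omega>\<in>space M. \<bar>b i \<omega>\<bar> \<le> B \<and> \<bar>c i \<omega>\<bar> \<le> B" for i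
  proof -
    obtain B where B: "\<And>\<omega>. \<omega> \<in> space M \<Longrightarrow> norm (\<xi> i \<omega>) \<le> B" using \<xi>(2) by blast
    define B1 where "B1 = exp (2 * \<mu> * R) * (B * KL)\<^sup>2"
    define B2 where "B2 = exp (2 * \<mu> * R) * (2 * (((R + R * (R * Ka)) * KL) * (B * KL)))"
    have "\<bar>b i \<omega>\<bar> \<le> B1 \<and> \<bar>c i \<omega>\<bar> \<le> max B2 0" if \<omega>: "\<omega> \<in> space M" for \<omega>
    proof
      have L\<xi>: "norm (L (\<xi> i \<omega>)) \<le> B * KL"
        using KL B[OF \<omega>] by (intro order_trans[OF KL(1)] mult_right_mono) auto
      then have "(norm (L (\<xi> i \<omega>)))\<^sup>2 \<le> (B * KL)\<^sup>2" by (intro power_mono) auto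
      then show "\<bar>b i \<omega>\<bar> \<le> B1"
        unfolding b_def B1_def using wbd nn by (subst abs_of_nonneg) (auto intro!: mult_mono)
      show "\<bar>c i \<omega>\<bar> \<le> max B2 0"
      proof (cases "\<kappa> i \<omega> = 0")
        case False
        note k = ybd[OF False]
        have "norm (y \<omega> i + \<Delta> i \<omega> *\<^sub>R a (y \<omega> i)) \<le> norm (y \<omega> i) + \<bar>\<Delta> i \<omega>\<bar> * norm (a (y \<omega> i))"
          using norm_triangle_ineq[of "y \<omega> i" "\<Delta> i \<omega> *\<^sub>R a (y \<omega> i)"] by simp
        also have "\<dots> \<le> R + R * (R * Ka)"
          using k Ka R0[OF False] by (intro add_mono mult_mono order_trans[OF Ka(1)]) auto
        finally have "norm (L (y \<omega> i + \<Delta> i \<omega> *\<^sub>R a (y \<omega> i))) \<le> (R + R * (R * Ka)) * KL"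
          using KL by (intro order_trans[OF KL(1)] mult_right_mono) auto
        then have "\<bar>inner (L (y \<omega> i + \<Delta> i \<omega> *\<^sub>R a (y \<omega> i))) (L (\<xi> i \<omega>))\<bar> \<le> ((R + R * (R * Ka)) * KL) * (B * KL)"
          using L\<xi> by (intro order_trans[OF Cauchy_Schwarz_ineq2] mult_mono) (auto intro: order_trans[OF norm_ge_zero])
        then have "(\<kappa> i \<omega> * Z \<omega> * w (Suc i) \<omega>) * (2 * \<bar>inner (L (y \<omega> i + \<Delta> i \<omega> *\<^sub>R a (y \<omega> i))) (L (\<xi> i \<omega>))\<bar>) \<le> B2"
          unfolding B2_def using wbd nn by (intro mult_mono) auto
        then show ?thesis unfolding c_def abs_mult[of "\<kappa> i \<omega> * Z \<omega> * w (Suc i) \<omega>"] abs_of_nonneg[OF nn] by (simp add: abs_mult)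
      qed (simp add: c_def)
    qed
    then show ?thesis by (intro exI[of _ "max B1 (max B2 0)"]) (auto intro: max.coboundedI1 max.coboundedI2)
  qed
  have tS: "\<tau> i \<le> \<tau> (Suc i)" for i using \<tau>(1) by (simp add: incseq_SucD)
  have int: "integrable M (\<lambda>\<omega>. c i \<omega> * dn i \<omega>)" "(\<integral>\<omega>. c i \<omega> * dn i \<omega> \<partial>M) = 0"
    "integrable M (\<lambda>\<omega>. b i \<omega> * ((dn i \<omega>)\<^sup>2 - \<Delta> i \<omega>))" "(\<integral>\<omega>. b i \<omega> * ((dn i \<omega>)\<^sup>2 - \<Delta> i \<omega>) \<partial>M) = 0" for i
  proof -
    obtain B where B: "\<And>\<omega>. \<omega> \<in> space M \<Longrightarrow> \<bar>b i \<omega>\<bar> \<le> B" "\<And>\<omega>. \<omega> \<in> space M \<Longrightarrow> \<bar>c i \<omega>\<bar> \<le> B"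
      using bounds by blast
    note s = square_integrable_martingale_increments[OF M N t0 tS]
    show "integrable M (\<lambda>\<omega>. c i \<omega> * dn i \<omega>)" "(\<integral>\<omega>. c i \<omega> * dn i \<omega> \<partial>M) = 0"
      unfolding dn_def using s(1,2)[OF cm B(2)] by blast+
    show "integrable M (\<lambda>\<omega>. b i \<omega> * ((dn i \<omega>)\<^sup>2 - \<Delta> i \<omega>))" "(\<integral>\<omega>. b i \<omega> * ((dn i \<omega>)\<^sup>2 - \<Delta> i \<omega>) \<partial>M) = 0"
      unfolding dn_def \<Delta>_def using s(3,4)[OF bm B(1)] by blast+
  qed
  define V where "V = (norm (L x0))\<^sup>2"
  define Rhs where "Rhs \<omega> = Z \<omega> * (V + \<epsilon>) + (\<Sum>i<m. c i \<omega> * dn i \<omega> + b i \<omega> * ((dn i \<omega>)\<^sup>2 - \<Delta> i \<omega>))" for \<omega>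
  have Zi: "integrable M Z"
    using Z measurable_from_subalg[OF sub[of 0] Z(1)] by (intro integrable_const_bound[where B = 1]) auto
  have Rint: "integrable M Rhs" unfolding Rhs_def using Zi int by simp
  have RI: "(\<integral>\<omega>. Rhs \<omega> \<partial>M) = (\<integral>\<omega>. Z \<omega> \<partial>M) * (V + \<epsilon>)"
    unfolding Rhs_def using Zi int by simp
  have le: "AE \<omega> in M. \<kappa> m \<omega> * (Z \<omega> * w m \<omega> * (norm (L (y \<omega> m)))\<^sup>2) \<le> Rhs \<omega>"
    using E(2)
  proof eventually_elim
    fix \<omega> assume \<omega>: "E 0 \<omega> = 0 \<and> mono_on {0..} (\<lambda>t. E t \<omega>)"
    have \<Delta>0: "\<Delta> i \<omega> \<ge> 0" for i
      using \<omega> t0[of i] t0[of "Suc i"] tS[of i] by (auto simp: \<Delta>_def mono_on_def)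
    define \<Phi> where "\<Phi> i = Z \<omega> * w i \<omega> * (norm (L (y \<omega> i)))\<^sup>2" for i
    have step: "\<kappa> i \<omega> * (\<Phi> (Suc i) - \<Phi> i) \<le>
        Z \<omega> * (\<kappa> i \<omega> * (w (Suc i) \<omega> * max 0 (D i \<omega>))) + (c i \<omega> * dn i \<omega> + b i \<omega> * ((dn i \<omega>)\<^sup>2 - \<Delta> i \<omega>))" for i
    proof -
      have "w (Suc i) \<omega> * (norm (L (y \<omega> i + \<Delta> i \<omega> *\<^sub>R a (y \<omega> i) + dn i \<omega> *\<^sub>R \<xi> i \<omega>)))\<^sup>2 - w i \<omega> * (norm (L (y \<omega> i)))\<^sup>2 \<le>
        w (Suc i) \<omega> * D i \<omega> + w (Suc i) \<omega> * (2 * inner (L (y \<omega> i + \<Delta> i \<omega> *\<^sub>R a (y \<omega> i))) (L (\<xi> i \<omega>))) * dn i \<omega> +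
        w (Suc i) \<omega> * (norm (L (\<xi> i \<omega>)))\<^sup>2 * ((dn i \<omega>)\<^sup>2 - \<Delta> i \<omega>)"
        unfolding D_def \<Delta>_def[symmetric]
      proof (rule energy_step[OF L dis(1) \<Delta>0])
        show "w i \<omega> = w (Suc i) \<omega> * exp (- (2 * \<mu> * \<Delta> i \<omega> - C * (\<Gamma> (E (\<tau> (Suc i)) \<omega>) - \<Gamma> (E (\<tau> i) \<omega>))))"
          unfolding w_def \<Delta>_def by (simp add: algebra_simps flip: exp_add)
      qed (use w0[of "Suc i" \<omega>] in simp)
      also have "\<dots> \<le> w (Suc i) \<omega> * max 0 (D i \<omega>) + w (Suc i) \<omega> * (2 * inner (L (y \<omega> i + \<Delta> i \<omega> *\<^sub>R a (y \<omega> i))) (L (\<xi> i \<omega>))) * dn i \<omega> +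
        w (Suc i) \<omega> * (norm (L (\<xi> i \<omega>)))\<^sup>2 * ((dn i \<omega>)\<^sup>2 - \<Delta> i \<omega>)"
        using w0[of "Suc i" \<omega>] by (intro add_right_mono mult_left_mono) auto
      finally have "(\<kappa> i \<omega> * Z \<omega>) * (w (Suc i) \<omega> * (norm (L (y \<omega> (Suc i))))\<^sup>2 - w i \<omega> * (norm (L (y \<omega> i)))\<^sup>2) \<le>
        (\<kappa> i \<omega> * Z \<omega>) * (w (Suc i) \<omega> * max 0 (D i \<omega>) + w (Suc i) \<omega> * (2 * inner (L (y \<omega> i + \<Delta> i \<omega> *\<^sub>R a (y \<omega> i))) (L (\<xi> i \<omega>))) * dn i \<omega> +
        w (Suc i) \<omega> * (norm (L (\<xi> i \<omega>)))\<^sup>2 * ((dn i \<omega>)\<^sup>2 - \<Delta> i \<omega>))"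
        unfolding ys using \<kappa>01 Z by (intro mult_left_mono) auto
      then show ?thesis unfolding \<Phi>_def c_def b_def by (simp add: algebra_simps)
    qed
    have "\<kappa> m \<omega> * \<Phi> m \<le> \<Phi> 0 + (\<Sum>i<m. \<kappa> i \<omega> * (\<Phi> (Suc i) - \<Phi> i))"
    proof (rule stopped_telescope)
      show "\<Phi> i \<ge> 0" for i using Z(2) less_imp_le[OF w0] by (simp add: \<Phi>_def)
    qed (use \<kappa>01 anti in auto)
    also have "\<dots> \<le> \<Phi> 0 + (\<Sum>i<m. Z \<omega> * (\<kappa> i \<omega> * (w (Suc i) \<omega> * max 0 (D i \<omega>))) + (c i \<omega> * dn i \<omega> + b i \<omega> * ((dn i \<omega>)\<^sup>2 - \<Delta> i \<omega>)))"
      by (intro add_left_mono sum_mono step)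
    also have "\<dots> = \<Phi> 0 + Z \<omega> * (\<Sum>i<m. \<kappa> i \<omega> * (w (Suc i) \<omega> * max 0 (D i \<omega>))) + (\<Sum>i<m. c i \<omega> * dn i \<omega> + b i \<omega> * ((dn i \<omega>)\<^sup>2 - \<Delta> i \<omega>))"
      by (simp only: sum.distrib sum_distrib_left add.assoc)
    also have "\<dots> \<le> \<Phi> 0 + Z \<omega> * \<epsilon> + (\<Sum>i<m. c i \<omega> * dn i \<omega> + b i \<omega> * ((dn i \<omega>)\<^sup>2 - \<Delta> i \<omega>))"
    proof (intro add_right_mono add_left_mono mult_left_mono)
      show "(\<Sum>i<m. \<kappa> i \<omega> * (w (Suc i) \<omega> * max 0 (D i \<omega>))) \<le> \<epsilon>"
      proof (rule stopped_sum_le[OF _ \<epsilon>])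
        show "0 \<le> w (Suc i) \<omega> * max 0 (D i \<omega>)" for i using w0[of "Suc i" \<omega>] by simp
        show "(\<Sum>l\<le>i. w (Suc l) \<omega> * max 0 (D l \<omega>)) \<le> \<epsilon>" if "\<kappa> i \<omega> \<noteq> 0" for i
          using that by (simp add: \<kappa>_def good_def)
      qed (use \<kappa>01 in auto)
    qed (use Z in auto)
    also have "\<Phi> 0 = Z \<omega> * V" using \<omega> \<tau>(2) \<Gamma>(2) by (simp add: \<Phi>_def w_def y_def V_def)
    finally show "\<kappa> m \<omega> * (Z \<omega> * w m \<omega> * (norm (L (y \<omega> m)))\<^sup>2) \<le> Rhs \<omega>"
      by (simp add: \<Phi>_def Rhs_def algebra_simps)
  qed
  have "(\<integral>\<^sup>+\<omega>. ennreal (\<kappa> m \<omega> * (Z \<omega> * w m \<omega> * (norm (L (y \<omega> m)))\<^sup>2)) \<partial>M) \<le> (\<integral>\<^sup>+\<omega>. ennreal (Rhs \<omega>) \<partial>M)"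
    by (intro nn_integral_mono_AE, use le in eventually_elim) (rule ennreal_leI)
  also have "\<dots> = ennreal (\<integral>\<omega>. Rhs \<omega> \<partial>M)"
  proof (rule nn_integral_eq_integral[OF Rint])
    show "AE \<omega> in M. 0 \<le> Rhs \<omega>"
      using le
    proof eventually_elim
      fix \<omega> assume "\<kappa> m \<omega> * (Z \<omega> * w m \<omega> * (norm (L (y \<omega> m)))\<^sup>2) \<le> Rhs \<omega>"
      moreover have "0 \<le> \<kappa> m \<omega> * (Z \<omega> * w m \<omega> * (norm (L (y \<omega> m)))\<^sup>2)"
        using \<kappa>01 Z(2) less_imp_le[OF w0] by simp
      ultimately show "0 \<le> Rhs \<omega>" by linarith
    qed
  qed
  finally show "(\<integral>\<^sup>+\<omega>. ennreal (of_bool (good m \<omega>) * (Z \<omega> * w m \<omega> * (norm (L (y \<omega> m)))\<^sup>2)) \<partial>M)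
     \<le> ennreal ((\<integral>\<omega>. Z \<omega> \<partial>M) * ((norm (L x0))\<^sup>2 + \<epsilon>))"
    unfolding RI \<kappa>_def V_def .
  have "(\<lambda>\<omega>. \<kappa> m \<omega> * (Z \<omega> * w m \<omega> * (norm (L (y \<omega> m)))\<^sup>2)) \<in> borel_measurable (G (\<tau> m))"
  proof -
    note [measurable] = \<kappa>m Zm wm ym0
    show ?thesis by measurable
  qed
  then show "(\<lambda>\<omega>. ennreal (of_bool (good m \<omega>) * (Z \<omega> * w m \<omega> * (norm (L (y \<omega> m)))\<^sup>2))) \<in> borel_measurable M"
    using measurable_from_subalg[OF sub[OF t0]] unfolding \<kappa>_def by (intro measurable_compose[OF _ measurable_ennreal]) blast
qed

section \<open>Clock, filtration and simple processes\<close>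

text \<open>
  The joint filtration contains the clock at all times from the start. So it also contains
  \<open>{E t \<le> u}\<close>, and intersecting an event of the clock with this set does not leave the filtration
  at \<open>u\<close>.
\<close>

lemma clock_measurable_time_changed_filtration:
  assumes "0 \<le> s" and t: "0 \<le> t"
  shows "E s \<in> borel_measurable (time_changed_filtration M B E t)"
proof -
  define gen where "gen u = {B s -` S \<inter> space M | s S. 0 \<le> s \<and> s \<le> u \<and> S \<in> sets borel} \<union>
         {E s -` S \<inter> space M | s S. 0 \<le> s \<and> S \<in> sets borel}" for u
  define A where "A t = (\<Inter>u\<in>{t<..}. sigma_sets (space M) (gen u))" for t
  have gen: "gen u \<subseteq> Pow (space M)" for u by (auto simp: gen_def)
  have A: "A t \<subseteq> Pow (space M)" for t
  proof -
    have "A t \<subseteq> sigma_sets (space M) (gen (t + 1))" by (force simp: A_def)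
    also have "\<dots> \<subseteq> Pow (space M)" using sigma_sets_into_sp[OF gen] by blast
    finally show ?thesis .
  qed
  have jf: "joint_filtration M B E t = sigma (space M) (A t)" for t
    by (simp add: joint_filtration_def A_def gen_def)
  have sp: "space (joint_filtration M B E t) = space M" for t by (simp add: jf space_measure_of[OF A])
  have se: "sets (joint_filtration M B E t) = sigma_sets (space M) (A t)" for t
    by (simp add: jf sets_measure_of[OF A])
  interpret filtration "space M" "joint_filtration M B E"
  proof
    show "space (joint_filtration M B E i) = space M" for i by (rule sp)
    show "sets (joint_filtration M B E i) \<subseteq> sets (joint_filtration M B E j)" if "i \<le> j" for i j
      unfolding se using that by (intro sigma_sets_mono') (auto simp: A_def)
  qed
  have Em: "E s \<in> borel_measurable (joint_filtration M B E t)" if "0 \<le> s" for s t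
  proof (rule measurableI)
    fix S :: "real set" assume "S \<in> sets borel"
    then have "E s -` S \<inter> space M \<in> gen u" for u using that by (auto simp: gen_def)
    then have "E s -` S \<inter> space M \<in> A t" by (auto simp: A_def)
    then show "E s -` S \<inter> space (joint_filtration M B E t) \<in> sets (joint_filtration M B E t)"
      by (simp add: se sp)
  qed simp
    have st: "stopping_time (joint_filtration M B E) (E t)"
      unfolding stopping_time_def
    proof
      fix u
      have [measurable]: "E t \<in> borel_measurable (joint_filtration M B E u)" by (rule Em[OF t])
      show "Measurable.pred (joint_filtration M B E u) (\<lambda>\<omega>. E t \<omega> \<le> u)" by measurable
    qed
    show ?thesis unfolding time_changed_filtration_def
    proof (rule measurableI)
      fix S :: "real set" assume S: "S \<in> sets borel"
      show "E s -` S \<inter> space (pre_sigma (E t)) \<in> sets (pre_sigma (E t))"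
      proof (rule sets_pre_sigmaI[OF st])
        fix u
        have "{\<omega> \<in> E s -` S \<inter> space (pre_sigma (E t)). E t \<omega> \<le> u} =
            (E s -` S \<inter> space (joint_filtration M B E u)) \<inter> (E t -` {..u} \<inter> space (joint_filtration M B E u))"
          by (auto simp: space_pre_sigma sp)
        also have "\<dots> \<in> sets (joint_filtration M B E u)"
          using Em[OF assms(1), of u] Em[OF t, of u] S by (intro sets.Int measurable_sets) auto
        finally show "{\<omega> \<in> E s -` S \<inter> space (pre_sigma (E t)). E t \<omega> \<le> u} \<in> sets (joint_filtration M B E u)" .
      qed
    qed simp
qed

lemma simple_value_measurable_time: "(\<lambda>t. simple_value S t \<omega>) \<in> borel_measurable borel"
proof (induction S)
  case Nil
  then show ?case by (simp add: simple_value_def)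
next
  case (Cons p S)
  obtain a b x where p: "p = (a, b, x)" by (cases p)
  have "(\<lambda>t. indicator {a<..b} t *\<^sub>R x \<omega> + simple_value S t \<omega>) \<in> borel_measurable borel"
    using Cons by measurable
  then show ?case by (simp add: simple_value_def p)
qed

text \<open>
  Between neighbouring points of a grid that contains its endpoints, a simple predictable process
  is a single random variable, known at the left point, and its integral has the increment of a
  discrete martingale transform. Its value is read off at the right point \<open>t\<close>, since the intervals
  are closed on the right.
\<close>

lemma simple_process_on_grid:
  fixes S :: "('w, 'v::euclidean_space) simple_process"
  assumes S: "simple_predictable G S"
    and sub: "\<And>s t. 0 \<le> s \<Longrightarrow> s \<le> t \<Longrightarrow> subalgebra (G t) (G s)"
    and "0 \<le> s" "s \<le> t"
    and grid: "\<And>a b x. (a, b, x) \<in> set S \<Longrightarrow> \<not> (s < a \<and> a < t) \<and> \<not> (s < b \<and> b < t)"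
  shows "\<And>r \<omega>. r \<in> {s<..t} \<Longrightarrow> simple_value S r \<omega> = simple_value S t \<omega>"
    and "\<And>\<omega>. simple_integral N S t \<omega> - simple_integral N S s \<omega> = (N t \<omega> - N s \<omega>) *\<^sub>R simple_value S t \<omega>"
    and "simple_value S t \<in> borel_measurable (G s)"
    and "\<exists>B. \<forall>\<omega>\<in>space (G s). norm (simple_value S t \<omega>) \<le> B"
proof -
  have *: "(\<forall>r\<in>{s<..t}. \<forall>\<omega>. simple_value S r \<omega> = simple_value S t \<omega>) \<and>
     (\<forall>\<omega>. simple_integral N S t \<omega> - simple_integral N S s \<omega> = (N t \<omega> - N s \<omega>) *\<^sub>R simple_value S t \<omega>) \<and>
     simple_value S t \<in> borel_measurable (G s) \<and> (\<exists>B. \<forall>\<omega>\<in>space (G s). norm (simple_value S t \<omega>) \<le> B)"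
    using S grid
  proof (induction S)
    case Nil
    then show ?case by (auto simp: simple_value_def[abs_def] simple_integral_def)
  next
    case (Cons p S)
    obtain a b x where p: "p = (a, b, x)" by (cases p)
    have "simple_predictable G S" using Cons.prems(1) by (simp add: simple_predictable_def)
    moreover have "\<And>a b x. (a, b, x) \<in> set S \<Longrightarrow> \<not> (s < a \<and> a < t) \<and> \<not> (s < b \<and> b < t)"
      using Cons.prems(2) by (meson list.set_intros(2))
    ultimately have IH': "(\<forall>r\<in>{s<..t}. \<forall>\<omega>. simple_value S r \<omega> = simple_value S t \<omega>) \<and>
     (\<forall>\<omega>. simple_integral N S t \<omega> - simple_integral N S s \<omega> = (N t \<omega> - N s \<omega>) *\<^sub>R simple_value S t \<omega>) \<and>
     simple_value S t \<in> borel_measurable (G s) \<and> (\<exists>B. \<forall>\<omega>\<in>space (G s). norm (simple_value S t \<omega>) \<le> B)"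
      by (rule Cons.IH)
    have IH: "\<And>r \<omega>. r \<in> {s<..t} \<Longrightarrow> simple_value S r \<omega> = simple_value S t \<omega>"
       "\<And>\<omega>. simple_integral N S t \<omega> - simple_integral N S s \<omega> = (N t \<omega> - N s \<omega>) *\<^sub>R simple_value S t \<omega>"
       "simple_value S t \<in> borel_measurable (G s)" "\<exists>B. \<forall>\<omega>\<in>space (G s). norm (simple_value S t \<omega>) \<le> B"
      using IH' by blast+
    have ab: "0 \<le> a" "a \<le> b" "x \<in> borel_measurable (G a)" "bounded (x ` space (G a))"
      using Cons.prems(1) by (auto simp: p simple_predictable_def)
    have g: "\<not> (s < a \<and> a < t)" "\<not> (s < b \<and> b < t)" using Cons.prems(2)[of a b x] by (auto simp: p)
    have v: "simple_value (p # S) r \<omega> = indicator {a<..b} r *\<^sub>R x \<omega> + simple_value S r \<omega>" for r \<omega>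
      by (simp add: simple_value_def p)
    have i: "simple_integral N (p # S) r \<omega> = (N (min r b) \<omega> - N (min r a) \<omega>) *\<^sub>R x \<omega> + simple_integral N S r \<omega>" for r \<omega>
      by (simp add: simple_integral_def p)
    have ind: "indicator {a<..b} r = (indicator {a<..b} t :: real)" if "r \<in> {s<..t}" for r
      using that g by (auto split: split_indicator)
    have inc: "(N (min t b) \<omega> - N (min t a) \<omega>) - (N (min s b) \<omega> - N (min s a) \<omega>) =
        (N t \<omega> - N s \<omega>) * indicator {a<..b} t" for \<omega>
      using g ab(2) \<open>s \<le> t\<close> by (cases "s = t") (auto simp: min_def split: split_indicator)
    have xs: "x \<in> borel_measurable (G s) \<and> space (G s) = space (G a)" if "a < t \<and> t \<le> b"
    proof -
      have "a \<le> s" using that g \<open>s \<le> t\<close> by (cases "s = t") auto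
      then show ?thesis using sub[OF ab(1) \<open>a \<le> s\<close>] ab(3)
        by (auto simp: subalgebra_def intro: measurable_from_subalg[OF sub[OF ab(1) \<open>a \<le> s\<close>]])
    qed
    have m: "simple_value (p # S) t \<in> borel_measurable (G s)"
    proof (cases "a < t \<and> t \<le> b")
      case True
      then show ?thesis unfolding v[abs_def] using IH(3) xs by (intro borel_measurable_add) auto
    next
      case False
      then have "simple_value (p # S) t = simple_value S t" by (auto simp: v[abs_def] split: split_indicator)
      then show ?thesis using IH(3) by simp
    qed
    have bd: "\<exists>B. \<forall>\<omega>\<in>space (G s). norm (simple_value (p # S) t \<omega>) \<le> B"
    proof -
      obtain B where B: "\<And>\<omega>. \<omega> \<in> space (G s) \<Longrightarrow> norm (simple_value S t \<omega>) \<le> B" using IH(4) by blast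
      show ?thesis
      proof (cases "a < t \<and> t \<le> b")
        case True
        obtain B' where B': "\<And>\<omega>. \<omega> \<in> space (G s) \<Longrightarrow> norm (x \<omega>) \<le> B'"
          using ab(4) xs[OF True] unfolding bounded_iff by auto
        have "norm (simple_value (p # S) t \<omega>) \<le> B' + B" if "\<omega> \<in> space (G s)" for \<omega>
          unfolding v using B[OF that] B'[OF that] True by (intro norm_triangle_le add_mono) auto
        then show ?thesis by blast
      next
        case False
        then have "simple_value (p # S) t = simple_value S t" by (auto simp: v[abs_def] split: split_indicator)
        then show ?thesis using IH(4) by simp
      qed
    qed
    have eq: "simple_integral N (p # S) t \<omega> - simple_integral N (p # S) s \<omega> = (N t \<omega> - N s \<omega>) *\<^sub>R simple_value (p # S) t \<omega>" for \<omega>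
    proof -
      have "simple_integral N (p # S) t \<omega> - simple_integral N (p # S) s \<omega> =
          ((N (min t b) \<omega> - N (min t a) \<omega>) - (N (min s b) \<omega> - N (min s a) \<omega>)) *\<^sub>R x \<omega> +
          (simple_integral N S t \<omega> - simple_integral N S s \<omega>)"
        by (simp add: i scaleR_diff_left)
      then show ?thesis unfolding inc IH(2) v by (simp add: scaleR_add_right)
    qed
    show ?case
    proof (intro conjI ballI allI m bd eq)
      fix r \<omega> assume r: "r \<in> {s<..t}"
      show "simple_value (p # S) r \<omega> = simple_value (p # S) t \<omega>"
        unfolding v ind[OF r] IH(1)[OF r] ..
    qed
  qed
  then show "\<And>r \<omega>. r \<in> {s<..t} \<Longrightarrow> simple_value S r \<omega> = simple_value S t \<omega>"
    "\<And>\<omega>. simple_integral N S t \<omega> - simple_integral N S s \<omega> = (N t \<omega> - N s \<omega>) *\<^sub>R simple_value S t \<omega>"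
    "simple_value S t \<in> borel_measurable (G s)" "\<exists>B. \<forall>\<omega>\<in>space (G s). norm (simple_value S t \<omega>) \<le> B"
    by blast+
qed

lemma simple_integral_0:
  assumes "simple_predictable G S"
  shows "simple_integral N S 0 \<omega> = 0"
proof -
  have "(case p of (a, b, \<xi>) \<Rightarrow> (N (min 0 b) \<omega> - N (min 0 a) \<omega>) *\<^sub>R \<xi> \<omega>) = 0" if "p \<in> set S" for p
    using assms that by (auto simp: simple_predictable_def min_def split: prod.splits)
  then show ?thesis unfolding simple_integral_def
    by (induction S) auto
qed

text \<open>
  By the Laplace transform at \<open>1\<close> the mean of \<open>inf\<^sub>n exp (- U\<^sub>n)\<close> is at most \<open>exp (- n)\<close> for every \<open>n\<close>,
  so \<open>U\<close> is unbounded almost surely. Hence the set in the definition of the inverse is nonempty for every level, and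
  its infimum is at least \<open>s\<close> as soon as the level has reached \<open>U\<^sub>s\<close>.
\<close>

lemma inverse_subordinator_tendsto_infinity:
  assumes "prob_space M" "stable_subordinator M \<beta> U"
  shows "AE \<omega> in M. filterlim (\<lambda>t. inverse_subordinator U t \<omega>) at_top at_top"
proof -
  interpret prob_space M by fact
  have ex: "expectation (\<lambda>\<omega>. exp (- 1 * U t \<omega>)) = exp (- t)" if "t \<ge> 0" for t
    using assms(2) that unfolding stable_subordinator_def by (metis mult.right_neutral powr_one_eq_one zero_le_one)
  have int: "integrable M (\<lambda>\<omega>. exp (- U t \<omega>))" if "t \<ge> 0" for t
    using ex[OF that] not_integrable_integral_eq by fastforce
  define I where "I \<omega> = (INF n::nat. ennreal (exp (- U n \<omega>)))" for \<omega>
  have "(\<integral>\<^sup>+\<omega>. I \<omega> \<partial>M) \<le> ennreal (exp (- real n))" for n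
  proof -
    have "(\<integral>\<^sup>+\<omega>. I \<omega> \<partial>M) \<le> (\<integral>\<^sup>+\<omega>. ennreal (exp (- U n \<omega>)) \<partial>M)"
      unfolding I_def by (intro nn_integral_mono INF_lower) auto
    also have "\<dots> = ennreal (exp (- real n))"
      using int[of n] ex[of n] by (subst nn_integral_eq_integral) auto
    finally show ?thesis .
  qed
  moreover have "(\<lambda>n. ennreal (exp (- real n))) \<longlonglongrightarrow> ennreal 0"
    by (intro tendsto_ennrealI filterlim_compose[OF exp_at_bot] filterlim_uminus_at_top_at_bot[THEN filterlim_compose])
       (auto simp: filterlim_uminus_at_bot filterlim_real_sequentially)
  ultimately have "(\<integral>\<^sup>+\<omega>. I \<omega> \<partial>M) \<le> ennreal 0"
    by (intro LIMSEQ_le_const) auto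
  moreover have Im: "I \<in> borel_measurable M"
    unfolding I_def using borel_measurable_integrable[OF int] by measurable
  ultimately have "AE \<omega> in M. I \<omega> = 0"
    using nn_integral_0_iff_AE[OF Im] by simp
  moreover have "AE \<omega> in M. strict_mono_on {0..} (\<lambda>t. U t \<omega>)"
    using assms(2) by (simp add: stable_subordinator_def)
  ultimately show ?thesis
  proof eventually_elim
    fix \<omega> assume I: "I \<omega> = 0" and sm: "strict_mono_on {0..} (\<lambda>t. U t \<omega>)"
    have unb: "\<exists>n::nat. U n \<omega> > c" for c
    proof -
      have "(INF n::nat. ennreal (exp (- U n \<omega>))) < ennreal (exp (- c))"
        using I by (simp add: I_def)
      then obtain n :: nat where "ennreal (exp (- U n \<omega>)) < ennreal (exp (- c))"
        unfolding INF_less_iff by blast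
      then show ?thesis by (auto simp: ennreal_less_iff)
    qed
    show "filterlim (\<lambda>t. inverse_subordinator U t \<omega>) at_top at_top"
      unfolding filterlim_at_top
    proof
      fix z :: real
      define s where "s = max 0 z"
      have "z \<le> inverse_subordinator U t \<omega>" if t: "U s \<omega> \<le> t" for t
      proof -
        obtain n :: nat where n: "U n \<omega> > t" using unb by blast
        have gt: "s \<le> r" if "0 < r" "t < U r \<omega>" for r
        proof (rule ccontr)
          assume "\<not> s \<le> r"
          then have "U r \<omega> < U s \<omega>" using sm that by (auto simp: s_def strict_mono_on_def)
          then show False using that t by simp
        qed
        have "real n \<noteq> 0"
        proof
          assume "real n = 0"
          then have "U 0 \<omega> > t" using n by simp
          moreover have "U 0 \<omega> \<le> U s \<omega>"
          proof (cases "s = 0")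
            case False
            then have "0 < s" by (simp add: s_def)
            then show ?thesis using strict_mono_onD[OF sm, of 0 s] by simp
          qed simp
          ultimately show False using t by simp
        qed
        then have "real n \<in> {s. 0 < s \<and> t < U s \<omega>}" using n by simp
        then have "{s. 0 < s \<and> t < U s \<omega>} \<noteq> {}" by blast
        then have "s \<le> Inf {s. 0 < s \<and> t < U s \<omega>}"
          by (rule cInf_greatest) (auto intro: gt)
        then show ?thesis by (simp add: inverse_subordinator_def s_def)
      qed
      then show "\<forall>\<^sub>F t in at_top. z \<le> inverse_subordinator U t \<omega>"
        unfolding eventually_at_top_linorder by blast
    qed
  qed
qed

section \<open>Energy bound and stability\<close>

text \<open>
  The supermartingale inequality for the weighted Lyapunov function, up to \<open>\<epsilon>\<close>, obtained from the
  Euler schemes by Fatou's lemma, which makes the square integrability of \<open>X\<close> part of the conclusion.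
\<close>

lemma weighted_energy_bound:
  fixes L :: "'v::euclidean_space \<Rightarrow> 'b::euclidean_space" and a :: "'v \<Rightarrow> 'v" and x0 :: 'v
    and N E :: "real \<Rightarrow> 'w \<Rightarrow> real" and H X J :: "real \<Rightarrow> 'w \<Rightarrow> 'v" and q :: "real \<Rightarrow> real"
    and K c \<mu> \<epsilon> T :: real
  defines "\<Gamma> \<equiv> \<lambda>u. LINT v:{0..u}|lebesgue. q v"
    and "C \<equiv> 2 * K\<^sup>2 / c\<^sup>2"
  assumes M: "prob_space M"
    and N: "square_integrable_martingale M G N" "martingale M G (\<lambda>t \<omega>. (N t \<omega>)\<^sup>2 - E t \<omega>)"
    and Em: "\<And>s t. 0 \<le> s \<Longrightarrow> 0 \<le> t \<Longrightarrow> E s \<in> borel_measurable (G t)"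
    and E: "AE \<omega> in M. E 0 \<omega> = 0 \<and> mono_on {0..} (\<lambda>t. E t \<omega>) \<and> continuous_on {0..} (\<lambda>t. E t \<omega>)"
    and q: "set_integrable lebesgue {0..} q" "\<And>u. q u \<ge> 0"
    and L: "linear L" "\<And>v. norm (L v) \<le> K * norm v" "K \<ge> 0" "\<And>v. c * norm v \<le> norm (L v)" "c > 0"
    and a: "linear a"
    and dis: "\<And>v. inner (L v) (L (a v)) \<le> - \<mu> * (norm (L v))\<^sup>2" "\<mu> \<ge> 0"
    and J: "has_stochastic_integral M G N E H J"
    and X: "AE \<omega> in M. continuous_on {0..} (\<lambda>t. X t \<omega>)"
       "AE \<omega> in M. \<forall>t\<ge>0. X t \<omega> = x0 + (LINT s:{0..t}|stieltjes_measure E \<omega>. a (X s \<omega>)) + J t \<omega>"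
    and H: "AE \<omega> in M. \<forall>t\<ge>0. (norm (H t \<omega>))\<^sup>2 \<le> q (E t \<omega>) * (norm (X t \<omega>))\<^sup>2"
    and Z: "Z \<in> borel_measurable (G 0)" "\<And>\<omega>. 0 \<le> Z \<omega>" "\<And>\<omega>. Z \<omega> \<le> 1"
    and "T \<ge> 0" and \<epsilon>: "\<epsilon> > 0"
  shows "(\<integral>\<^sup>+\<omega>. ennreal (Z \<omega> * exp (2 * \<mu> * E T \<omega> - C * \<Gamma> (E T \<omega>)) * (norm (L (X T \<omega>)))\<^sup>2) \<partial>M)
     \<le> ennreal ((\<integral>\<omega>. Z \<omega> \<partial>M) * ((norm (L x0))\<^sup>2 + \<epsilon>))"
proof -
  interpret prob_space M by fact
  have subM: "subalgebra M (G t)" if "0 \<le> t" for t using N(2) that by (auto simp: martingale_def)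
  have sub: "subalgebra (G t) (G s)" if "0 \<le> s" "s \<le> t" for s t using N(2) that by (auto simp: martingale_def)
  obtain S where S: "\<And>k. simple_predictable G (S k)"
    and conv: "AE \<omega> in M. \<forall>T\<ge>0.
           (\<lambda>k. \<integral>\<^sup>+s\<in>{0..T}. ennreal ((norm (simple_value (S k) s \<omega> - H s \<omega>))\<^sup>2)
                  \<partial>stieltjes_measure E \<omega>) \<longlonglongrightarrow> 0 \<and>
           uniform_limit {0..T} (\<lambda>k t. simple_integral N (S k) t \<omega>) (\<lambda>t. J t \<omega>) sequentially"
    and Hm: "AE \<omega> in M. set_borel_measurable borel {0..} (\<lambda>s. H s \<omega>)"
    using J unfolding has_stochastic_integral_def by blast
  define P where "P k = fst ` set (S k) \<union> (\<lambda>(a, b, x). b) ` set (S k)" for k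
  define \<delta> where "\<delta> k = 1 / real (Suc k)" for k
  have "\<exists>\<tau> m. incseq \<tau> \<and> \<tau> 0 = 0 \<and> (\<forall>i\<ge>m. \<tau> i = T) \<and> (\<forall>i. \<tau> (Suc i) - \<tau> i \<le> \<delta> k) \<and>
      (\<forall>i. \<forall>p\<in>P k. \<not> (\<tau> i < p \<and> p < \<tau> (Suc i)))" for k
  proof (rule refining_grid)
    show "finite (P k)" by (simp add: P_def)
    show "0 \<le> T" by fact
    show "0 < \<delta> k" by (simp add: \<delta>_def)
  next
    fix \<tau> :: "nat \<Rightarrow> real" and m
    assume "incseq \<tau>" "\<tau> 0 = 0" "\<And>i. m \<le> i \<Longrightarrow> \<tau> i = T" "\<And>i. \<tau> (Suc i) - \<tau> i \<le> \<delta> k"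
      "\<And>i p. p \<in> P k \<Longrightarrow> \<not> (\<tau> i < p \<and> p < \<tau> (Suc i))"
    then show ?thesis by (intro exI[of _ \<tau>] exI[of _ m]) blast
  qed
  then obtain \<tau> m where \<tau>m: "\<forall>k. incseq (\<tau> k) \<and> \<tau> k 0 = 0 \<and> (\<forall>i\<ge>m k. \<tau> k i = T) \<and> (\<forall>i. \<tau> k (Suc i) - \<tau> k i \<le> \<delta> k) \<and>
      (\<forall>i. \<forall>p\<in>P k. \<not> (\<tau> k i < p \<and> p < \<tau> k (Suc i)))"
    by metis
  have \<tau>: "incseq (\<tau> k)" "\<tau> k 0 = 0" "\<tau> k (Suc i) - \<tau> k i \<le> \<delta> k" for k i
    using \<tau>m by auto
  have \<tau>T: "\<tau> k (m k) = T" for k using \<tau>m by auto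
  have \<tau>le: "\<tau> k i \<le> T" for k i
    using incseqD[OF \<tau>(1)[of k], of i "max i (m k)"] \<tau>m by (metis max.cobounded1 max.cobounded2)
  have t0: "0 \<le> \<tau> k i" for k i using incseqD[OF \<tau>(1), of 0 i k] \<tau>(2)[of k] by simp
  have tS: "\<tau> k i \<le> \<tau> k (Suc i)" for k i using \<tau>(1) by (simp add: incseq_SucD)
  define \<xi> where "\<xi> k i = simple_value (S k) (\<tau> k (Suc i))" for k i
  have cell: "\<not> (\<tau> k i < a \<and> a < \<tau> k (Suc i)) \<and> \<not> (\<tau> k i < b \<and> b < \<tau> k (Suc i))"
    if "(a, b, x) \<in> set (S k)" for a b x k i
  proof -
    have "a \<in> P k" "b \<in> P k" using that by (force simp: P_def)+
    then show ?thesis using \<tau>m by blast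
  qed
  have sp1: "simple_value (S k) r \<omega> = \<xi> k i \<omega>" if "r \<in> {\<tau> k i<..\<tau> k (Suc i)}" for k i r \<omega>
    unfolding \<xi>_def
    by (rule simple_process_on_grid(1)[OF S _ t0 tS _ that]) (rule sub cell | assumption)+
  have sp2: "simple_integral N (S k) (\<tau> k (Suc i)) \<omega> - simple_integral N (S k) (\<tau> k i) \<omega> =
      (N (\<tau> k (Suc i)) \<omega> - N (\<tau> k i) \<omega>) *\<^sub>R \<xi> k i \<omega>" for k i \<omega>
    unfolding \<xi>_def
    by (rule simple_process_on_grid(2)[OF S _ t0 tS]) (rule sub cell | assumption)+
  have sp3: "\<xi> k i \<in> borel_measurable (G (\<tau> k i))" for k i
    unfolding \<xi>_def
    by (rule simple_process_on_grid(3)[OF S _ t0 tS]) (rule sub cell | assumption)+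
  have sp4: "\<exists>B. \<forall>\<omega>\<in>space M. norm (\<xi> k i \<omega>) \<le> B" for k i
  proof -
    have "\<exists>B. \<forall>\<omega>\<in>space (G (\<tau> k i)). norm (\<xi> k i \<omega>) \<le> B"
      unfolding \<xi>_def
      by (rule simple_process_on_grid(4)[OF S _ t0 tS]) (rule sub cell | assumption)+
    then show ?thesis using subM[OF t0[of k i]] by (simp add: subalgebra_def)
  qed
  have \<delta>0: "\<delta> \<longlonglongrightarrow> 0" unfolding \<delta>_def by (rule LIMSEQ_Suc[OF lim_1_over_n])
  have \<Gamma>mono: "mono \<Gamma>"
  proof (rule monoI)
    fix u v :: real assume "u \<le> v"
    have int: "integrable lebesgue (\<lambda>x. indicat_real {0..u} x *\<^sub>R q x)" for u
      using set_integrable_subset[OF q(1), of "{0..u}"] by (auto simp: set_integrable_def)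
    show "\<Gamma> u \<le> \<Gamma> v"
      unfolding \<Gamma>_def set_lebesgue_integral_def
      by (rule integral_mono[OF int int]) (use \<open>u \<le> v\<close> q(2) in \<open>auto split: split_indicator\<close>)
  qed
  have \<Gamma>0: "\<Gamma> 0 = 0"
  proof -
    have "AE x in lebesgue. x \<notin> {0::real}" by (rule AE_not_in) auto
    then have "AE x in lebesgue. indicat_real {0..0} x *\<^sub>R q x = 0"
      by eventually_elim (simp split: split_indicator)
    then show ?thesis unfolding \<Gamma>_def set_lebesgue_integral_def by (rule integral_eq_zero_AE)
  qed
  define y where "y k \<omega> = euler_scheme a x0 (\<lambda>i. E (\<tau> k i) \<omega>) (\<lambda>i. (N (\<tau> k (Suc i)) \<omega> - N (\<tau> k i) \<omega>) *\<^sub>R \<xi> k i \<omega>)" for k \<omega>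
  define w where "w k i \<omega> = exp (2 * \<mu> * E (\<tau> k i) \<omega> - C * \<Gamma> (E (\<tau> k i) \<omega>))" for k i \<omega>
  define D where "D k i \<omega> = (E (\<tau> k (Suc i)) \<omega> - E (\<tau> k i) \<omega>)\<^sup>2 * (norm (L (a (y k \<omega> i))))\<^sup>2 +
       (E (\<tau> k (Suc i)) \<omega> - E (\<tau> k i) \<omega>) * (norm (L (\<xi> k i \<omega>)))\<^sup>2 -
       C * (\<Gamma> (E (\<tau> k (Suc i)) \<omega>) - \<Gamma> (E (\<tau> k i) \<omega>)) * (norm (L (y k \<omega> i)))\<^sup>2" for k i \<omega>
  define good where "good k i \<omega> \<longleftrightarrow> (\<forall>l\<in>{..Suc i}. 0 \<le> E (\<tau> k l) \<omega> \<and> E (\<tau> k l) \<omega> \<le> real k) \<and>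
       (\<forall>l\<in>{..i}. norm (y k \<omega> l) \<le> real k) \<and>
       (\<Sum>l\<le>i. w k (Suc l) \<omega> * max 0 (D k l \<omega>)) \<le> \<epsilon>" for k i \<omega>
  have E': "AE \<omega> in M. E 0 \<omega> = 0 \<and> mono_on {0..} (\<lambda>t. E t \<omega>)" using E by eventually_elim auto
  have C0: "C \<ge> 0" by (simp add: C_def)
  note hyps = Em E' \<tau>(1,2) sp3 sp4 L(1) a dis \<Gamma>mono \<Gamma>0 C0 Z less_imp_le[OF \<epsilon>]
  \<comment> \<open>The bounds on scheme and clock grow with \<open>k\<close>, so that almost every path is eventually not stopped.\<close>
  define u where "u k \<omega> = ennreal (of_bool (good k (m k) \<omega>) * (Z \<omega> * w k (m k) \<omega> * (norm (L (y k \<omega> (m k))))\<^sup>2))" for k \<omega>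
  have um: "u k \<in> borel_measurable M" for k
    unfolding u_def good_def D_def w_def y_def
    by (rule stopped_energy_estimate(1)[OF M N]) (rule hyps | assumption)+
  have uI: "(\<integral>\<^sup>+\<omega>. u k \<omega> \<partial>M) \<le> ennreal ((\<integral>\<omega>. Z \<omega> \<partial>M) * ((norm (L x0))\<^sup>2 + \<epsilon>))" for k
    unfolding u_def good_def D_def w_def y_def
    by (rule stopped_energy_estimate(2)[OF M N]) (rule hyps | assumption)+
  have lim: "AE \<omega> in M. (\<lambda>k. u k \<omega>) \<longlonglongrightarrow> ennreal (Z \<omega> * exp (2 * \<mu> * E T \<omega> - C * \<Gamma> (E T \<omega>)) * (norm (L (X T \<omega>)))\<^sup>2)"
    using E conv Hm X H
  proof eventually_elim
    fix \<omega>
    assume E: "E 0 \<omega> = 0 \<and> mono_on {0..} (\<lambda>t. E t \<omega>) \<and> continuous_on {0..} (\<lambda>t. E t \<omega>)"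
      and conv: "\<forall>T\<ge>0.
           (\<lambda>k. \<integral>\<^sup>+s\<in>{0..T}. ennreal ((norm (simple_value (S k) s \<omega> - H s \<omega>))\<^sup>2)
                  \<partial>stieltjes_measure E \<omega>) \<longlonglongrightarrow> 0 \<and>
           uniform_limit {0..T} (\<lambda>k t. simple_integral N (S k) t \<omega>) (\<lambda>t. J t \<omega>) sequentially"
      and Hm: "set_borel_measurable borel {0..} (\<lambda>s. H s \<omega>)"
      and Xc: "continuous_on {0..} (\<lambda>t. X t \<omega>)"
      and Xe: "\<forall>t\<ge>0. X t \<omega> = x0 + (LINT s:{0..t}|stieltjes_measure E \<omega>. a (X s \<omega>)) + J t \<omega>"
      and Hb: "\<forall>t\<ge>0. (norm (H t \<omega>))\<^sup>2 \<le> q (E t \<omega>) * (norm (X t \<omega>))\<^sup>2"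
    define F where "F s = E (max 0 s) \<omega>" for s
    have sm: "stieltjes_measure E \<omega> = interval_measure F" unfolding stieltjes_measure_def F_def ..
    have Fmono: "mono F" using E by (auto simp: F_def mono_def mono_on_def)
    have Fcont: "continuous_on UNIV F"
      unfolding F_def by (rule continuous_on_compose2[of "{0..}" "\<lambda>t. E t \<omega>"]) (use E in \<open>auto intro!: continuous_intros\<close>)
    have F0: "F 0 = 0" using E by (simp add: F_def)
    have FE: "F s = E s \<omega>" if "0 \<le> s" for s using that by (simp add: F_def)
    have F\<tau>: "F (\<tau> k i) = E (\<tau> k i) \<omega>" for k i using t0 by (rule FE)
    have Xc': "continuous_on {0..T} (\<lambda>t. X t \<omega>)" using Xc by (rule continuous_on_subset) auto
    have Xe': "X t \<omega> = x0 + (LINT s:{0..t}|interval_measure F. a (X s \<omega>)) + J t \<omega>" if "t \<in> {0..T}" for t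
      using Xe that unfolding sm by auto
    have Hb': "(norm (H s \<omega>))\<^sup>2 \<le> q (F s) * (norm (X s \<omega>))\<^sup>2" if "s \<in> {0..T}" for s
      using Hb that by (simp add: FE)
    have cv: "(\<lambda>k. \<integral>\<^sup>+s\<in>{0..T}. ennreal ((norm (simple_value (S k) s \<omega> - H s \<omega>))\<^sup>2) \<partial>interval_measure F) \<longlonglongrightarrow> 0"
      and ul: "uniform_limit {0..T} (\<lambda>k t. simple_integral N (S k) t \<omega>) (\<lambda>t. J t \<omega>) sequentially"
      using conv \<open>T \<ge> 0\<close> unfolding sm by auto
    have y_eq: "y k \<omega> = euler_scheme a x0 (\<lambda>i. F (\<tau> k i))
        (\<lambda>i. simple_integral N (S k) (\<tau> k (Suc i)) \<omega> - simple_integral N (S k) (\<tau> k i) \<omega>)" for k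
      unfolding y_def F\<tau> sp2 ..
    note hyps' = Fmono Fcont F0 q L a Xc' Xe' Hm Hb' \<tau>(1,2) \<tau>le \<tau>(3) \<delta>0 simple_value_measurable_time sp1 cv ul
          simple_integral_0[OF S] dis(2)
    have err: "\<forall>\<^sub>F k in sequentially. \<forall>i. norm (y k \<omega> i - X (\<tau> k i) \<omega>) \<le> \<eta>" if "\<eta> > 0" for \<eta>
      unfolding y_eq
      by (rule euler_scheme_converges(1)[where X = "\<lambda>t. X t \<omega>" and H = "\<lambda>t. H t \<omega>" and J = "\<lambda>t. J t \<omega>"
        and S = "\<lambda>k s. simple_value (S k) s \<omega>" and j = "\<lambda>k t. simple_integral N (S k) t \<omega>" and \<xi> = "\<lambda>k i. \<xi> k i \<omega>"
        and a = a and F = F and q = q and L = L and K = K and c = c and T = T and \<tau> = \<tau> and \<delta> = \<delta> and \<mu> = \<mu>])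
        (rule hyps' that | assumption)+
    have exc: "\<forall>\<^sub>F k in sequentially. \<forall>m. (\<Sum>i<m. w k (Suc i) \<omega> * max 0 (D k i \<omega>)) \<le> \<epsilon>"
      unfolding w_def D_def y_eq F\<tau>[symmetric] C_def \<Gamma>_def
      by (rule euler_scheme_converges(2)[where X = "\<lambda>t. X t \<omega>" and H = "\<lambda>t. H t \<omega>" and J = "\<lambda>t. J t \<omega>"
        and S = "\<lambda>k s. simple_value (S k) s \<omega>" and j = "\<lambda>k t. simple_integral N (S k) t \<omega>" and \<xi> = "\<lambda>k i. \<xi> k i \<omega>"
        and a = a and F = F and q = q and L = L and K = K and c = c and T = T and \<tau> = \<tau> and \<delta> = \<delta> and \<mu> = \<mu>])
        (rule hyps' \<epsilon> | assumption)+
    have "bounded ((\<lambda>t. X t \<omega>) ` {0..T})" using Xc' by (intro compact_imp_bounded compact_continuous_image) auto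
    then obtain R0 where R0: "\<And>s. s \<in> {0..T} \<Longrightarrow> norm (X s \<omega>) \<le> R0" unfolding bounded_iff by blast
    have err1: "\<forall>\<^sub>F k in sequentially. \<forall>i. norm (y k \<omega> i - X (\<tau> k i) \<omega>) \<le> 1"
      by (rule err) simp
    have good: "\<forall>\<^sub>F k in sequentially. good k (m k) \<omega>"
      using err1 exc eventually_ge_at_top[of "nat \<lceil>max (E T \<omega>) (R0 + 1)\<rceil>"]
    proof eventually_elim
      fix k
      assume y: "\<forall>i. norm (y k \<omega> i - X (\<tau> k i) \<omega>) \<le> 1"
        and s: "\<forall>m. (\<Sum>i<m. w k (Suc i) \<omega> * max 0 (D k i \<omega>)) \<le> \<epsilon>"
        and k: "k \<ge> nat \<lceil>max (E T \<omega>) (R0 + 1)\<rceil>"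
      have k': "E T \<omega> \<le> real k" "R0 + 1 \<le> real k" using k by linarith+
      have "0 \<le> E (\<tau> k l) \<omega>" "E (\<tau> k l) \<omega> \<le> real k" for l
        using monoD[OF Fmono t0[of k l]] monoD[OF Fmono \<tau>le[of k l]] k'(1) F0 FE[OF \<open>T \<ge> 0\<close>] by (auto simp: F\<tau>)
      moreover have "norm (y k \<omega> l) \<le> real k" for l
      proof -
        have "norm (y k \<omega> l) \<le> norm (X (\<tau> k l) \<omega>) + norm (y k \<omega> l - X (\<tau> k l) \<omega>)" by (rule norm_triangle_sub)
        also have "\<dots> \<le> R0 + 1" using R0[of "\<tau> k l"] t0[of k l] \<tau>le[of k l] y by (intro add_mono) auto
        finally show ?thesis using k'(2) by simp
      qed
      ultimately show "good k (m k) \<omega>"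
        using s[rule_format, of "Suc (m k)"] unfolding good_def by (simp only: lessThan_Suc_atMost) simp
    qed
    have yX: "(\<lambda>k. y k \<omega> (m k)) \<longlonglongrightarrow> X T \<omega>"
    proof (rule LIMSEQ_I)
      fix r :: real assume r: "0 < r"
      have "\<forall>\<^sub>F k in sequentially. norm (y k \<omega> (m k) - X T \<omega>) < r"
        using err[OF half_gt_zero[OF r]]
      proof (eventually_elim)
        case (elim k)
        then have "norm (y k \<omega> (m k) - X (\<tau> k (m k)) \<omega>) \<le> r / 2" by blast
        then show ?case using r \<tau>T by simp
      qed
      then show "\<exists>no. \<forall>n\<ge>no. norm (y n \<omega> (m n) - X T \<omega>) < r" by (simp add: eventually_sequentially)
    qed
    have "(\<lambda>k. Z \<omega> * exp (2 * \<mu> * E T \<omega> - C * \<Gamma> (E T \<omega>)) * (norm (L (y k \<omega> (m k))))\<^sup>2) \<longlonglongrightarrow>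
        Z \<omega> * exp (2 * \<mu> * E T \<omega> - C * \<Gamma> (E T \<omega>)) * (norm (L (X T \<omega>)))\<^sup>2"
      using linear_conv_bounded_linear[of L] L(1) yX by (intro tendsto_intros bounded_linear.tendsto[of L]) auto
    then have "(\<lambda>k. ennreal (Z \<omega> * exp (2 * \<mu> * E T \<omega> - C * \<Gamma> (E T \<omega>)) * (norm (L (y k \<omega> (m k))))\<^sup>2)) \<longlonglongrightarrow>
        ennreal (Z \<omega> * exp (2 * \<mu> * E T \<omega> - C * \<Gamma> (E T \<omega>)) * (norm (L (X T \<omega>)))\<^sup>2)"
      by (rule tendsto_ennrealI)
    moreover have "\<forall>\<^sub>F k in sequentially.
        ennreal (Z \<omega> * exp (2 * \<mu> * E T \<omega> - C * \<Gamma> (E T \<omega>)) * (norm (L (y k \<omega> (m k))))\<^sup>2) = u k \<omega>"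
      using good by eventually_elim (simp add: u_def w_def \<tau>T)
    ultimately show "(\<lambda>k. u k \<omega>) \<longlonglongrightarrow> ennreal (Z \<omega> * exp (2 * \<mu> * E T \<omega> - C * \<Gamma> (E T \<omega>)) * (norm (L (X T \<omega>)))\<^sup>2)"
      by (rule Lim_transform_eventually)
  qed
  have "(\<integral>\<^sup>+\<omega>. ennreal (Z \<omega> * exp (2 * \<mu> * E T \<omega> - C * \<Gamma> (E T \<omega>)) * (norm (L (X T \<omega>)))\<^sup>2) \<partial>M) =
      (\<integral>\<^sup>+\<omega>. liminf (\<lambda>k. u k \<omega>) \<partial>M)"
    by (intro nn_integral_cong_AE, use lim in eventually_elim) (simp add: lim_imp_Liminf)
  also have "\<dots> \<le> liminf (\<lambda>k. \<integral>\<^sup>+\<omega>. u k \<omega> \<partial>M)" using um by (rule nn_integral_liminf)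
  also have "\<dots> \<le> ennreal ((\<integral>\<omega>. Z \<omega> \<partial>M) * ((norm (L x0))\<^sup>2 + \<epsilon>))"
    using uI by (intro Liminf_le) (auto intro: always_eventually)
  finally show ?thesis .
qed

theorem theorem3p3:
  fixes M :: "'w measure"
    and B U E :: "real \<Rightarrow> 'w \<Rightarrow> real"
    and \<beta> :: real
    and A :: "real^'n^'n"
    and f :: "real \<Rightarrow> real^'n \<Rightarrow> real^'n"
    and g :: "real \<Rightarrow> real"
    and X :: "real^'n \<Rightarrow> real \<Rightarrow> 'w \<Rightarrow> real^'n"
  assumes "prob_space M"
    and "standard_brownian_motion M B"
    and "0 < \<beta>" and "\<beta> < 1" and "stable_subordinator M \<beta> U"
    and "E = inverse_subordinator U"
    and "square_integrable_martingale M (time_changed_filtration M B E) (\<lambda>t \<omega>. B (E t \<omega>) \<omega>)"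
    and "quadratic_variation M (time_changed_filtration M B E) (\<lambda>t \<omega>. B (E t \<omega>) \<omega>) E"
    and "\<forall>z\<in>eigenvalues A. Re z < 0"
    and "\<forall>s\<ge>0. f s 0 = 0"
    and "\<forall>x0. time_changed_sde_solution M B E A f x0 (X x0)"
    and "\<forall>x0. AE \<omega> in M. \<forall>t\<ge>0. norm (f (E t \<omega>) (X x0 t \<omega>)) \<le> norm (g (E t \<omega>)) * norm (X x0 t \<omega>)"
    and "set_integrable lebesgue {0..} (\<lambda>s. (norm (g s))\<^sup>2)"
  shows "square_mean_asymptotically_stable M X"
proof -
  interpret prob_space M by fact
  define G where "G = time_changed_filtration M B E"
  define N where "N = (\<lambda>t \<omega>. B (E t \<omega>) \<omega>)"
  define q where "q s = (norm (g s))\<^sup>2" for s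
  have q: "set_integrable lebesgue {0..} q" "\<And>u. q u \<ge> 0" using assms(13) by (auto simp: q_def[abs_def])
  have N: "square_integrable_martingale M G N" "martingale M G (\<lambda>t \<omega>. (N t \<omega>)\<^sup>2 - E t \<omega>)"
    and E: "AE \<omega> in M. E 0 \<omega> = 0 \<and> mono_on {0..} (\<lambda>t. E t \<omega>) \<and> continuous_on {0..} (\<lambda>t. E t \<omega>)"
    using assms(7,8) by (auto simp: quadratic_variation_def G_def N_def)
  have Em: "E s \<in> borel_measurable (G t)" if "0 \<le> s" "0 \<le> t" for s t
    unfolding G_def by (rule clock_measurable_time_changed_filtration[OF that])
  have EM: "E s \<in> borel_measurable M" if "0 \<le> s" for s
    using N(2) Em[OF that order_refl] by (auto simp: martingale_def intro: measurable_from_subalg)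
  have E0: "AE \<omega> in M. \<forall>t\<ge>0. 0 \<le> E t \<omega>"
    using E by eventually_elim (force simp: mono_on_def)
  obtain L :: "real^'n \<Rightarrow> complex^'n" and \<mu> where L: "linear L" "inj L" and \<mu>: "\<mu> > 0"
    and dis: "\<And>x. inner (L x) (L (A *v x)) \<le> - \<mu> * (norm (L x))\<^sup>2"
    using lyapunov_transform[OF assms(9)] by metis
  obtain c where c: "c > 0" "\<And>v. c * norm v \<le> norm (L v)"
    using linear_inj_bounded_below_pos[OF L] by (metis mult.commute)
  obtain K where K: "K > 0" "\<And>v. norm (L v) \<le> K * norm v"
    using linear_bounded_pos[OF L(1)] by (metis mult.commute)
  \<comment> \<open>The constant for which \<open>C q\<close> dominates the noise intensity, as provided by the energy bound.\<close>
  define C where "C = 2 * K\<^sup>2 / c\<^sup>2"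
  define \<Gamma> where "\<Gamma> u = (LINT v:{0..u}|lebesgue. q v)" for u
  define \<Gamma>m where "\<Gamma>m = (LINT v:{0..}|lebesgue. q v)"
  have \<Gamma>le: "\<Gamma> u \<le> \<Gamma>m" for u
    unfolding \<Gamma>_def \<Gamma>m_def set_lebesgue_integral_def
  proof (rule integral_mono)
    show "integrable lebesgue (\<lambda>x. indicat_real {0..u} x *\<^sub>R q x)"
      using set_integrable_subset[OF q(1), of "{0..u}"] by (auto simp: set_integrable_def)
    show "integrable lebesgue (\<lambda>x. indicat_real {0..} x *\<^sub>R q x)"
      using q(1) by (auto simp: set_integrable_def)
  qed (use q(2) in \<open>auto split: split_indicator\<close>)
  have C0: "C \<ge> 0" by (simp add: C_def)
  \<comment> \<open>This random variable is known at time \<open>0\<close> and cancels the growing factor of the weight at time \<open>t\<close>. The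
      maximum only matters on a null set.\<close>
  define Z where "Z t \<omega> = exp (- (2 * \<mu> * max 0 (E t \<omega>)))" for t \<omega>
  have Zm: "Z t \<in> borel_measurable (G 0)" if "0 \<le> t" for t
    unfolding Z_def using Em[OF that order_refl] by measurable
  have ZM: "Z t \<in> borel_measurable M" if "0 \<le> t" for t
    unfolding Z_def using EM[OF that] by measurable
  have Z01: "0 \<le> Z t \<omega>" "Z t \<omega> \<le> 1" for t \<omega>
    using \<mu> by (auto simp: Z_def)
  define \<nu> where "\<nu> t = (if 0 \<le> t then \<integral>\<omega>. Z t \<omega> \<partial>M else 0)" for t
  have \<nu>01: "0 \<le> \<nu> t" "\<nu> t \<le> 1" for t
  proof -
    show "0 \<le> \<nu> t" using Z01 by (simp add: \<nu>_def)
    show "\<nu> t \<le> 1"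
    proof (cases "0 \<le> t")
      case True
      have "(\<integral>\<omega>. Z t \<omega> \<partial>M) \<le> (\<integral>\<omega>. 1 \<partial>M)"
        using Z01 ZM[OF True] by (intro integral_mono integrable_const_bound[where B = 1]) auto
      then show ?thesis using True by (simp add: \<nu>_def prob_space)
    qed (simp add: \<nu>_def)
  qed
  have \<nu>lim: "(\<nu> \<longlongrightarrow> 0) at_top"
  proof -
    have "((\<lambda>t. \<integral>\<omega>. Z (max 0 t) \<omega> \<partial>M) \<longlongrightarrow> (\<integral>\<omega>. 0 \<partial>M)) at_top"
    proof (rule integral_dominated_convergence_at_top[where w = "\<lambda>_. 1"])
      show "\<forall>\<^sub>F t in at_top. AE \<omega> in M. norm (Z (max 0 t) \<omega>) \<le> 1"
        using Z01 by (intro always_eventually) simp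
      have "AE \<omega> in M. filterlim (\<lambda>t. E t \<omega>) at_top at_top"
        using inverse_subordinator_tendsto_infinity[OF assms(1,5)] by (simp add: assms(6))
      then show "AE \<omega> in M. ((\<lambda>t. Z (max 0 t) \<omega>) \<longlongrightarrow> 0) at_top"
      proof eventually_elim
        fix \<omega> assume lim: "filterlim (\<lambda>t. E t \<omega>) at_top at_top"
        have "filterlim (\<lambda>t. 2 * \<mu> * E t \<omega>) at_top at_top"
          using \<mu> lim by (intro filterlim_tendsto_pos_mult_at_top[OF tendsto_const]) auto
        then have "((\<lambda>t. exp (- (2 * \<mu> * E t \<omega>))) \<longlongrightarrow> 0) at_top"
          by (intro filterlim_compose[OF exp_at_bot]) (simp add: filterlim_uminus_at_bot)
        moreover have "\<forall>\<^sub>F t in at_top. exp (- (2 * \<mu> * E t \<omega>)) = Z (max 0 t) \<omega>"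
          using eventually_ge_at_top[of 0] filterlim_at_top[THEN iffD1, OF lim, rule_format, of 0]
          by eventually_elim (simp add: Z_def max_def)
        ultimately show "((\<lambda>t. Z (max 0 t) \<omega>) \<longlongrightarrow> 0) at_top" by (rule Lim_transform_eventually)
      qed
    qed (use ZM in auto)
    moreover have "\<forall>\<^sub>F t in at_top. (\<integral>\<omega>. Z (max 0 t) \<omega> \<partial>M) = \<nu> t"
      using eventually_ge_at_top[of 0] by eventually_elim (simp add: \<nu>_def)
    ultimately show ?thesis by (simp add: Lim_transform_eventually)
  qed
  \<comment> \<open>Lower bound for the remaining weight \<open>exp (- C \<Gamma>)\<close>, times the constant in \<open>c |x| \<le> |L x|\<close> squared.\<close>
  define e0 where "e0 = exp (- (C * \<Gamma>m)) * c\<^sup>2"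
  have e0: "e0 > 0" using c by (simp add: e0_def)
  have bound: "(\<integral>\<^sup>+\<omega>. ennreal ((norm (X x0 t \<omega>))\<^sup>2) \<partial>M) \<le> ennreal (K\<^sup>2 / e0 * (norm x0)\<^sup>2 * \<nu> t)"
    if t: "0 \<le> t" for x0 t
  proof -
    obtain J where J: "has_stochastic_integral M G N E (\<lambda>s \<omega>. f (E s \<omega>) (X x0 s \<omega>)) J"
      and Xe: "AE \<omega> in M. \<forall>t\<ge>0.
             X x0 t \<omega> = x0 + (LINT s:{0..t}|stieltjes_measure E \<omega>. A *v X x0 s \<omega>) + J t \<omega>"
      and Xc: "AE \<omega> in M. continuous_on {0..} (\<lambda>t. X x0 t \<omega>)"
      and Xm: "X x0 t \<in> borel_measurable (G t)"
      using assms(11) t unfolding time_changed_sde_solution_def G_def N_def by blast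
    have XM: "X x0 t \<in> borel_measurable M"
      using N(2) Xm t by (auto simp: martingale_def intro: measurable_from_subalg)
    have H: "AE \<omega> in M. \<forall>t\<ge>0. (norm (f (E t \<omega>) (X x0 t \<omega>)))\<^sup>2 \<le> q (E t \<omega>) * (norm (X x0 t \<omega>))\<^sup>2"
      using assms(12)[rule_format, of x0]
    proof eventually_elim
      fix \<omega> assume le: "\<forall>t\<ge>0. norm (f (E t \<omega>) (X x0 t \<omega>)) \<le> norm (g (E t \<omega>)) * norm (X x0 t \<omega>)"
      show "\<forall>t\<ge>0. (norm (f (E t \<omega>) (X x0 t \<omega>)))\<^sup>2 \<le> q (E t \<omega>) * (norm (X x0 t \<omega>))\<^sup>2"
      proof (intro allI impI)
        fix t :: real assume "0 \<le> t"
        then have "(norm (f (E t \<omega>) (X x0 t \<omega>)))\<^sup>2 \<le> (norm (g (E t \<omega>)) * norm (X x0 t \<omega>))\<^sup>2"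
          using le by (intro power_mono) auto
        then show "(norm (f (E t \<omega>) (X x0 t \<omega>)))\<^sup>2 \<le> q (E t \<omega>) * (norm (X x0 t \<omega>))\<^sup>2"
          by (simp add: q_def power_mult_distrib)
      qed
    qed
    have lin: "linear ((*v) A)" by simp
    let ?I = "\<integral>\<^sup>+\<omega>. ennreal ((norm (X x0 t \<omega>))\<^sup>2) \<partial>M"
    have "ennreal e0 * ?I = (\<integral>\<^sup>+\<omega>. ennreal (e0 * (norm (X x0 t \<omega>))\<^sup>2) \<partial>M)"
      using XM e0 by (simp add: nn_integral_cmult[symmetric] ennreal_mult)
    also have "\<dots> \<le> (\<integral>\<^sup>+\<omega>. ennreal (Z t \<omega> * exp (2 * \<mu> * E t \<omega> - C * \<Gamma> (E t \<omega>)) * (norm (L (X x0 t \<omega>)))\<^sup>2) \<partial>M)"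
    proof (intro nn_integral_mono_AE, use E0 in eventually_elim, rule ennreal_leI)
      fix \<omega> assume "\<forall>t\<ge>0. 0 \<le> E t \<omega>"
      then have "0 \<le> E t \<omega>" using t by simp
      then have "Z t \<omega> * exp (2 * \<mu> * E t \<omega> - C * \<Gamma> (E t \<omega>)) = exp (- (C * \<Gamma> (E t \<omega>)))"
        by (simp add: Z_def flip: exp_add)
      moreover have "exp (- (C * \<Gamma>m)) \<le> exp (- (C * \<Gamma> (E t \<omega>)))"
        using C0 \<Gamma>le by (simp add: mult_left_mono)
      moreover have "c\<^sup>2 * (norm (X x0 t \<omega>))\<^sup>2 \<le> (norm (L (X x0 t \<omega>)))\<^sup>2"
        using c by (simp flip: power_mult_distrib add: power_mono)
      ultimately show "e0 * (norm (X x0 t \<omega>))\<^sup>2 \<le>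
          Z t \<omega> * exp (2 * \<mu> * E t \<omega> - C * \<Gamma> (E t \<omega>)) * (norm (L (X x0 t \<omega>)))\<^sup>2"
        unfolding e0_def mult.assoc[of _ "c\<^sup>2"] by (auto intro!: mult_mono)
    qed
    also have "\<dots> \<le> ennreal (\<nu> t * (norm (L x0))\<^sup>2)"
    proof (rule ennreal_le_epsilon)
      fix \<epsilon> :: real assume \<epsilon>: "0 < \<epsilon>"
      have "(\<integral>\<^sup>+\<omega>. ennreal (Z t \<omega> * exp (2 * \<mu> * E t \<omega> - C * \<Gamma> (E t \<omega>)) * (norm (L (X x0 t \<omega>)))\<^sup>2) \<partial>M)
        \<le> ennreal ((\<integral>\<omega>. Z t \<omega> \<partial>M) * ((norm (L x0))\<^sup>2 + \<epsilon>))"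
        unfolding C_def \<Gamma>_def
        by (rule weighted_energy_bound[where a = "(*v) A", OF assms(1) N])
          (rule Em E q L(1) K(2) less_imp_le[OF K(1)] c lin dis less_imp_le[OF \<mu>] J Xc Xe H Zm[OF t] Z01 t \<epsilon> | assumption)+
      also have "\<dots> \<le> ennreal (\<nu> t * (norm (L x0))\<^sup>2 + \<epsilon>)"
        using mult_right_mono[OF \<nu>01(2)[of t], of \<epsilon>] \<epsilon> t by (intro ennreal_leI) (simp add: \<nu>_def distrib_left)
      also have "\<dots> = ennreal (\<nu> t * (norm (L x0))\<^sup>2) + ennreal \<epsilon>"
        using \<nu>01 \<epsilon> by (intro ennreal_plus) auto
      finally show "(\<integral>\<^sup>+\<omega>. ennreal (Z t \<omega> * exp (2 * \<mu> * E t \<omega> - C * \<Gamma> (E t \<omega>)) * (norm (L (X x0 t \<omega>)))\<^sup>2) \<partial>M)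
        \<le> ennreal (\<nu> t * (norm (L x0))\<^sup>2) + ennreal \<epsilon>" .
    qed
    also have "\<dots> \<le> ennreal (\<nu> t * (K * norm x0)\<^sup>2)"
      using \<nu>01 K by (intro ennreal_leI mult_left_mono power_mono) auto
    finally have le: "ennreal e0 * ?I \<le> ennreal (\<nu> t * (K * norm x0)\<^sup>2)" .
    have "?I = ennreal (1 / e0) * (ennreal e0 * ?I)"
      using e0 by (simp add: mult.assoc[symmetric] flip: ennreal_mult)
    also have "\<dots> \<le> ennreal (1 / e0) * ennreal (\<nu> t * (K * norm x0)\<^sup>2)" using le by (rule mult_left_mono) simp
    also have "\<dots> = ennreal (K\<^sup>2 / e0 * (norm x0)\<^sup>2 * \<nu> t)"
      using e0 \<nu>01 by (subst ennreal_mult[symmetric]) (auto simp: power_mult_distrib mult.commute mult.left_commute)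
    finally show ?thesis .
  qed
  show ?thesis
    unfolding square_mean_asymptotically_stable_def
  proof (intro exI conjI allI impI)
    show "0 < K\<^sup>2 / e0" using K e0 by simp
  qed (use \<nu>01 \<nu>lim bound in auto)
qed

end
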